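(* Let $A=\begin{pmatrix} A_{11} & A_{12} \\ A_{21} & A_{22} \end{pmatrix}\in\mathrm{GL}(2d,\mathbb{R})$ be right-regular and let $1\le p,q\le\infty$. The quantization mapping $$\sigma\in L^q(\mathbb{R}^{2d})\ \longmapsto\ \sigma^A\in\mathcal{L}\big(L^p(\mathbb{R}^d)\big)$$ is continuous if and only if $q\le 2$ and $q\le p\le q'$, with norm estimate $$\|\sigma^A\|_{L^p\to L^p}\le\frac{\|\sigma\|_{L^q}}{|\det A|^{\frac1{q'}}\,|\det A_{12}|^{\frac1p-\frac1{q'}}\,|\det A_{22}|^{\frac1{p'}-\frac1{q'}}}.$$
   Context: $p'$ denotes the conjugate exponent, $1/p+1/p'=1$. $\mathrm{GL}(2d,\mathbb{R})$ is the group of invertible real $2d\times 2d$ matrices. A block matrix with $d\times d$ blocks $A_{ij}$ is right-regular if $A_{12}$ and $A_{22}$ are invertible. The matrix-Wigner distribution associated with $A$ is $$\mathcal{B}_A(f,g)(x,\omega)=\int_{\mathbb{R}^d}e^{-2\pi i\omega\cdot y}f(A_{11}x+A_{12}y)\,\overline{g(A_{21}x+A_{22}y)}\,dy .$$ It maps $M^1(\mathbb{R}^d)\times M^1(\mathbb{R}^d)$ continuously into $M^1(\mathbb{R}^{2d})$. Here $M^r(\mathbb{R}^n)$ ($r=1,\infty$) is the space of tempered distributions $f$ whose short-time Fourier transform $V_\gamma f(x,\omega)=\langle f,e^{2\pi i\omega\cdot(\cdot)}\gamma(\cdot-x)\rangle$, for a fixed nonzero Schwartz window $\gamma$, belongs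 to $L^r(\mathbb{R}^{2n})$; one has $M^\infty=(M^1)'$. For $\sigma\in M^\infty(\mathbb{R}^{2d})$ (in particular $\sigma\in L^q(\mathbb{R}^{2d})$), the pseudodifferential operator $\sigma^A:M^1(\mathbb{R}^d)\to M^\infty(\mathbb{R}^d)$ is defined by $\langle\sigma^Af,g\rangle=\langle\sigma,\mathcal{B}_A(g,f)\rangle$ for $f,g\in M^1(\mathbb{R}^d)$, with $\langle\cdot,\cdot\rangle$ extending the $L^2$ inner product (conjugate-linear in the second argument). $\mathcal{L}(L^p(\mathbb{R}^d))$ is the space of bounded linear operators on $L^p(\mathbb{R}^d)$. Convention: continuity of the quantization mapping means that there is a constant $C>0$ with $\|\sigma^Af\|_{L^p}\le C\|\sigma\|_{L^q}\|f\|_{L^p}$ for all $\sigma\in L^q(\mathbb{R}^{2d})$ and all $f\in M^1(\mathbb{R}^d)$, and $\|\sigma^A\|_{L^p\to L^p}$ is the smallest constant $c$ such that $\|\sigma^Af\|_{L^p}\le c\|f\|_{L^p}$ for all $f\in M^1(\mathbb{R}^d)$.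
   Formalization: The exponents of |det A_12| and |det A_22| in the norm estimate are exchanged: |det A_12|^{1/p'-1/q'} |det A_22|^{1/p-1/q'}. As printed, the estimate fails, e.g. for d=1, A=((0,2),(1,1)), p=q=1. *)

theory Defs
  imports "HOL-Analysis.Analysis" "HOL-Probability.Essential_Supremum"
begin

subsection \<open>Lebesgue spaces\<close>

text \<open>Exponents are extended nonnegative reals, with \<^term>\<open>1 / (\<infinity> :: ennreal) = 0\<close>.
  Elements of $L^p$ are represented by Borel functions; \<open>Lp_norm\<close> is meaningful on \<open>Lp_space\<close> only.\<close>

definition Lp_space :: "ennreal \<Rightarrow> ('a::euclidean_space \<Rightarrow> complex) set" where
  "Lp_space p = {f \<in> borel_measurable lborel.
     if p = \<infinity> then esssup lborel (\<lambda>x. ennreal (norm (f x))) < \<infinity>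
     else integrable lborel (\<lambda>x. norm (f x) powr enn2real p)}"

definition Lp_norm :: "ennreal \<Rightarrow> ('a::euclidean_space \<Rightarrow> complex) \<Rightarrow> real" where
  "Lp_norm p f =
     (if p = \<infinity> then enn2real (esssup lborel (\<lambda>x. ennreal (norm (f x))))
      else (\<integral>x. norm (f x) powr enn2real p \<partial>lborel) powr (1 / enn2real p))"


subsection \<open>Schwartz functions and tempered distributions\<close>

primrec partials :: "'a list \<Rightarrow> ('a::euclidean_space \<Rightarrow> complex) \<Rightarrow> 'a \<Rightarrow> complex" where
  "partials [] f = f"
| "partials (v # vs) f = (\<lambda>x. frechet_derivative (partials vs f) (at x) v)"

definition schwartz :: "('a::euclidean_space \<Rightarrow> complex) set" where
  "schwartz = {\<phi>. \<forall>vs \<in> lists Basis.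
     (\<forall>x. partials vs \<phi> differentiable (at x)) \<and>
     (\<forall>k::nat. bounded (range (\<lambda>x. (1 + norm x) ^ k *\<^sub>R partials vs \<phi> x)))}"

definition schwartz_norm :: "nat \<Rightarrow> ('a::euclidean_space \<Rightarrow> complex) \<Rightarrow> real" where
  "schwartz_norm N \<phi> =
     (SUP vs \<in> {vs \<in> lists Basis. length vs \<le> N}. SUP x. (1 + norm x) ^ N * norm (partials vs \<phi> x))"

text \<open>A distribution \<open>T\<close> is given by its pairing $\varphi \mapsto \langle T, \varphi\rangle$, which
  extends the $L^2$ inner product and hence is conjugate-linear in $\varphi$. The values of \<open>T\<close>
  outside the relevant space of test functions are irrelevant.\<close>

definition L2_pairing :: "('a::euclidean_space \<Rightarrow> complex) \<Rightarrow> ('a \<Rightarrow> complex) \<Rightarrow> complex" where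
  "L2_pairing f g = (\<integral>x. f x * cnj (g x) \<partial>lborel)"

definition tempered_distribution :: "(('a::euclidean_space \<Rightarrow> complex) \<Rightarrow> complex) \<Rightarrow> bool" where
  "tempered_distribution T \<longleftrightarrow>
     (\<forall>\<phi>\<in>schwartz. \<forall>\<psi>\<in>schwartz. T (\<lambda>x. \<phi> x + \<psi> x) = T \<phi> + T \<psi>) \<and>
     (\<forall>c. \<forall>\<phi>\<in>schwartz. T (\<lambda>x. c * \<phi> x) = cnj c * T \<phi>) \<and>
     (\<exists>C N. \<forall>\<phi>\<in>schwartz. norm (T \<phi>) \<le> C * schwartz_norm N \<phi>)"


subsection \<open>Modulation spaces\<close>

definition stft ::
  "('a::euclidean_space \<Rightarrow> complex) \<Rightarrow> (('a \<Rightarrow> complex) \<Rightarrow> complex) \<Rightarrow> 'a \<times> 'a \<Rightarrow> complex" where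
  "stft \<gamma> T = (\<lambda>(x, \<omega>). T (\<lambda>t. cis (2 * pi * (\<omega> \<bullet> t)) * \<gamma> (t - x)))"

definition modulation_space ::
  "('a::euclidean_space \<Rightarrow> complex) \<Rightarrow> ennreal \<Rightarrow> (('a \<Rightarrow> complex) \<Rightarrow> complex) set" where
  "modulation_space \<gamma> r = {T. tempered_distribution T \<and> stft \<gamma> T \<in> Lp_space r}"

text \<open>The distributions in $M^1$ are regular; \<open>M1 \<gamma>\<close> consists of the functions representing them.\<close>

definition M1 :: "('a::euclidean_space \<Rightarrow> complex) \<Rightarrow> ('a \<Rightarrow> complex) set" where
  "M1 \<gamma> = {f \<in> borel_measurable lborel.
     (\<forall>\<phi>\<in>schwartz. integrable lborel (\<lambda>x. f x * cnj (\<phi> x))) \<and>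
     L2_pairing f \<in> modulation_space \<gamma> 1}"

text \<open>Elements of $M^\infty = (M^1)'$ are given by their pairing with \<open>M1 \<gamma>\<close>. The $L^p$ norm of such
  a functional \<open>u\<close> is \<open>\<infinity>\<close> unless \<open>u\<close> is represented by an $L^p$ function, which is then unique
  almost everywhere.\<close>

definition functional_Lp_norm ::
  "('a::euclidean_space \<Rightarrow> complex) \<Rightarrow> ennreal \<Rightarrow> (('a \<Rightarrow> complex) \<Rightarrow> complex) \<Rightarrow> ennreal" where
  "functional_Lp_norm \<gamma> p u =
     Inf {ennreal (Lp_norm p h) | h. h \<in> Lp_space p \<and> (\<forall>g \<in> M1 \<gamma>. u g = L2_pairing h g)}"


subsection \<open>Matrix-Wigner distributions and pseudodifferential operators\<close>

definition block11 :: "'e^('d::finite + 'd)^('d + 'd) \<Rightarrow> 'e^'d^'d" where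
  "block11 A = (\<chi> i j. A $ Inl i $ Inl j)"

definition block12 :: "'e^('d::finite + 'd)^('d + 'd) \<Rightarrow> 'e^'d^'d" where
  "block12 A = (\<chi> i j. A $ Inl i $ Inr j)"

definition block21 :: "'e^('d::finite + 'd)^('d + 'd) \<Rightarrow> 'e^'d^'d" where
  "block21 A = (\<chi> i j. A $ Inr i $ Inl j)"

definition block22 :: "'e^('d::finite + 'd)^('d + 'd) \<Rightarrow> 'e^'d^'d" where
  "block22 A = (\<chi> i j. A $ Inr i $ Inr j)"

definition right_regular :: "real^('d::finite + 'd)^('d + 'd) \<Rightarrow> bool" where
  "right_regular A \<longleftrightarrow> invertible (block12 A) \<and> invertible (block22 A)"

definition matrix_wigner :: "real^('d::finite + 'd)^('d + 'd) \<Rightarrow> (real^'d \<Rightarrow> complex) \<Rightarrow> (real^'d \<Rightarrow> complex)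
    \<Rightarrow> (real^'d) \<times> (real^'d) \<Rightarrow> complex" where
  "matrix_wigner A f g = (\<lambda>(x, \<omega>).
     \<integral>y. cis (- 2 * pi * (\<omega> \<bullet> y)) * f (block11 A *v x + block12 A *v y)
         * cnj (g (block21 A *v x + block22 A *v y)) \<partial>lborel)"

text \<open>The symbol \<open>\<sigma>\<close> is a functional on $M^1(\mathbb{R}^{2d})$; a function symbol \<open>s\<close> in $L^q$ enters
  as \<open>L2_pairing s\<close>. Note that the test function \<open>g\<close> is the first argument of \<open>matrix_wigner\<close>, so
  that it is \<open>g\<close> that is composed with \<open>block12 A\<close> and \<open>f\<close> that is composed with \<open>block22 A\<close>.\<close>

definition psido :: "real^('d::finite + 'd)^('d + 'd)
    \<Rightarrow> (((real^'d) \<times> (real^'d) \<Rightarrow> complex) \<Rightarrow> complex)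
    \<Rightarrow> (real^'d \<Rightarrow> complex) \<Rightarrow> (real^'d \<Rightarrow> complex) \<Rightarrow> complex" where
  "psido A \<sigma> f = (\<lambda>g. \<sigma> (matrix_wigner A g f))"

definition operator_Lp_norm :: "('a::euclidean_space \<Rightarrow> complex) \<Rightarrow> ennreal
    \<Rightarrow> (('a \<Rightarrow> complex) \<Rightarrow> ('a \<Rightarrow> complex) \<Rightarrow> complex) \<Rightarrow> ennreal" where
  "operator_Lp_norm \<gamma> p S = Inf {ennreal c | c. 0 \<le> c \<and>
     (\<forall>f \<in> M1 \<gamma>. functional_Lp_norm \<gamma> p (S f) \<le> ennreal (c * Lp_norm p f))}"

definition quantization_continuous ::
  "(real^'d::finite \<Rightarrow> complex) \<Rightarrow> real^('d + 'd)^('d + 'd) \<Rightarrow> ennreal \<Rightarrow> ennreal \<Rightarrow> bool" where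
  "quantization_continuous \<gamma> A q p \<longleftrightarrow> (\<exists>C>0. \<forall>s \<in> Lp_space q. \<forall>f \<in> M1 \<gamma>.
     functional_Lp_norm \<gamma> p (psido A (L2_pairing s) f) \<le> ennreal (C * Lp_norm q s * Lp_norm p f))"

end

theory Submission
  imports Defs "HOL-Complex_Analysis.Conformal_Mappings" "HOL-Probability.Sinc_Integral"
    "HOL-Probability.Characteristic_Functions"
begin

text \<open>
  Pairing $\sigma^A f$ with \<open>g\<close> gives the trilinear form $\int \sigma\, \overline{\mathcal{B}_A(g, f)}$. For
  $q = 1$ it is controlled by Hoelder's inequality in the inner variable, for every \<open>p\<close>; for
  $p = q = 2$ by Plancherel's inequality. These endpoints span the triangle $q \le 2$,
  $q \le p \le q'$ in the variables $(1/q, 1/p)$, and the three lines theorem interpolates with the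
  stated constant. Conversely, Gaussians \<open>f\<close> and \<open>g\<close>, one of width $\lambda$ and one of width
  $1$, and a symbol of width $1$ in \<open>x\<close> and $1/\lambda$ in \<open>\<omega>\<close> whose phase cancels the shear of \<open>A\<close>,
  give in the limit $\lambda \to 0$ the conditions $q \le p$ and $q \le p'$, and these imply $q \le 2$.
\<close>

section \<open>Linear changes of variables\<close>

text \<open>Put \<theta> = 2/q'. Then 1/q = 1 - \<theta>/2 and 1/p = (1 - \<theta>) a + \<theta>/2,
  where 1/a is the exponent used at the endpoint q = 1. That endpoint contributes the determinants
  of \<open>A12\<close> and \<open>A22\<close> to the powers -b and -a with a + b = 1, and the L2
  endpoint contributes |det A| to the power -1/2; weighting them by 1 - \<theta> and \<theta> gives
  1/p' - 1/q', 1/p - 1/q' and 1/q', the exponents of the theorem. Two obstacles shape the rest. A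
  bound on the form must be turned into an actual Lp function, also for p = 1, where a bounded form
  need not come from a function; hence kernels are built explicitly for integrable symbols and then
  summed. And elements of M1 are given only through the short-time Fourier transform for an
  arbitrary window, so each must be shown to be almost everywhere equal to a bounded integrable
  function before the estimates apply, and Gaussians must be shown to belong to M1 before they can
  serve as tests. The Fourier facts behind both, Plancherel's inequality and a sup bound for
  inversion, come from one Gaussian regularisation.\<close>

lemma nn_integral_lborel_shear:
  fixes \<phi> :: "real^'n \<Rightarrow> ennreal"
  assumes [measurable]: "\<phi> \<in> borel_measurable borel" and mn: "m \<noteq> n"
  shows "(\<integral>\<^sup>+x. \<phi> (x + x $ n *\<^sub>R axis m 1) \<partial>lborel) = (\<integral>\<^sup>+x. \<phi> x \<partial>lborel)"
proof -
  interpret P: product_sigma_finite "\<lambda>_::real^'n. lborel::real measure" ..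
  define B where "B = Basis - {axis m (1::real) :: real^'n}"
  have bm: "axis m 1 \<in> (Basis::(real^'n) set)" by (simp add: axis_in_Basis_iff)
  have BB: "Basis = insert (axis m 1) B" and B: "finite B" "axis m 1 \<notin> B"
    using bm by (auto simp: B_def)
  define J where "J f = (\<Sum>b\<in>Basis. f b *\<^sub>R b)" for f :: "real^'n \<Rightarrow> real"
  have J_n: "J f $ n = f (axis n 1)" for f
  proof -
    have "J f $ n = J f \<bullet> axis n 1" by (simp add: cart_eq_inner_axis)
    also have "\<dots> = f (axis n 1)"
      unfolding J_def by (subst inner_sum_left_Basis) (auto simp: axis_in_Basis_iff)
    finally show ?thesis .
  qed
  have [measurable]: "J \<in> borel_measurable (Pi\<^sub>M Basis (\<lambda>_. lborel))"
    unfolding J_def by measurable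
  have lb: "(\<integral>\<^sup>+x. \<psi> x \<partial>lborel) = (\<integral>\<^sup>+f. (\<integral>\<^sup>+y. \<psi> (J (f(axis m 1 := y))) \<partial>lborel) \<partial>Pi\<^sub>M B (\<lambda>_. lborel))"
    if [measurable]: "\<psi> \<in> borel_measurable borel" for \<psi> :: "real^'n \<Rightarrow> ennreal"
  proof -
    have "(\<integral>\<^sup>+x. \<psi> x \<partial>lborel) = (\<integral>\<^sup>+f. \<psi> (J f) \<partial>Pi\<^sub>M Basis (\<lambda>_. lborel))"
      unfolding J_def by (subst lborel_eq) (simp add: nn_integral_distr)
    also have "\<dots> = (\<integral>\<^sup>+f. (\<integral>\<^sup>+y. \<psi> (J (f(axis m 1 := y))) \<partial>lborel) \<partial>Pi\<^sub>M B (\<lambda>_. lborel))"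
    proof (subst BB, rule P.product_nn_integral_insert[OF B])
      show "(\<lambda>f. \<psi> (J f)) \<in> borel_measurable (Pi\<^sub>M (insert (axis m 1) B) (\<lambda>_. lborel))"
        unfolding BB[symmetric] by measurable
    qed
    finally show ?thesis .
  qed
  \<comment> \<open>With all coordinates but the \<open>m\<close>-th fixed, the shear translates
    that coordinate by the constant \<open>f (axis n 1)\<close>. The slope is written as
    \<open>1 * y\<close> to fit the affine substitution on the line.\<close>
  have shift: "J (f(axis m 1 := y)) + J (f(axis m 1 := y)) $ n *\<^sub>R axis m 1
      = J (f(axis m 1 := f (axis n 1) + 1 * y))" for f y
  proof -
    have *: "J (f(axis m 1 := y)) = y *\<^sub>R axis m 1 + (\<Sum>b\<in>B. f b *\<^sub>R b)" for y
      unfolding J_def BB using B by (auto intro!: sum.cong)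
    have "J (f(axis m 1 := y)) $ n = f (axis n 1)"
      using mn by (simp add: J_n axis_eq_axis)
    then show ?thesis by (simp add: * algebra_simps)
  qed
  have "(\<integral>\<^sup>+x. \<phi> (x + x $ n *\<^sub>R axis m 1) \<partial>lborel) =
    (\<integral>\<^sup>+f. (\<integral>\<^sup>+y. \<phi> (J (f(axis m 1 := f (axis n 1) + 1 * y))) \<partial>lborel) \<partial>Pi\<^sub>M B (\<lambda>_. lborel))"
    by (subst lb) (simp_all only: shift, measurable)
  also have "\<dots> = (\<integral>\<^sup>+f. (\<integral>\<^sup>+y. \<phi> (J (f(axis m 1 := y))) \<partial>lborel) \<partial>Pi\<^sub>M B (\<lambda>_. lborel))"
  proof (rule nn_integral_cong)
    fix f assume f: "f \<in> space (Pi\<^sub>M B (\<lambda>_. lborel::real measure))"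
    have "(\<lambda>y. f(axis m 1 := y)) \<in> borel \<rightarrow>\<^sub>M Pi\<^sub>M (insert (axis m 1) B) (\<lambda>_. lborel)"
      by (rule measurable_fun_upd[where J=B]) (use f in auto)
    then have [measurable]: "(\<lambda>y. \<phi> (J (f(axis m 1 := y)))) \<in> borel_measurable borel"
      unfolding BB[symmetric] by measurable
    show "(\<integral>\<^sup>+y. \<phi> (J (f(axis m 1 := f (axis n 1) + 1 * y))) \<partial>lborel)
        = (\<integral>\<^sup>+y. \<phi> (J (f(axis m 1 := y))) \<partial>lborel)"
      by (subst (2) nn_integral_real_affine[where c=1 and t="f (axis n 1)"]) (simp_all, measurable)
  qed
  also have "\<dots> = (\<integral>\<^sup>+x. \<phi> x \<partial>lborel)" by (rule lb[symmetric]) measurable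
  finally show ?thesis .
qed

text \<open>Lebesgue measure is determined by the volumes of boxes, and permuting coordinates sends
  boxes to boxes with the same side lengths.\<close>

lemma nn_integral_lborel_permute:
  fixes \<phi> :: "real^'n \<Rightarrow> ennreal"
  assumes [measurable]: "\<phi> \<in> borel_measurable borel" and p: "bij (p :: 'n \<Rightarrow> 'n)"
  shows "(\<integral>\<^sup>+x. \<phi> (\<chi> i. x $ p i) \<partial>lborel) = (\<integral>\<^sup>+x. \<phi> x \<partial>lborel)"
proof -
  have [measurable]: "(\<lambda>x::real^'n. \<chi> i. x $ p i) \<in> borel_measurable borel"
    by (intro borel_measurable_continuous_onI continuous_intros)
  have "lborel = distr lborel borel (\<lambda>x::real^'n. \<chi> i. x $ p i)"
  proof (rule lborel_eqI)
    fix l u :: "real^'n"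
    assume le: "\<And>b. b \<in> Basis \<Longrightarrow> l \<bullet> b \<le> u \<bullet> b"
    have le': "l $ i \<le> u $ i" for i
      using le[of "axis i 1"] by (simp add: cart_eq_inner_axis axis_in_Basis_iff)
    have eq: "(\<lambda>x::real^'n. \<chi> i. x $ p i) -` box l u = box (\<chi> i. l $ inv p i) (\<chi> i. u $ inv p i)"
      using p by (auto simp: mem_box_cart) (metis bij_inv_eq_iff)+
    have B: "Basis = range (\<lambda>i. axis i (1::real) :: real^'n)"
      by (auto simp: Basis_vec_def)
    have pr: "(\<Prod>b\<in>Basis. v \<bullet> b) = (\<Prod>i\<in>UNIV. v $ i)" for v :: "real^'n"
      unfolding B by (subst prod.reindex) (auto simp: inj_on_def axis_eq_axis cart_eq_inner_axis)
    have "(\<Prod>i\<in>UNIV. (u - l) $ inv p i) = (\<Prod>i\<in>UNIV. (u - l) $ i)"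
      using p by (intro prod.reindex_bij_betw) (auto simp: bij_imp_bij_inv)
    then show "emeasure (distr lborel borel (\<lambda>x::real^'n. \<chi> i. x $ p i)) (box l u) = (\<Prod>b\<in>Basis. (u - l) \<bullet> b)"
      using le' by (simp add: emeasure_distr eq emeasure_lborel_box_eq pr prod_ennreal[symmetric]
        del: prod_ennreal)
        (auto simp: B cart_eq_inner_axis[symmetric] pr prod.reindex inj_on_def axis_eq_axis)
  qed simp
  then have "(\<integral>\<^sup>+x. \<phi> x \<partial>lborel) = (\<integral>\<^sup>+x. \<phi> x \<partial>distr lborel borel (\<lambda>x::real^'n. \<chi> i. x $ p i))"
    by simp
  then show ?thesis by (simp add: nn_integral_distr)
qed

lemma nn_integral_lborel_diagonal:
  fixes \<phi> :: "real^'n \<Rightarrow> ennreal"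
  assumes [measurable]: "\<phi> \<in> borel_measurable borel" and c: "\<And>i. c i \<noteq> 0"
  shows "(\<integral>\<^sup>+x. \<phi> x \<partial>lborel) = ennreal \<bar>\<Prod>i\<in>UNIV. c i\<bar> * (\<integral>\<^sup>+x. \<phi> (\<chi> i. c i * x $ i) \<partial>lborel)"
proof -
  \<comment> \<open>The affine rule for Lebesgue measure takes its factors indexed by basis vectors;
    \<open>C\<close> recovers the coordinate from the basis vector.\<close>
  define C where "C b = c (SOME i. b = axis i 1)" for b :: "real^'n"
  have C: "C (axis i 1) = c i" for i by (simp add: C_def axis_eq_axis)
  have B: "Basis = range (\<lambda>i. axis i (1::real) :: real^'n)"
    by (auto simp: Basis_vec_def)
  have T: "0 + (\<Sum>j\<in>Basis. (C j * (x \<bullet> j)) *\<^sub>R j) = (\<chi> i. c i * x $ i)" for x :: "real^'n"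
  proof (subst vec_eq_iff, rule allI)
    fix k
    have "(\<Sum>j\<in>Basis. (C j * (x \<bullet> j)) *\<^sub>R j) \<bullet> axis k 1 = C (axis k 1) * (x \<bullet> axis k 1)"
      by (subst inner_sum_left_Basis) (auto simp: axis_in_Basis_iff)
    then show "(0 + (\<Sum>j\<in>Basis. (C j * (x \<bullet> j)) *\<^sub>R j)) $ k = (\<chi> i. c i * x $ i) $ k"
      by (simp add: C cart_eq_inner_axis[symmetric])
  qed
  have [measurable]: "(\<lambda>x::real^'n. \<chi> i. c i * x $ i) \<in> borel_measurable borel"
    by (intro borel_measurable_continuous_onI continuous_intros)
  have "lborel = density (distr lborel borel (\<lambda>x. 0 + (\<Sum>j\<in>Basis. (C j * (x \<bullet> j)) *\<^sub>R j)))
      (\<lambda>_. (\<Prod>j\<in>(Basis::(real^'n) set). \<bar>C j\<bar>))"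
    by (rule lborel_affine_euclidean) (auto simp: B C c)
  also have "(\<Prod>j\<in>Basis. \<bar>C j\<bar>) = \<bar>\<Prod>i\<in>UNIV. c i\<bar>"
    unfolding B by (subst prod.reindex) (auto simp: inj_on_def axis_eq_axis C abs_prod)
  finally have eq: "lborel = density (distr lborel borel (\<lambda>x. \<chi> i. c i * x $ i)) (\<lambda>_. ennreal \<bar>\<Prod>i\<in>UNIV. c i\<bar>)"
    unfolding T .
  show ?thesis
    by (subst eq) (simp add: nn_integral_density nn_integral_distr nn_integral_cmult)
qed

text \<open>The library proves this for well-ordered index types only.\<close>

lemma nn_integral_lborel_matrix:
  fixes A :: "real^'n^'n"
  assumes "\<phi> \<in> borel_measurable borel" "det A \<noteq> 0"
  shows "(\<integral>\<^sup>+x. \<phi> x \<partial>lborel) = ennreal \<bar>det A\<bar> * (\<integral>\<^sup>+x. \<phi> (A *v x) \<partial>lborel)"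
proof -
  have mv[measurable]: "(\<lambda>x. A *v x) \<in> borel_measurable borel" for A :: "real^'n^'n"
    by (intro borel_measurable_continuous_onI matrix_vector_mult_linear_continuous_on)
  \<comment> \<open>The determinant condition sits inside the predicate, which makes the case of a
    zero row vacuous. The quantifier over \<open>\<phi>\<close> is inside as well, because for a
    product the second factor's claim is applied to \<open>\<phi>\<close> composed with the
    first.\<close>
  have "det A \<noteq> 0 \<longrightarrow> (\<forall>\<phi>\<in>borel_measurable borel.
    (\<integral>\<^sup>+x. \<phi> x \<partial>lborel) = ennreal \<bar>det A\<bar> * (\<integral>\<^sup>+x. \<phi> (A *v x) \<partial>lborel))" (is "?P A")
  proof (rule induct_matrix_elementary_alt[where P="?P"])
    fix A B :: "real^'n^'n" assume A: "?P A" and B: "?P B"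
    show "?P (A ** B)"
    proof (intro impI ballI)
      fix \<phi> :: "real^'n \<Rightarrow> ennreal"
      assume nz: "det (A ** B) \<noteq> 0" and [measurable]: "\<phi> \<in> borel_measurable borel"
      have "(\<integral>\<^sup>+x. \<phi> x \<partial>lborel) = ennreal \<bar>det A\<bar> * (\<integral>\<^sup>+x. \<phi> (A *v x) \<partial>lborel)"
      proof -
        have "det A \<noteq> 0" using nz by (simp add: det_mul)
        with A have "\<forall>\<phi>\<in>borel_measurable borel.
          (\<integral>\<^sup>+x. \<phi> x \<partial>lborel) = ennreal \<bar>det A\<bar> * (\<integral>\<^sup>+x. \<phi> (A *v x) \<partial>lborel)" by blast
        then show ?thesis by (rule bspec) measurable
      qed
      also have "(\<integral>\<^sup>+x. \<phi> (A *v x) \<partial>lborel) = ennreal \<bar>det B\<bar> * (\<integral>\<^sup>+x. \<phi> (A *v (B *v x)) \<partial>lborel)"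
      proof -
        have "det B \<noteq> 0" using nz by (simp add: det_mul)
        with B have "\<forall>\<phi>\<in>borel_measurable borel.
          (\<integral>\<^sup>+x. \<phi> x \<partial>lborel) = ennreal \<bar>det B\<bar> * (\<integral>\<^sup>+x. \<phi> (B *v x) \<partial>lborel)" by blast
        moreover have "(\<lambda>x. \<phi> (A *v x)) \<in> borel_measurable borel" by measurable
        ultimately show ?thesis by (rule bspec)
      qed
      finally show "(\<integral>\<^sup>+x. \<phi> x \<partial>lborel) = ennreal \<bar>det (A ** B)\<bar> * (\<integral>\<^sup>+x. \<phi> ((A ** B) *v x) \<partial>lborel)"
        by (simp add: det_mul abs_mult ennreal_mult mult.assoc matrix_vector_mul_assoc)
    qed
  next
    fix A :: "real^'n^'n" and i assume "row i A = 0" then show "?P A" by (simp add: det_zero_row)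
  next
    fix A :: "real^'n^'n" assume A: "\<And>i j. i \<noteq> j \<Longrightarrow> A $ i $ j = 0"
    have eq: "A *v x = (\<chi> i. A $ i $ i * x $ i)" for x
    proof -
      have "(\<Sum>j\<in>UNIV. A $ i $ j * x $ j) = (\<Sum>j\<in>UNIV. if j = i then A $ i $ i * x $ i else 0)" for i
        by (rule sum.cong) (auto simp: A)
      then show ?thesis by (simp add: matrix_vector_mult_def)
    qed
    show "?P A"
    proof (intro impI ballI)
      have d: "det A = (\<Prod>i\<in>UNIV. A $ i $ i)" by (rule det_diagonal) (simp add: A)
      fix \<phi> :: "real^'n \<Rightarrow> ennreal" assume "\<phi> \<in> borel_measurable borel" "det A \<noteq> 0"
      then show "(\<integral>\<^sup>+x. \<phi> x \<partial>lborel) = ennreal \<bar>det A\<bar> * (\<integral>\<^sup>+x. \<phi> (A *v x) \<partial>lborel)"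
        unfolding d eq by (intro nn_integral_lborel_diagonal) (auto simp: prod_zero_iff)
    qed
  next
    fix m n :: 'n assume "m \<noteq> n"
    let ?p = "Transposition.transpose m n"
    have d: "\<bar>det ((\<chi> i j. mat 1 $ i $ ?p j)::real^'n^'n)\<bar> = 1"
      by (subst det_permute_columns) (auto simp: permutes_swap_id sign_def)
    have eq: "((\<chi> i j. mat 1 $ i $ ?p j)::real^'n^'n) *v x = (\<chi> i. x $ ?p i)" for x
    proof -
      have "(\<Sum>j\<in>UNIV. mat 1 $ i $ ?p j * x $ j) = (\<Sum>j\<in>UNIV. if j = ?p i then x $ ?p i else 0)" for i
        by (rule sum.cong) (auto simp: mat_def)
      then show ?thesis by (simp add: matrix_vector_mult_def)
    qed
    show "?P (\<chi> i j. mat 1 $ i $ ?p j)"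
      unfolding eq d by (simp add: nn_integral_lborel_permute)
  next
    fix m n :: 'n assume mn: "m \<noteq> n"
    let ?S = "(\<chi> i j. of_bool (i = m \<and> j = n \<or> i = j))::real^'n^'n"
    have "?S = (\<chi> k. if k = m then row m (mat 1) + 1 *s row n (mat 1) else row k (mat 1))"
      using mn by (auto simp: vec_eq_iff row_def mat_def)
    then have d: "det ?S = 1" using det_row_operation[OF mn, of "mat 1::real^'n^'n" 1] by simp
    have eq: "?S *v x = x + x $ n *\<^sub>R axis m 1" for x
    proof -
      have "(\<Sum>j\<in>UNIV. of_bool (i = m \<and> j = n \<or> i = j) * x $ j) =
        (\<Sum>j\<in>UNIV. (if j = i then x $ i else 0) + (if j = n then of_bool (i = m) * x $ n else 0))" for i
        by (rule sum.cong) (use mn in auto)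
      then show ?thesis by (simp add: matrix_vector_mult_def vec_eq_iff axis_def sum.distrib)
    qed
    show "?P ?S" unfolding eq d using mn by (simp add: nn_integral_lborel_shear)
  qed
  with assms show ?thesis by blast
qed

section \<open>Affine maps with constant Jacobian\<close>

lemma nn_integral_lborel_shift:
  fixes \<phi> :: "'a::euclidean_space \<Rightarrow> ennreal"
  assumes [measurable]: "\<phi> \<in> borel_measurable borel"
  shows "(\<integral>\<^sup>+x. \<phi> (a + x) \<partial>lborel) = (\<integral>\<^sup>+x. \<phi> x \<partial>lborel)"
proof -
  have "(\<integral>\<^sup>+x. \<phi> x \<partial>lborel) = (\<integral>\<^sup>+x. \<phi> x \<partial>distr lborel borel ((+) a))"
    by (simp add: lborel_distr_plus)
  then show ?thesis by (simp add: nn_integral_distr)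
qed

lemma nn_integral_lborel_reflect:
  fixes \<phi> :: "'a::euclidean_space \<Rightarrow> ennreal"
  assumes [measurable]: "\<phi> \<in> borel_measurable borel"
  shows "(\<integral>\<^sup>+x. \<phi> (a - x) \<partial>lborel) = (\<integral>\<^sup>+x. \<phi> x \<partial>lborel)"
  by (subst lborel_affine[of "-1" a]) (simp_all add: nn_integral_density nn_integral_distr)

text \<open>\<open>k\<close> is the absolute Jacobian of \<open>L\<close>. Asking for the
  substitution rule on nonnegative integrals only gives one interface for translations, reflections,
  homotheties, matrices and the pair map \<open>(U, W)\<close>; the rules for Bochner integrals,
  null sets and Lp norms follow from it.\<close>

definition affine_scaling :: "('a::euclidean_space \<Rightarrow> 'b::euclidean_space) \<Rightarrow> real \<Rightarrow> bool" where
  "affine_scaling L k \<longleftrightarrow> 0 < k \<and> L \<in> borel_measurable borel \<and>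
    (\<forall>\<phi>\<in>borel_measurable borel. (\<integral>\<^sup>+x. \<phi> x \<partial>lborel) = ennreal k * (\<integral>\<^sup>+x. \<phi> (L x) \<partial>lborel))"

lemma affine_scalingI:
  fixes A :: "real^'n^'n"
  assumes "det A \<noteq> 0"
  shows "affine_scaling (\<lambda>x. c + A *v x) \<bar>det A\<bar>"
  unfolding affine_scaling_def
proof (intro conjI ballI)
  show "(\<lambda>x. c + A *v x) \<in> borel_measurable borel"
    by (intro borel_measurable_continuous_onI continuous_intros matrix_vector_mult_linear_continuous_on)
  fix \<phi> :: "real^'n \<Rightarrow> ennreal" assume [measurable]: "\<phi> \<in> borel_measurable borel"
  have "(\<integral>\<^sup>+x. \<phi> x \<partial>lborel) = (\<integral>\<^sup>+x. \<phi> (c + x) \<partial>lborel)"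
    by (simp add: nn_integral_lborel_shift)
  also have "\<dots> = ennreal \<bar>det A\<bar> * (\<integral>\<^sup>+x. \<phi> (c + A *v x) \<partial>lborel)"
    by (rule nn_integral_lborel_matrix) (use assms in auto)
  finally show "(\<integral>\<^sup>+x. \<phi> x \<partial>lborel) = ennreal \<bar>det A\<bar> * (\<integral>\<^sup>+x. \<phi> (c + A *v x) \<partial>lborel)" .
qed (use assms in auto)

lemma affine_scaling_pos: "affine_scaling L k \<Longrightarrow> 0 < k"
  by (simp add: affine_scaling_def)

lemma affine_scalingD:
  assumes "affine_scaling L k" "\<phi> \<in> borel_measurable borel"
  shows "(\<integral>\<^sup>+x. \<phi> x \<partial>lborel) = ennreal k * (\<integral>\<^sup>+x. \<phi> (L x) \<partial>lborel)"
  using assms unfolding affine_scaling_def by blast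

text \<open>Testing the substitution rule on indicators identifies Lebesgue measure with a scaled
  image measure, which carries the rule over to Bochner integrals.\<close>

lemma affine_scaling_eq:
  assumes "affine_scaling L k"
  shows "lborel = density (distr lborel borel L) (\<lambda>_. ennreal k)"
proof (rule measure_eqI)
  fix S :: "'b set" assume "S \<in> sets lborel"
  then have [measurable]: "S \<in> sets borel" by simp
  have [measurable]: "L \<in> borel_measurable borel" using assms by (simp add: affine_scaling_def)
  have "emeasure lborel S = (\<integral>\<^sup>+x. indicator S x \<partial>lborel)" by simp
  also have "\<dots> = ennreal k * (\<integral>\<^sup>+x. indicator S (L x) \<partial>lborel)"
    by (rule affine_scalingD[OF assms]) measurable
  finally show "emeasure lborel S = emeasure (density (distr lborel borel L) (\<lambda>_. ennreal k)) S"
    by (simp add: emeasure_density nn_integral_cmult nn_integral_distr del: nn_integral_indicator)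
qed simp

lemma affine_scaling_nn_integral:
  assumes "affine_scaling L k" "\<phi> \<in> borel_measurable borel"
  shows "(\<integral>\<^sup>+x. \<phi> (L x) \<partial>lborel) = ennreal (1 / k) * (\<integral>\<^sup>+x. \<phi> x \<partial>lborel)"
proof -
  have k: "0 < k" using assms by (simp add: affine_scaling_def)
  have "ennreal (1 / k) * (\<integral>\<^sup>+x. \<phi> x \<partial>lborel) = ennreal (1 / k) * (ennreal k * (\<integral>\<^sup>+x. \<phi> (L x) \<partial>lborel))"
    using affine_scalingD[OF assms] by simp
  also have "\<dots> = ennreal (1 / k * k) * (\<integral>\<^sup>+x. \<phi> (L x) \<partial>lborel)"
    using k by (subst ennreal_mult) (simp_all add: mult.assoc)
  finally show ?thesis using k by simp
qed

lemma affine_scaling_integral: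
  fixes \<phi> :: "'b::euclidean_space \<Rightarrow> 'c::{banach,second_countable_topology}"
  assumes "affine_scaling L k" "\<phi> \<in> borel_measurable borel"
  shows "integrable lborel (\<lambda>x. \<phi> (L x)) \<longleftrightarrow> integrable lborel \<phi>"
    and "(\<integral>x. \<phi> x \<partial>lborel) = k *\<^sub>R (\<integral>x. \<phi> (L x) \<partial>lborel)"
proof -
  have L[measurable]: "L \<in> borel_measurable borel" and k: "0 < k"
    using assms by (simp_all add: affine_scaling_def)
  note [measurable] = assms(2)
  have "integrable lborel \<phi> \<longleftrightarrow> integrable (density (distr lborel borel L) (\<lambda>_. ennreal k)) \<phi>"
    using affine_scaling_eq[OF assms(1)] by simp
  also have "\<dots> \<longleftrightarrow> integrable lborel (\<lambda>x. k *\<^sub>R \<phi> (L x))"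
    using k by (simp add: integrable_density integrable_distr_eq)
  also have "\<dots> \<longleftrightarrow> integrable lborel (\<lambda>x. \<phi> (L x))" 
  proof
    assume "integrable lborel (\<lambda>x. k *\<^sub>R \<phi> (L x))"
    then have "integrable lborel (\<lambda>x. (1 / k) *\<^sub>R k *\<^sub>R \<phi> (L x))" by (rule integrable_scaleR_right)
    then show "integrable lborel (\<lambda>x. \<phi> (L x))" using k by simp
  qed simp
  finally show "integrable lborel (\<lambda>x. \<phi> (L x)) \<longleftrightarrow> integrable lborel \<phi>" by simp
  have "(\<integral>x. \<phi> x \<partial>lborel) = (\<integral>x. \<phi> x \<partial>density (distr lborel borel L) (\<lambda>_. ennreal k))"
    using affine_scaling_eq[OF assms(1)] by simp
  also have "\<dots> = (\<integral>x. k *\<^sub>R \<phi> (L x) \<partial>lborel)"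
    using k by (simp add: integral_density integral_distr)
  finally show "(\<integral>x. \<phi> x \<partial>lborel) = k *\<^sub>R (\<integral>x. \<phi> (L x) \<partial>lborel)" by simp
qed

lemma affine_scaling_AE:
  assumes "affine_scaling L k" "AE x in lborel. P x"
  shows "AE x in lborel. P (L x)"
proof -
  obtain N where N: "{x. \<not> P x} \<subseteq> N" "N \<in> sets borel" "emeasure lborel N = 0"
    using AE_E[OF assms(2)] by (auto simp: sets_lborel)
  have L[measurable]: "L \<in> borel_measurable borel" using assms by (simp add: affine_scaling_def)
  note [measurable] = N(2)
  have "(\<integral>\<^sup>+x. indicator N (L x) \<partial>lborel) = ennreal (1/k) * (\<integral>\<^sup>+x. indicator N x \<partial>lborel)"
    by (rule affine_scaling_nn_integral[OF assms(1)]) simp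
  also have "\<dots> = 0" using N by simp
  finally have "AE x in lborel. indicator N (L x) = (0::ennreal)"
    by (subst (asm) nn_integral_0_iff_AE) auto
  then show ?thesis by eventually_elim (use N(1) in \<open>auto simp: indicator_def split: if_splits\<close>)
qed

lemma affine_scaling_shift: "affine_scaling (\<lambda>x. x + a :: 'a::euclidean_space) 1"
  unfolding affine_scaling_def
  by (auto simp: nn_integral_lborel_shift add.commute[of _ a])

lemma affine_scaling_diff: "affine_scaling (\<lambda>x. x - a :: 'a::euclidean_space) 1"
  using affine_scaling_shift[of "-a"] by simp

lemma affine_scaling_reflect: "affine_scaling (\<lambda>x. a - x :: 'a::euclidean_space) 1"
  unfolding affine_scaling_def by (auto simp: nn_integral_lborel_reflect)

text \<open>\<open>A\<close> acts on vectors indexed by a sum type, whereas symbols live on pairs.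
  The gluing map between the two preserves measure because the preimage of a box is a product of two
  boxes.\<close>

lemma lborel_vec_sum:
  "distr (lborel :: ((real^'m) \<times> (real^'n)) measure) borel
     (\<lambda>(x, y). (\<chi> i. case i of Inl a \<Rightarrow> x $ a | Inr b \<Rightarrow> y $ b) :: real^('m + 'n)) = lborel"
proof (rule lborel_eqI[symmetric])
  let ?j = "\<lambda>(x, y). (\<chi> i. case i of Inl a \<Rightarrow> x $ a | Inr b \<Rightarrow> y $ b) :: real^('m + 'n)"
  have [measurable]: "?j \<in> borel_measurable borel"
  proof (intro borel_measurable_continuous_onI, unfold case_prod_unfold, intro continuous_on_vec_lambda)
    show "continuous_on UNIV (\<lambda>x. case i of Inl a \<Rightarrow> fst x $ a | Inr b \<Rightarrow> snd x $ b)"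
      for i :: "'m + 'n"
      by (cases i) (auto intro!: continuous_intros)
  qed
  fix l u :: "real^('m + 'n)"
  assume le: "\<And>b. b \<in> Basis \<Longrightarrow> l \<bullet> b \<le> u \<bullet> b"
  have le': "l $ i \<le> u $ i" for i
    using le[of "axis i 1"] by (simp add: cart_eq_inner_axis axis_in_Basis_iff)
  have eq: "?j -` box l u = box (\<chi> a. l $ Inl a) (\<chi> a. u $ Inl a) \<times> box (\<chi> b. l $ Inr b) (\<chi> b. u $ Inr b)"
    by (auto simp: mem_box_cart split: sum.splits)
  have B: "Basis = range (\<lambda>i. axis i (1::real) :: real^'k::finite)"
    by (auto simp: Basis_vec_def)
  have pr: "(\<Prod>b\<in>Basis. v \<bullet> b) = (\<Prod>i\<in>UNIV. v $ i)" for v :: "real^'k::finite"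
    unfolding B by (subst prod.reindex) (auto simp: inj_on_def axis_eq_axis cart_eq_inner_axis)
  have box: "emeasure lborel (box a b) = ennreal (\<Prod>i\<in>UNIV. (b - a) $ i)"
    if "\<And>i. a $ i \<le> b $ i" for a b :: "real^'k::finite"
    using that by (subst emeasure_lborel_box) (auto simp: pr, auto simp: B cart_eq_inner_axis[symmetric])
  have U: "(UNIV::('m+'n) set) = range Inl \<union> range Inr"
    by (auto simp: UNIV_sum)
  have "(\<Prod>i\<in>UNIV. (u - l) $ i) = (\<Prod>a\<in>UNIV. (u - l) $ Inl a) * (\<Prod>b\<in>UNIV. (u - l) $ Inr b)"
    unfolding U by (subst prod.union_disjoint) (auto simp: prod.reindex)
  then show "emeasure (distr lborel borel ?j) (box l u) = (\<Prod>b\<in>Basis. (u - l) \<bullet> b)"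
    using le' by (simp add: emeasure_distr eq pr) 
     (simp add: lborel_prod[symmetric] lborel.emeasure_pair_measure_Times box ennreal_mult prod_nonneg)
qed simp

section \<open>Lebesgue spaces\<close>

lemma exponent_cases:
  fixes p :: ennreal
  assumes "1 \<le> p"
  obtains (fin) r where "p = ennreal r" "p \<noteq> \<infinity>" "1 \<le> r" "enn2real p = r" "enn2real (1 / p) = 1 / r"
        | (inf) "p = \<infinity>" "enn2real (1 / p) = 0"
proof (cases p)
  case (real r)
  then have r: "1 \<le> r" using assms by simp
  then have "1 / ennreal r = ennreal (1 / r)" by (subst ennreal_1[symmetric], subst divide_ennreal) auto
  then show ?thesis using real r by (intro fin[of r]) auto
next
  case top
  then show ?thesis by (intro inf) auto
qed

lemma conjugate_exponents:
  fixes p p' :: ennreal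
  assumes "1 \<le> p" "1 / p + 1 / p' = 1"
  shows "1 \<le> p'" "enn2real (1 / p) + enn2real (1 / p') = 1"
proof -
  have "1 / p' \<le> 1 / p + 1 / p'" "1 / p \<le> 1 / p + 1 / p'" by simp_all
  then have le: "1 / p' \<le> 1" "1 / p \<le> 1" unfolding assms(2) .
  \<comment> \<open>In \<open>ennreal\<close> the quotient 1 / 0 is \<infinity>, which exceeds the
    prescribed sum 1.\<close>
  have "p' \<noteq> 0" 
  proof
    assume "p' = 0" then show False using le(1) by (simp add: divide_ennreal_def top_unique)
  qed
  show "1 \<le> p'"
  proof (cases p')
    case (real r)
    then have "0 < r" using \<open>p' \<noteq> 0\<close> by (cases "r = 0") auto
    then have "1 / p' = ennreal (1 / r)" using real by (subst ennreal_1[symmetric], simp add: divide_ennreal del: ennreal_1)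
    then have "1 / r \<le> 1" using le(1) \<open>0 < r\<close> by simp
    then show ?thesis using real \<open>0 < r\<close> by simp
  qed simp
  have "enn2real (1 / p + 1 / p') = enn2real (1 / p) + enn2real (1 / p')"
    by (rule enn2real_plus) (use le in \<open>auto simp: less_top[symmetric] top_unique\<close>)
  then show "enn2real (1 / p) + enn2real (1 / p') = 1" using assms(2) by simp
qed

lemma Lp_norm_nonneg [simp]: "0 \<le> Lp_norm p f"
  by (simp add: Lp_norm_def)

lemma Lp_space_measurable [measurable_dest]: "f \<in> Lp_space p \<Longrightarrow> f \<in> borel_measurable borel"
  by (simp add: Lp_space_def)

lemma Lp_space_infinity_AE:
  assumes "f \<in> Lp_space \<infinity>"
  shows "AE x in lborel. norm (f x) \<le> Lp_norm \<infinity> f"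
proof -
  have "AE x in lborel. ennreal (norm (f x)) \<le> esssup lborel (\<lambda>x. ennreal (norm (f x)))"
    by (rule esssup_AE)
  then show ?thesis
  proof eventually_elim
    case (elim x)
    then have "enn2real (ennreal (norm (f x))) \<le> enn2real (esssup lborel (\<lambda>x. ennreal (norm (f x))))"
      using assms by (intro enn2real_mono) (auto simp: Lp_space_def)
    then show ?case by (simp add: Lp_norm_def)
  qed
qed

lemma Lp_space_infinityI:
  assumes [measurable]: "f \<in> borel_measurable borel" and "AE x in lborel. norm (f x) \<le> c" "0 \<le> c"
  shows "f \<in> Lp_space \<infinity>" "Lp_norm \<infinity> f \<le> c"
proof -
  have le: "esssup lborel (\<lambda>x. ennreal (norm (f x))) \<le> ennreal c"
    by (rule esssup_I) (use assms(2) in \<open>auto intro: ennreal_leI\<close>)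
  then have "esssup lborel (\<lambda>x. ennreal (norm (f x))) < \<infinity>" by (simp add: le_less_trans less_top)
  then show "f \<in> Lp_space \<infinity>" by (simp add: Lp_space_def)
  show "Lp_norm \<infinity> f \<le> c" using enn2real_mono[OF le] assms(3) by (simp add: Lp_norm_def)
qed

lemma Lp_space_cong_AE:
  assumes [measurable]: "f \<in> borel_measurable borel" "g \<in> borel_measurable borel"
    and ae: "AE x in lborel. f x = g x"
  shows "f \<in> Lp_space p \<longleftrightarrow> g \<in> Lp_space p" "Lp_norm p f = Lp_norm p g"
proof -
  have 1: "esssup lborel (\<lambda>x. ennreal (norm (f x))) = esssup lborel (\<lambda>x. ennreal (norm (g x)))"
    by (rule esssup_AE_cong) (use ae in auto)
  have 2: "integrable lborel (\<lambda>x. norm (f x) powr r) \<longleftrightarrow> integrable lborel (\<lambda>x. norm (g x) powr r)" for r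
    by (rule integrable_cong_AE) (use ae in auto)
  have 3: "(\<integral>x. norm (f x) powr r \<partial>lborel) = (\<integral>x. norm (g x) powr r \<partial>lborel)" for r
    by (rule integral_cong_AE) (use ae in auto)
  show "f \<in> Lp_space p \<longleftrightarrow> g \<in> Lp_space p" "Lp_norm p f = Lp_norm p g"
    by (simp_all add: Lp_space_def Lp_norm_def 1 2 3)
qed

lemma Lp_space_dominated:
  fixes f :: "'a::euclidean_space \<Rightarrow> complex" and g :: "'a \<Rightarrow> complex"
  assumes "f \<in> Lp_space p" and [measurable]: "g \<in> borel_measurable borel"
    and le: "\<And>x. norm (g x) \<le> norm (f x)"
  shows "g \<in> Lp_space p" "Lp_norm p g \<le> Lp_norm p f"
proof -
  have [measurable]: "f \<in> borel_measurable borel" using assms(1) by measurable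
  have "g \<in> Lp_space p \<and> Lp_norm p g \<le> Lp_norm p f"
  proof (cases "p = \<infinity>")
    case True
    have "AE x in lborel. norm (g x) \<le> Lp_norm \<infinity> f"
      using Lp_space_infinity_AE[of f] assms(1) True le order_trans by (auto elim!: eventually_mono)
    then show ?thesis using Lp_space_infinityI[of g "Lp_norm \<infinity> f"] True by auto
  next
    case False
    have f: "integrable lborel (\<lambda>x. norm (f x) powr enn2real p)" using assms(1) False by (simp add: Lp_space_def)
    have g: "integrable lborel (\<lambda>x. norm (g x) powr enn2real p)"
      by (rule Bochner_Integration.integrable_bound[OF f]) (auto intro!: powr_mono2 le)
    have "(\<integral>x. norm (g x) powr enn2real p \<partial>lborel) \<le> (\<integral>x. norm (f x) powr enn2real p \<partial>lborel)"
      by (rule integral_mono[OF g f]) (auto intro!: powr_mono2 le)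
    then show ?thesis using g False
      by (auto simp: Lp_space_def Lp_norm_def intro!: powr_mono2)
  qed
  then show "g \<in> Lp_space p" "Lp_norm p g \<le> Lp_norm p f" by auto
qed

text \<open>The Jacobian enters with the power -1/p; applied to the sections in \<open>y\<close>,
  this is what puts the determinants of \<open>A12\<close> and \<open>A22\<close> into the bound.
  For p = \<infinity> that power is 0, and it suffices to pull back null sets.\<close>

lemma Lp_affine_scaling:
  fixes f :: "'b::euclidean_space \<Rightarrow> complex" and L :: "'a::euclidean_space \<Rightarrow> 'b"
  assumes L: "affine_scaling L k" and f: "f \<in> Lp_space p" and p: "1 \<le> p"
  shows "(\<lambda>x. f (L x)) \<in> Lp_space p"
    "Lp_norm p (\<lambda>x. f (L x)) \<le> k powr (- enn2real (1 / p)) * Lp_norm p f"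
proof -
  have [measurable]: "f \<in> borel_measurable borel" using f by measurable
  have [measurable]: "L \<in> borel_measurable borel" and k: "0 < k" using L by (auto simp: affine_scaling_def)
  have "(\<lambda>x. f (L x)) \<in> Lp_space p \<and> Lp_norm p (\<lambda>x. f (L x)) \<le> k powr (- enn2real (1 / p)) * Lp_norm p f"
    using p
  proof (cases p rule: exponent_cases)
    case (fin r)
    note * = affine_scaling_integral[OF L, of "\<lambda>x. norm (f x) powr r"]
    have "(\<integral>x. norm (f (L x)) powr r \<partial>lborel) = (1 / k) * (\<integral>x. norm (f x) powr r \<partial>lborel)"
      using * k by simp
    then have "Lp_norm p (\<lambda>x. f (L x)) = (1 / k) powr (1 / r) * Lp_norm p f"
      using fin k by (simp add: Lp_norm_def powr_mult[symmetric])
    moreover have "(\<lambda>x. f (L x)) \<in> Lp_space p"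
      using f fin * by (simp add: Lp_space_def)
    moreover have "(1 / k) powr (1 / r) = k powr (- enn2real (1 / p))"
      unfolding fin(5) using k by (simp add: powr_minus powr_divide field_simps)
    ultimately show ?thesis by simp
  next
    case inf
    have "AE x in lborel. norm (f (L x)) \<le> Lp_norm \<infinity> f"
      using affine_scaling_AE[OF L Lp_space_infinity_AE] f inf by auto
    then show ?thesis using Lp_space_infinityI[of "\<lambda>x. f (L x)" "Lp_norm \<infinity> f"] inf k by auto
  qed
  then show "(\<lambda>x. f (L x)) \<in> Lp_space p"
    "Lp_norm p (\<lambda>x. f (L x)) \<le> k powr (- enn2real (1 / p)) * Lp_norm p f" by auto
qed

lemma young_powr:
  fixes a b x y :: real
  assumes "0 < a" "0 < b" "a + b = 1" "0 \<le> x" "0 \<le> y"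
  shows "x powr a * y powr b \<le> a * x + b * y"
proof (cases "x = 0 \<or> y = 0")
  case False
  then show ?thesis using assms by (intro Youngs_inequality_0) auto
qed (use assms in auto)

text \<open>After dividing \<open>u\<close> and \<open>v\<close> by their integrals, Young's
  inequality integrates to a + b = 1. If one of the integrals vanishes, the product vanishes almost
  everywhere.\<close>

lemma integral_powr_holder:
  fixes u v :: "'a \<Rightarrow> real"
  assumes u: "integrable M u" "\<And>x. 0 \<le> u x" and v: "integrable M v" "\<And>x. 0 \<le> v x"
    and ab: "0 < a" "0 < b" "a + b = 1"
  shows "integrable M (\<lambda>x. u x powr a * v x powr b)"
    "(\<integral>x. u x powr a * v x powr b \<partial>M) \<le> (\<integral>x. u x \<partial>M) powr a * (\<integral>x. v x \<partial>M) powr b"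
proof -
  have [measurable]: "u \<in> borel_measurable M" "v \<in> borel_measurable M" using u v by auto
  show int: "integrable M (\<lambda>x. u x powr a * v x powr b)"
  proof (rule Bochner_Integration.integrable_bound)
    show "integrable M (\<lambda>x. a * u x + b * v x)" using u v by auto
    show "AE x in M. norm (u x powr a * v x powr b) \<le> norm (a * u x + b * v x)"
      using young_powr[OF ab] u v ab by auto
  qed simp
  define U V where "U = (\<integral>x. u x \<partial>M)" and "V = (\<integral>x. v x \<partial>M)"
  have UV: "0 \<le> U" "0 \<le> V" unfolding U_def V_def using u v by auto
  show "(\<integral>x. u x powr a * v x powr b \<partial>M) \<le> (\<integral>x. u x \<partial>M) powr a * (\<integral>x. v x \<partial>M) powr b"
  proof (cases "U = 0 \<or> V = 0")
    case True
    then have "AE x in M. u x powr a * v x powr b = 0"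
    proof
      assume "U = 0"
      then have "AE x in M. u x = 0" using u unfolding U_def by (subst (asm) integral_nonneg_eq_0_iff_AE) auto
      then show ?thesis by eventually_elim auto
    next
      assume "V = 0"
      then have "AE x in M. v x = 0" using v unfolding V_def by (subst (asm) integral_nonneg_eq_0_iff_AE) auto
      then show ?thesis by eventually_elim auto
    qed
    then have "(\<integral>x. u x powr a * v x powr b \<partial>M) = 0" by (rule integral_eq_zero_AE)
    then show ?thesis by simp
  next
    case False
    then have pos: "0 < U" "0 < V" using UV by auto
    have "(\<integral>x. u x powr a * v x powr b \<partial>M) / (U powr a * V powr b)
        = (\<integral>x. (u x / U) powr a * (v x / V) powr b \<partial>M)"
      using pos u v by (simp add: powr_divide)
    also have "\<dots> \<le> (\<integral>x. a * (u x / U) + b * (v x / V) \<partial>M)"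
    proof (rule integral_mono)
      have "integrable M (\<lambda>x. (u x powr a * v x powr b) / (U powr a * V powr b))" using int by simp
      then show "integrable M (\<lambda>x. (u x / U) powr a * (v x / V) powr b)"
        using pos u v by (simp add: powr_divide)
      show "integrable M (\<lambda>x. a * (u x / U) + b * (v x / V))" using u v by auto
      show "(u x / U) powr a * (v x / V) powr b \<le> a * (u x / U) + b * (v x / V)" for x
        by (rule young_powr[OF ab]) (use u(2)[of x] v(2)[of x] pos in auto)
    qed
    also have "\<dots> = a * (U / U) + b * (V / V)"
      using u v unfolding U_def V_def by simp
    also have "\<dots> = 1" using pos ab by simp
    finally have "(\<integral>x. u x powr a * v x powr b \<partial>M) / (U powr a * V powr b) \<le> 1" .
    moreover have "0 < U powr a * V powr b" using pos by simp
    ultimately show ?thesis unfolding U_def[symmetric] V_def[symmetric]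
      by (simp only: divide_le_eq_1_pos)
  qed
qed

lemma Lp_holder:
  fixes f g :: "'a::euclidean_space \<Rightarrow> complex"
  assumes f: "f \<in> Lp_space p" and g: "g \<in> Lp_space p'" and p: "1 \<le> p" and pp: "1 / p + 1 / p' = 1"
  shows "integrable lborel (\<lambda>x. f x * g x)"
    "(\<integral>x. norm (f x) * norm (g x) \<partial>lborel) \<le> Lp_norm p f * Lp_norm p' g"
proof -
  note p' = conjugate_exponents[OF p pp]
  have [measurable]: "f \<in> borel_measurable borel" "g \<in> borel_measurable borel" using f g by measurable
  \<comment> \<open>The exponent pair (\<infinity>, 1), stated for generic functions because it is
    needed with either of \<open>f\<close> and \<open>g\<close> in the role of the bounded
    one.\<close>
  have sup: "integrable lborel (\<lambda>x. norm (f x) * norm (g x)) \<and>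
       (\<integral>x. norm (f x) * norm (g x) \<partial>lborel) \<le> Lp_norm q f * Lp_norm q' g"
    if f: "f \<in> Lp_space q" and g: "g \<in> Lp_space q'" and q: "q = \<infinity>" and q': "q' \<noteq> \<infinity>" "enn2real q' = 1"
    for f g :: "'a \<Rightarrow> complex" and q q' :: ennreal
  proof -
    have [measurable]: "f \<in> borel_measurable borel" "g \<in> borel_measurable borel" using f g by measurable
    have ig: "integrable lborel (\<lambda>x. norm (g x))" using g q' by (simp add: Lp_space_def)
    have ae: "AE x in lborel. norm (f x) * norm (g x) \<le> Lp_norm \<infinity> f * norm (g x)"
      using Lp_space_infinity_AE[of f] f q by (auto elim!: eventually_mono intro!: mult_right_mono)
    have *: "integrable lborel (\<lambda>x. norm (f x) * norm (g x))"
    proof (rule Bochner_Integration.integrable_bound)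
      show "integrable lborel (\<lambda>x. Lp_norm \<infinity> f * norm (g x))" using ig by simp
    qed (use ae in auto)
    have "(\<integral>x. norm (f x) * norm (g x) \<partial>lborel) \<le> (\<integral>x. Lp_norm \<infinity> f * norm (g x) \<partial>lborel)"
      by (rule integral_mono_AE) (use * ig ae in auto)
    also have "\<dots> = Lp_norm \<infinity> f * Lp_norm q' g" using q' by (simp add: Lp_norm_def)
    finally show ?thesis using * q by simp
  qed
  have main: "integrable lborel (\<lambda>x. norm (f x) * norm (g x)) \<and>
      (\<integral>x. norm (f x) * norm (g x) \<partial>lborel) \<le> Lp_norm p f * Lp_norm p' g"
    using p
  proof (cases p rule: exponent_cases)
    case inf
    from p'(1) show ?thesis
      by (cases p' rule: exponent_cases) (use p'(2) inf sup[OF f g] in auto)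
  next
    case (fin r)
    note r = this
    from p'(1) show ?thesis
    proof (cases p' rule: exponent_cases)
      case inf
      then have "r = 1" using p'(2) r by auto
      then show ?thesis using sup[OF g f] inf r by (simp add: mult.commute)
    next
      case (fin r')
      have rr: "1 / r + 1 / r' = 1" using p'(2) r fin by simp
      have f': "integrable lborel (\<lambda>x. norm (f x) powr r)" using f r by (simp add: Lp_space_def)
      have g': "integrable lborel (\<lambda>x. norm (g x) powr r')" using g fin by (simp add: Lp_space_def)
      have pos: "0 < r" "0 < r'" using r fin by auto
      have "norm (f x) = (norm (f x) powr r) powr (1 / r)" "norm (g x) = (norm (g x) powr r') powr (1 / r')" for x
        using pos by (auto simp: powr_powr)
      then show ?thesis
        using integral_powr_holder[OF f' _ g', of "1 / r" "1 / r'"] pos rr r fin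
        by (simp add: Lp_norm_def powr_powr)
    qed
  qed
  then have "integrable lborel (\<lambda>x. norm (f x * g x))" by (simp add: norm_mult)
  then show "integrable lborel (\<lambda>x. f x * g x)" by (simp add: integrable_norm_iff)
  show "(\<integral>x. norm (f x) * norm (g x) \<partial>lborel) \<le> Lp_norm p f * Lp_norm p' g" using main by simp
qed

lemma borel_measurable_cnj [measurable (raw)]:
  "f \<in> borel_measurable M \<Longrightarrow> (\<lambda>x. cnj (f x)) \<in> borel_measurable M"
  by (rule measurable_compose[OF _ borel_measurable_continuous_onI]) (auto intro: continuous_intros)

lemma Lp_cnj:
  shows "(\<lambda>x. cnj (f x)) \<in> Lp_space p \<longleftrightarrow> f \<in> Lp_space p" "Lp_norm p (\<lambda>x. cnj (f x)) = Lp_norm p f"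
proof -
  have "(\<lambda>x. cnj (f x)) \<in> borel_measurable borel \<longleftrightarrow> f \<in> borel_measurable borel"
  proof
    assume [measurable]: "(\<lambda>x. cnj (f x)) \<in> borel_measurable borel"
    have "(\<lambda>x. cnj (cnj (f x))) \<in> borel_measurable borel" by measurable
    then show "f \<in> borel_measurable borel" by simp
  qed measurable
  then show "(\<lambda>x. cnj (f x)) \<in> Lp_space p \<longleftrightarrow> f \<in> Lp_space p" "Lp_norm p (\<lambda>x. cnj (f x)) = Lp_norm p f"
    by (simp_all add: Lp_space_def Lp_norm_def)
qed

text \<open>L1 functions with a bound valid at every point. They lie in every Lp and are stable
  under conjugation and truncation, and the pointwise bound passes to sections without exceptional
  null sets. Elements of M1 will be seen to agree almost everywhere with such functions.\<close>

definition nice :: "('a::euclidean_space \<Rightarrow> complex) \<Rightarrow> bool" where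
  "nice f \<longleftrightarrow> integrable lborel f \<and> (\<exists>C. \<forall>x. norm (f x) \<le> C)"

lemma niceD:
  assumes "nice f"
  shows "integrable lborel f" "f \<in> borel_measurable borel"
  using assms by (auto simp: nice_def)

lemma nice_bound:
  assumes "nice f"
  obtains C where "0 < C" "\<And>x. norm (f x) \<le> C"
proof -
  obtain C where C: "\<And>x. norm (f x) \<le> C" using assms by (auto simp: nice_def)
  show ?thesis
    by (rule that[of "max C 1"]) (use C in \<open>auto simp: le_max_iff_disj\<close>)
qed

lemma nice_dominated:
  fixes f :: "'a::euclidean_space \<Rightarrow> complex"
  assumes "nice f" "g \<in> borel_measurable borel" "\<And>x. norm (g x) \<le> norm (f x)"
  shows "nice g"
  unfolding nice_def
proof
  show "integrable lborel g"
    by (rule Bochner_Integration.integrable_bound[of lborel f]) (use assms in \<open>auto dest: niceD\<close>)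
  obtain C where "\<And>x. norm (f x) \<le> C" using assms(1) by (auto simp: nice_def)
  then show "\<exists>C. \<forall>x. norm (g x) \<le> C" using assms(3) order_trans by blast
qed

lemma nice_cnj: "nice f \<Longrightarrow> nice (\<lambda>x. cnj (f x))"
  by (rule nice_dominated[of f]) (auto intro: borel_measurable_cnj dest: niceD)

lemma nice_powr_integrable:
  assumes "nice f" "1 \<le> r"
  shows "integrable lborel (\<lambda>x. norm (f x) powr r)"
proof -
  have [measurable]: "f \<in> borel_measurable borel" using assms by (simp add: niceD)
  obtain C where C: "0 < C" "\<And>x. norm (f x) \<le> C" using nice_bound[OF assms(1)] by blast
  show ?thesis
  proof (rule Bochner_Integration.integrable_bound)
    show "integrable lborel (\<lambda>x. C powr (r - 1) * norm (f x))" using niceD[OF assms(1)] by simp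
    have "norm (f x) powr r \<le> C powr (r - 1) * norm (f x)" for x
    proof (cases "f x = 0")
      case False
      have "norm (f x) powr r = norm (f x) powr (r - 1) * norm (f x) powr 1"
        by (subst powr_add[symmetric]) simp
      also have "\<dots> \<le> C powr (r - 1) * norm (f x)"
        using C assms(2) by (auto intro!: mult_right_mono powr_mono2)
      finally show ?thesis .
    qed simp
    then show "AE x in lborel. norm (norm (f x) powr r) \<le> norm (C powr (r - 1) * norm (f x))"
      using C by simp
  qed simp
qed

lemma nice_Lp:
  assumes "nice f" "1 \<le> p"
  shows "f \<in> Lp_space p"
  using assms(2)
proof (cases p rule: exponent_cases)
  case (fin r)
  then show ?thesis using nice_powr_integrable[OF assms(1)] niceD[OF assms(1)] by (simp add: Lp_space_def)
next
  case inf
  obtain C where C: "0 < C" "\<And>x. norm (f x) \<le> C" using nice_bound[OF assms(1)] by blast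
  show ?thesis using Lp_space_infinityI[of f C] C niceD[OF assms(1)] inf by auto
qed

lemma mult_cnj_sgn: "w * cnj (sgn w) = of_real (norm w)"
proof -
  have "w * cnj (sgn w) = of_real ((norm w)\<^sup>2) / of_real (norm w)"
    by (simp add: sgn_div_norm complex_norm_square[symmetric] scaleR_conv_of_real divide_inverse mult.commute)
  then show ?thesis by (simp add: power2_eq_square)
qed

text \<open>The test functions \<open>g\<close> are chosen so that \<open>h * g = \<bar>h\<bar>\<^sup>r\<close> on a set where \<open>h\<close> is bounded.\<close>

lemma Lp_converse_holder:
  fixes h :: "'a::euclidean_space \<Rightarrow> complex"
  assumes [measurable]: "h \<in> borel_measurable borel" and c: "0 \<le> c"
    and p: "1 \<le> p" and pp: "1 / p + 1 / p' = 1"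
    and le: "\<And>g. nice g \<Longrightarrow> norm (\<integral>x. h x * g x \<partial>lborel) \<le> c * Lp_norm p' g"
  shows "h \<in> Lp_space p \<and> Lp_norm p h \<le> c"
proof -
  note p' = conjugate_exponents[OF p pp]
  \<comment> \<open>On \<open>E n\<close> both the argument and the value of \<open>h\<close> are
    bounded, so the test functions built from \<open>h\<close> and cut off to \<open>E n\<close> are
    bounded and integrable; these sets exhaust the space.\<close>
  define E where "E n = {x. norm x \<le> real n \<and> norm (h x) \<le> real n}" for n :: nat
  have [measurable]: "E n \<in> sets borel" for n unfolding E_def by measurable
  have bound_int: "integrable lborel u"
    if [measurable]: "u \<in> borel_measurable borel" and u: "\<And>x. norm (u x) \<le> C * indicator (E n) x"
    for u :: "'a \<Rightarrow> 'b::{banach,second_countable_topology}" and C n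
  proof (rule Bochner_Integration.integrable_bound)
    have "E n \<subseteq> cball 0 (real n)" by (auto simp: E_def)
    then have "emeasure lborel (E n) \<le> emeasure lborel (cball (0::'a) (real n))" by (intro emeasure_mono) auto
    also have "\<dots> < \<infinity>" using emeasure_lborel_cball_finite by (simp add: less_top)
    finally show "integrable lborel (\<lambda>x. C * indicator (E n) x)" by (intro integrable_mult_right) (simp add: integrable_indicator_iff)
    show "AE x in lborel. norm (u x) \<le> norm (C * indicator (E n) x)"
      unfolding real_norm_def by (intro AE_I2 order_trans[OF u abs_ge_self])
  qed simp
  note hc = mult_cnj_sgn[of "h _"]
  show ?thesis
    using p
  proof (cases p rule: exponent_cases)
    case inf
    have p1: "p' \<noteq> \<infinity>" "enn2real p' = 1"
      using p'(1) by (cases p' rule: exponent_cases; use p'(2) inf in auto)+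
    \<comment> \<open>For p = \<infinity> the test function is the conjugate sign of
      \<open>h\<close> on the part of \<open>E n\<close> where |h| > c. Its L1 norm is the measure
      of that set, so the assumed bound leaves no room for positive measure.\<close>
    have "AE x in lborel. \<not> (x \<in> E n \<and> c < norm (h x))" for n
    proof -
      define D where "D = {x \<in> E n. c < norm (h x)}"
      have [measurable]: "D \<in> sets borel" unfolding D_def by measurable
      have DE: "D \<subseteq> E n" by (auto simp: D_def)
      define g where "g x = indicator D x * cnj (sgn (h x))" for x
      have iD: "integrable lborel (indicator D :: 'a \<Rightarrow> real)"
        by (rule bound_int[of _ 1 n]) (use DE in \<open>auto simp: indicator_def\<close>)
      have ih: "integrable lborel (\<lambda>x. indicator D x * norm (h x))"
        by (rule bound_int[of _ n n]) (use DE in \<open>auto simp: indicator_def E_def\<close>)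
      have ng: "norm (g x) = indicator D x" for x
        using c by (auto simp: g_def D_def norm_mult norm_sgn indicator_def)
      have g: "nice g"
        unfolding nice_def
      proof
        show "integrable lborel g"
          by (rule bound_int[of _ 1 n]) (use DE ng in \<open>auto simp: g_def[abs_def] indicator_def\<close>)
        show "\<exists>C. \<forall>x. norm (g x) \<le> C" by (rule exI[of _ 1]) (simp add: ng indicator_def)
      qed
      have "(\<integral>x. h x * g x \<partial>lborel) = (\<integral>x. of_real (indicator D x * norm (h x)) \<partial>lborel)"
        by (rule Bochner_Integration.integral_cong) (auto simp: g_def hc[symmetric] indicator_def)
      then have "norm (\<integral>x. h x * g x \<partial>lborel) = (\<integral>x. indicator D x * norm (h x) \<partial>lborel)"
        by (simp add: integral_nonneg_AE del: of_real_mult)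
      moreover have "Lp_norm p' g = (\<integral>x. indicator D x \<partial>lborel)"
        using p1 by (simp add: Lp_norm_def ng)
      ultimately have "(\<integral>x. indicator D x * norm (h x) \<partial>lborel) \<le> (\<integral>x. c * indicator D x \<partial>lborel)"
        using le[OF g] by simp
      then have "(\<integral>x. indicator D x * norm (h x) - c * indicator D x \<partial>lborel) \<le> 0"
        using ih iD by (subst Bochner_Integration.integral_diff) auto
      moreover have nn: "0 \<le> indicator D x * norm (h x) - c * indicator D x" for x
        by (auto simp: D_def indicator_def)
      ultimately have "(\<integral>x. indicator D x * norm (h x) - c * indicator D x \<partial>lborel) = 0"
        by (intro antisym integral_nonneg_AE) auto
      then have "AE x in lborel. indicator D x * norm (h x) - c * indicator D x = 0"
        using nn ih iD by (subst (asm) integral_nonneg_eq_0_iff_AE) auto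
      then show ?thesis by eventually_elim (auto simp: D_def indicator_def split: if_splits)
    qed
    then have "AE x in lborel. \<forall>n. \<not> (x \<in> E n \<and> c < norm (h x))" unfolding AE_all_countable by blast
    then have "AE x in lborel. norm (h x) \<le> c"
    proof eventually_elim
      case (elim x)
      obtain n where "norm x \<le> real n" "norm (h x) \<le> real n"
        using real_arch_simple[of "max (norm x) (norm (h x))"] by auto
      then show ?case using elim by (auto simp: E_def not_less)
    qed
    then show ?thesis using Lp_space_infinityI[of h c] c inf by auto
  next
    case (fin r)
    define I where "I n = (\<integral>x. indicator (E n) x * norm (h x) powr r \<partial>lborel)" for n
    have int_I: "integrable lborel (\<lambda>x. indicator (E n) x * norm (h x) powr r)" for n
      by (rule bound_int[of _ "real n powr r" n])
        (use fin in \<open>auto simp: indicator_def E_def intro!: powr_mono2\<close>)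
    have I: "I n \<le> c powr r" for n
    proof (cases "I n = 0")
      case False
      have "0 \<le> I n" unfolding I_def by (rule integral_nonneg_AE) auto
      with False have pos: "0 < I n" by simp
      define g where "g x = of_real (indicator (E n) x * norm (h x) powr (r - 1)) * cnj (sgn (h x))" for x
      have ng: "norm (g x) = indicator (E n) x * norm (h x) powr (r - 1)" for x
        by (auto simp: g_def norm_mult norm_sgn indicator_def)
      have gle: "norm (g x) \<le> real n powr (r - 1) * indicator (E n) x" for x
        using fin by (auto simp: ng indicator_def E_def intro!: powr_mono2)
      have g: "nice g"
        unfolding nice_def
      proof
        show "integrable lborel g"
          by (rule bound_int[OF _ gle]) (simp add: g_def[abs_def])
        show "\<exists>C. \<forall>x. norm (g x) \<le> C"
        proof (intro exI allI)
          show "norm (g x) \<le> real n powr (r - 1)" for x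
            by (rule order_trans[OF gle]) (simp add: indicator_def)
        qed
      qed
      have "h x * g x = of_real (indicator (E n) x * norm (h x) powr r)" for x
      proof -
        have "h x * g x = of_real (indicator (E n) x * norm (h x) powr (r - 1)) * (h x * cnj (sgn (h x)))"
          by (simp add: g_def)
        also have "\<dots> = of_real (indicator (E n) x * (norm (h x) powr (r - 1) * norm (h x) powr 1))"
          by (simp add: hc)
        also have "\<dots> = of_real (indicator (E n) x * norm (h x) powr r)"
          by (subst powr_add[symmetric]) simp
        finally show ?thesis .
      qed
      then have "(\<integral>x. h x * g x \<partial>lborel) = of_real (I n)" by (simp add: I_def del: of_real_mult)
      then have "norm (\<integral>x. h x * g x \<partial>lborel) = I n" using pos by simp
      then have "I n \<le> c * Lp_norm p' g" using le[OF g] by simp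
      \<comment> \<open>Since (r - 1) r' = r, the p'-norm of \<open>g\<close> is a power of the same
        integral \<open>I n\<close>, and dividing by it leaves
        \<open>I n powr (1 / r) \<le> c\<close>. For r = 1 the exponent p' is \<infinity>, and the
        bound 1 is \<open>I n powr 0\<close>, where positivity of \<open>I n\<close> is
        used.\<close>
      also have "Lp_norm p' g \<le> I n powr (1 - 1 / r)"
        using p'(1)
      proof (cases p' rule: exponent_cases)
        case inf
        then have r1: "r = 1" using p'(2) fin by auto
        have "norm (g x) \<le> 1" for x using gle[of x] by (auto simp: ng r1 indicator_def)
        then show ?thesis using Lp_space_infinityI(2)[of g 1] niceD[OF g] inf pos r1 by auto
      next
        case (fin r')
        have eq: "1 / r + 1 / r' = 1" using p'(2) fin \<open>enn2real (1 / p) = 1 / r\<close> by simp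
        then have "(r - 1) * r' = r" using \<open>1 \<le> r\<close> \<open>1 \<le> r'\<close> by (simp add: field_simps)
        then have "norm (g x) powr r' = indicator (E n) x * norm (h x) powr r" for x
          by (auto simp: ng indicator_def powr_powr)
        then have "Lp_norm p' g = I n powr (1 / r')" using fin by (simp add: Lp_norm_def I_def)
        moreover have "1 / r' = 1 - 1 / r" using eq by linarith
        ultimately show ?thesis by simp
      qed
      finally have "I n \<le> c * I n powr (1 - 1 / r)" using c by (simp add: mult_left_mono)
      then have "I n powr (1 / r) * I n powr (1 - 1 / r) \<le> c * I n powr (1 - 1 / r)"
        using pos by (subst powr_add[symmetric]) simp
      then have "I n powr (1 / r) \<le> c" using pos by simp
      then have "(I n powr (1 / r)) powr r \<le> c powr r" using fin by (intro powr_mono2) auto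
      then show ?thesis using pos fin by (simp add: powr_powr)
    qed simp
    have lim: "(\<lambda>n. indicator (E n) x * norm (h x) powr r) \<longlonglongrightarrow> norm (h x) powr r" for x
    proof (rule tendsto_eventually)
      obtain N where "max (norm x) (norm (h x)) \<le> real N" using real_arch_simple by blast
      then show "\<forall>\<^sub>F n in sequentially. indicator (E n) x * norm (h x) powr r = norm (h x) powr r"
        by (intro eventually_sequentiallyI[of N]) (auto simp: E_def indicator_def)
    qed
    have nn: "(\<integral>\<^sup>+x. ennreal (norm (h x) powr r) \<partial>lborel) \<le> ennreal (c powr r)"
    proof -
      have "(\<integral>\<^sup>+x. ennreal (norm (h x) powr r) \<partial>lborel)
          = (\<integral>\<^sup>+x. liminf (\<lambda>n. ennreal (indicator (E n) x * norm (h x) powr r)) \<partial>lborel)"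
        by (intro nn_integral_cong lim_imp_Liminf[symmetric] tendsto_ennrealI lim) simp
      also have "\<dots> \<le> liminf (\<lambda>n. \<integral>\<^sup>+x. ennreal (indicator (E n) x * norm (h x) powr r) \<partial>lborel)"
        by (rule nn_integral_liminf) simp
      also have "\<dots> \<le> liminf (\<lambda>_. ennreal (c powr r))"
      proof (rule Liminf_mono, rule always_eventually, rule allI)
        show "(\<integral>\<^sup>+x. ennreal (indicator (E n) x * norm (h x) powr r) \<partial>lborel) \<le> ennreal (c powr r)" for n
          using I[of n] by (subst nn_integral_eq_integral[OF int_I]) (auto simp: I_def)
      qed
      also have "\<dots> = ennreal (c powr r)" by (rule Liminf_const) simp
      finally show ?thesis .
    qed
    then have int: "integrable lborel (\<lambda>x. norm (h x) powr r)"
      by (intro integrableI_bounded) (auto simp: le_less_trans less_top)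
    have "(\<integral>x. norm (h x) powr r \<partial>lborel) \<le> c powr r"
      using nn by (subst (asm) nn_integral_eq_integral[OF int]) auto
    then have "(\<integral>x. norm (h x) powr r \<partial>lborel) powr (1 / r) \<le> (c powr r) powr (1 / r)"
      using fin by (intro powr_mono2) auto
    then show ?thesis using int fin c by (simp add: Lp_space_def Lp_norm_def powr_powr)
  qed
qed

section \<open>Product integrals\<close>

lemma borel_measurable_Pair_section:
  fixes F :: "'a::euclidean_space \<times> 'b::euclidean_space \<Rightarrow> 'c::topological_space"
  assumes "F \<in> borel_measurable borel"
  shows "(\<lambda>y. F (x, y)) \<in> borel_measurable borel" "(\<lambda>x. F (x, y)) \<in> borel_measurable borel"
proof -
  have "(\<lambda>y. (x, y)) \<in> borel_measurable (borel::'b measure)" "(\<lambda>x. (x, y)) \<in> borel_measurable (borel::'a measure)"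
    by (intro borel_measurable_continuous_onI continuous_intros)+
  then show "(\<lambda>y. F (x, y)) \<in> borel_measurable borel" "(\<lambda>x. F (x, y)) \<in> borel_measurable borel"
    using measurable_compose assms by blast+
qed

lemma borel_measurable_lborel_integral:
  fixes F :: "'a::euclidean_space \<times> 'b::euclidean_space \<Rightarrow> complex"
  assumes "F \<in> borel_measurable borel"
  shows "(\<lambda>x. \<integral>y. F (x, y) \<partial>lborel) \<in> borel_measurable borel"
proof -
  have "F \<in> borel_measurable (borel \<Otimes>\<^sub>M lborel)"
    using assms by (simp add: borel_prod[symmetric] cong: measurable_cong_sets sets_pair_measure_cong)
  then show ?thesis by (intro lborel.borel_measurable_lebesgue_integral) simp
qed

lemma nn_integral_lborel_pair:
  fixes F :: "'a::euclidean_space \<times> 'b::euclidean_space \<Rightarrow> ennreal"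
  assumes "F \<in> borel_measurable borel"
  shows "(\<integral>\<^sup>+z. F z \<partial>lborel) = (\<integral>\<^sup>+x. \<integral>\<^sup>+y. F (x, y) \<partial>lborel \<partial>lborel)"
    "(\<integral>\<^sup>+z. F z \<partial>lborel) = (\<integral>\<^sup>+y. \<integral>\<^sup>+x. F (x, y) \<partial>lborel \<partial>lborel)"
    "(\<lambda>x. \<integral>\<^sup>+y. F (x, y) \<partial>lborel) \<in> borel_measurable borel"
proof -
  have *: "F \<in> borel_measurable (lborel \<Otimes>\<^sub>M lborel)"
    using assms by (simp add: lborel_prod)
  show "(\<integral>\<^sup>+z. F z \<partial>lborel) = (\<integral>\<^sup>+x. \<integral>\<^sup>+y. F (x, y) \<partial>lborel \<partial>lborel)"
    by (subst lborel_prod[symmetric], subst lborel.nn_integral_fst[symmetric]) (use * in auto)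
  show "(\<integral>\<^sup>+z. F z \<partial>lborel) = (\<integral>\<^sup>+y. \<integral>\<^sup>+x. F (x, y) \<partial>lborel \<partial>lborel)"
    by (subst lborel_prod[symmetric], subst lborel_pair.nn_integral_snd[symmetric]) (use * in auto)
  show "(\<lambda>x. \<integral>\<^sup>+y. F (x, y) \<partial>lborel) \<in> borel_measurable borel"
    using lborel.borel_measurable_nn_integral_fst[OF *] by simp
qed

lemma integral_lborel_pair:
  fixes F :: "'a::euclidean_space \<times> 'b::euclidean_space \<Rightarrow> 'c::{banach,second_countable_topology}"
  assumes "integrable lborel F"
  shows "(\<integral>z. F z \<partial>lborel) = (\<integral>x. \<integral>y. F (x, y) \<partial>lborel \<partial>lborel)"
    "(\<integral>z. F z \<partial>lborel) = (\<integral>y. \<integral>x. F (x, y) \<partial>lborel \<partial>lborel)"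
    "integrable lborel (\<lambda>x. \<integral>y. F (x, y) \<partial>lborel)"
    "integrable lborel (\<lambda>y. \<integral>x. F (x, y) \<partial>lborel)"
    "AE x in lborel. integrable lborel (\<lambda>y. F (x, y))"
    "AE y in lborel. integrable lborel (\<lambda>x. F (x, y))"
proof -
  have *: "integrable (lborel \<Otimes>\<^sub>M lborel) F" "integrable (lborel \<Otimes>\<^sub>M lborel) (\<lambda>(x, y). F (x, y))"
    using assms by (simp_all add: lborel_prod)
  show "(\<integral>z. F z \<partial>lborel) = (\<integral>x. \<integral>y. F (x, y) \<partial>lborel \<partial>lborel)"
    using lborel_pair.integral_fst'[OF *(1)] by (simp add: lborel_prod)
  show "(\<integral>z. F z \<partial>lborel) = (\<integral>y. \<integral>x. F (x, y) \<partial>lborel \<partial>lborel)"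
    using lborel_pair.integral_snd[OF *(2)] by (simp add: lborel_prod)
  show "integrable lborel (\<lambda>x. \<integral>y. F (x, y) \<partial>lborel)"
    using lborel_pair.integrable_fst'[OF *(1)] .
  show "integrable lborel (\<lambda>y. \<integral>x. F (x, y) \<partial>lborel)"
    using lborel_pair.integrable_snd[OF *(2)] .
  show "AE x in lborel. integrable lborel (\<lambda>y. F (x, y))"
    using lborel_pair.AE_integrable_fst'[OF *(1)] .
  show "AE y in lborel. integrable lborel (\<lambda>x. F (x, y))"
    using lborel_pair.AE_integrable_snd[OF *(2)] .
qed

lemma borel_measurable_fst_snd [measurable]:
  "fst \<in> borel_measurable (borel :: ('a::euclidean_space \<times> 'b::euclidean_space) measure)"
  "snd \<in> borel_measurable (borel :: ('a::euclidean_space \<times> 'b::euclidean_space) measure)"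
  by (intro borel_measurable_continuous_onI continuous_intros)+

lemma integrable_lborel_mult:
  fixes f :: "'a::euclidean_space \<Rightarrow> 'c::{real_normed_algebra,banach,second_countable_topology}"
    and g :: "'b::euclidean_space \<Rightarrow> 'c"
  assumes f: "integrable lborel f" and g: "integrable lborel g"
  shows "integrable lborel (\<lambda>z. f (fst z) * g (snd z))"
proof (rule integrableI_bounded)
  have [measurable]: "f \<in> borel_measurable borel" "g \<in> borel_measurable borel" using f g by auto
  show "(\<lambda>z. f (fst z) * g (snd z)) \<in> borel_measurable lborel" by simp
  have "(\<integral>\<^sup>+z. ennreal (norm (f (fst z) * g (snd z))) \<partial>lborel)
     \<le> (\<integral>\<^sup>+z. ennreal (norm (f (fst z))) * ennreal (norm (g (snd z))) \<partial>lborel)"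
    by (intro nn_integral_mono) (simp add: ennreal_mult[symmetric] norm_mult_ineq ennreal_leI)
  also have "\<dots> = (\<integral>\<^sup>+x. ennreal (norm (f x)) \<partial>lborel) * (\<integral>\<^sup>+y. ennreal (norm (g y)) \<partial>lborel)"
    by (subst nn_integral_lborel_pair) (simp_all add: nn_integral_cmult nn_integral_multc)
  also have "\<dots> < \<infinity>"
    using f g by (simp add: integrable_iff_bounded ennreal_mult_less_top)
  finally show "(\<integral>\<^sup>+z. ennreal (norm (f (fst z) * g (snd z))) \<partial>lborel) < \<infinity>" .
qed

lemma integral_lborel_mult:
  fixes f :: "'a::euclidean_space \<Rightarrow> 'c::{real_normed_field,banach,second_countable_topology}"
    and g :: "'b::euclidean_space \<Rightarrow> 'c"
  assumes f: "integrable lborel f" and g: "integrable lborel g"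
  shows "(\<integral>z. f (fst z) * g (snd z) \<partial>lborel) = (\<integral>x. f x \<partial>lborel) * (\<integral>y. g y \<partial>lborel)"
  by (subst integral_lborel_pair(1)[OF integrable_lborel_mult[OF f g]]) (use g f in simp)

text \<open>A bounded kernel keeps the product of two integrable functions integrable on the product
  space, so Fubini applies although the kernels in question, characters possibly times a bounded
  function, have no decay.\<close>

lemma fubini_bounded_kernel:
  fixes K :: "'a::euclidean_space \<times> 'b::euclidean_space \<Rightarrow> complex"
  assumes u: "integrable lborel u" and v: "integrable lborel v"
    and [measurable]: "K \<in> borel_measurable borel" and K: "\<And>z. norm (K z) \<le> C"
  shows "(\<integral>x. u x * (\<integral>y. K (x, y) * v y \<partial>lborel) \<partial>lborel)
      = (\<integral>y. v y * (\<integral>x. K (x, y) * u x \<partial>lborel) \<partial>lborel)"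
    "integrable lborel (\<lambda>x. u x * (\<integral>y. K (x, y) * v y \<partial>lborel))"
    "integrable lborel (\<lambda>y. v y * (\<integral>x. K (x, y) * u x \<partial>lborel))"
proof -
  have [measurable]: "u \<in> borel_measurable borel" "v \<in> borel_measurable borel" using u v by auto
  have C: "0 \<le> C" using K[of undefined] norm_ge_zero order_trans by blast
  have int: "integrable lborel (\<lambda>z. K z * (u (fst z) * v (snd z)))"
  proof (rule Bochner_Integration.integrable_bound)
    show "integrable lborel (\<lambda>z. of_real C * (u (fst z) * v (snd z)))"
      by (intro integrable_mult_right integrable_lborel_mult u v)
    show "AE z in lborel. norm (K z * (u (fst z) * v (snd z))) \<le> norm (of_real C * (u (fst z) * v (snd z)))"
      using K C by (auto simp: norm_mult intro!: mult_right_mono)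
  qed simp
  have 1: "(\<integral>y. K (x, y) * (u x * v y) \<partial>lborel) = u x * (\<integral>y. K (x, y) * v y \<partial>lborel)" for x
    by (simp add: mult.left_commute)
  have 2: "(\<integral>x. K (x, y) * (u x * v y) \<partial>lborel) = v y * (\<integral>x. K (x, y) * u x \<partial>lborel)" for y
    by (simp add: mult.left_commute mult.commute[of "u _" "v y"])
  show "(\<integral>x. u x * (\<integral>y. K (x, y) * v y \<partial>lborel) \<partial>lborel)
      = (\<integral>y. v y * (\<integral>x. K (x, y) * u x \<partial>lborel) \<partial>lborel)"
    using integral_lborel_pair(1,2)[OF int] by (simp add: 1 2)
  show "integrable lborel (\<lambda>x. u x * (\<integral>y. K (x, y) * v y \<partial>lborel))"
    "integrable lborel (\<lambda>y. v y * (\<integral>x. K (x, y) * u x \<partial>lborel))"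
    using integral_lborel_pair(3,4)[OF int] by (simp_all add: 1 2)
qed

section \<open>Gaussians and the Fourier transform\<close>

text \<open>\<open>c\<close> is an inverse width. The factor pi matches the 2 pi in the frequency
  normalisation: the transform of \<open>gauss c\<close> is \<open>gauss (1 / c)\<close> divided by
  c to the power of the dimension.\<close>

definition gauss :: "real \<Rightarrow> 'a::euclidean_space \<Rightarrow> real" where
  "gauss c x = exp (- (pi * c\<^sup>2 * (norm x)\<^sup>2))"

lemma gauss_pos [simp]: "0 < gauss c x" and gauss_nonneg [simp]: "0 \<le> gauss c x" and gauss_le_1 [simp]: "gauss c x \<le> 1"
  by (auto simp: gauss_def)

lemma gauss_measurable [measurable]: "gauss c \<in> borel_measurable borel"
  unfolding gauss_def[abs_def] by measurable

lemma gauss_ft_real: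
  fixes c u :: real
  assumes c: "0 < c"
  shows "integrable lborel (\<lambda>x. cis (2 * pi * (x * u)) * of_real (gauss c x))"
    "(\<integral>x. cis (2 * pi * (x * u)) * of_real (gauss c x) \<partial>lborel) = of_real (gauss (1 / c) u / c)"
proof -
  \<comment> \<open>Substituting \<open>s * x\<close> turns the exponent of the standard normal
    density into -pi c^2 x^2, and \<open>t\<close> is then forced by
    \<open>t * s = 2 * pi * u\<close>, so the known characteristic function applies.\<close>
  define s where "s = sqrt (2 * pi) * c"
  define t where "t = 2 * pi * u / s"
  have s: "0 < s" "s\<^sup>2 = 2 * pi * c\<^sup>2" using c by (auto simp: s_def power_mult_distrib)
  define f where "f x = cis (t * x) * of_real (std_normal_density x)" for x
  have int: "integrable lborel f"
    unfolding f_def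
    by (rule Bochner_Integration.integrable_bound[of _ std_normal_density]) (auto simp: norm_mult cis_conv_exp)
  have "char std_normal_distribution t = (\<integral>x. f x \<partial>lborel)"
    unfolding char_def f_def
    by (subst integral_density) (auto simp: cis_conv_exp scaleR_conv_of_real mult.commute)
  then have I: "(\<integral>x. f x \<partial>lborel) = of_real (exp (- t\<^sup>2 / 2))" by (simp add: char_std_normal_distribution)
  have eq: "f (0 + s * x) = of_real (1 / sqrt (2 * pi)) * (cis (2 * pi * (x * u)) * of_real (gauss c x))" for x
  proof -
    have "t * (s * x) = 2 * pi * (x * u)" using s by (simp add: t_def)
    moreover have "std_normal_density (s * x) = 1 / sqrt (2 * pi) * gauss c x"
      using s by (simp add: std_normal_density_def gauss_def power_mult_distrib)
    moreover have "f (0 + s * x) = cis (t * (s * x)) * of_real (std_normal_density (s * x))"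
      by (simp add: f_def)
    ultimately show ?thesis by (simp only: of_real_mult mult_ac)
  qed
  have "integrable lborel (\<lambda>x. f (0 + s * x))"
    by (rule lborel_integrable_real_affine[OF int]) (use s in simp)
  then have "integrable lborel (\<lambda>x. of_real (sqrt (2 * pi)) * f (0 + s * x))"
    by (rule integrable_mult_right)
  then show "integrable lborel (\<lambda>x. cis (2 * pi * (x * u)) * of_real (gauss c x))"
    unfolding eq by (simp add: mult.assoc[symmetric] del: of_real_mult)
  have "of_real (exp (- t\<^sup>2 / 2)) = of_real s * (\<integral>x. f (0 + s * x) \<partial>lborel)"
    unfolding I[symmetric]
    by (subst lborel_integral_real_affine[where c=s and t=0]) (use s in \<open>auto simp: scaleR_conv_of_real\<close>)
  also have "\<dots> = of_real c * (\<integral>x. cis (2 * pi * (x * u)) * of_real (gauss c x) \<partial>lborel)"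
    unfolding eq by (simp add: s_def)
  finally have "(\<integral>x. cis (2 * pi * (x * u)) * of_real (gauss c x) \<partial>lborel) = of_real (exp (- t\<^sup>2 / 2) / c)"
    using c by (simp add: field_simps)
  moreover have "- t\<^sup>2 / 2 = - (pi * (1 / c)\<^sup>2 * (norm u)\<^sup>2)"
    using c s by (simp add: t_def power_divide power_mult_distrib) (simp add: field_simps power2_eq_square)
  ultimately show "(\<integral>x. cis (2 * pi * (x * u)) * of_real (gauss c x) \<partial>lborel) = of_real (gauss (1 / c) u / c)"
    by (simp add: gauss_def)
qed

lemma integral_lborel_prod_Basis:
  fixes f :: "'a::euclidean_space \<Rightarrow> real \<Rightarrow> complex"
  assumes int: "\<And>b. b \<in> Basis \<Longrightarrow> integrable lborel (f b)"
  shows "integrable lborel (\<lambda>x. \<Prod>b\<in>Basis. f b (x \<bullet> b))"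
    "(\<integral>x. (\<Prod>b\<in>Basis. f b (x \<bullet> b)) \<partial>lborel) = (\<Prod>b\<in>Basis. \<integral>x. f b x \<partial>lborel)"
proof -
  interpret P: product_sigma_finite "\<lambda>_::'a. lborel::real measure" ..
  have [measurable]: "f b \<in> borel_measurable borel" if "b \<in> Basis" for b using int[OF that] by auto
  define J where "J g = (\<Sum>b\<in>Basis. g b *\<^sub>R b)" for g :: "'a \<Rightarrow> real"
  have J: "J g \<bullet> b = g b" if "b \<in> Basis" for g b
    unfolding J_def using that by (rule inner_sum_left_Basis)
  have [measurable]: "J \<in> borel_measurable (Pi\<^sub>M Basis (\<lambda>_. lborel))"
    unfolding J_def by measurable
  have lb: "(lborel::'a measure) = distr (Pi\<^sub>M Basis (\<lambda>_. lborel)) borel J"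
    unfolding J_def by (rule lborel_eq)
  have eq: "(\<Prod>b\<in>Basis. f b (J g \<bullet> b)) = (\<Prod>b\<in>Basis. f b (g b))" for g
    by (rule prod.cong) (simp_all add: J)
  show "integrable lborel (\<lambda>x. \<Prod>b\<in>Basis. f b (x \<bullet> b))"
    by (subst lb, subst integrable_distr_eq) (simp_all add: eq P.product_integrable_prod int)
  show "(\<integral>x. (\<Prod>b\<in>Basis. f b (x \<bullet> b)) \<partial>lborel) = (\<Prod>b\<in>Basis. \<integral>x. f b x \<partial>lborel)"
    by (subst lb, subst integral_distr) (simp_all add: eq P.product_integral_prod int)
qed

text \<open>The character and the Gaussian both factor over the coordinates, which reduces the claim
  to the line.\<close>

lemma gauss_ft:
  fixes t :: "'a::euclidean_space"
  assumes c: "0 < c"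
  shows "integrable lborel (\<lambda>w. cis (2 * pi * (w \<bullet> t)) * of_real (gauss c w))"
    "(\<integral>w. cis (2 * pi * (w \<bullet> t)) * of_real (gauss c w) \<partial>lborel) = of_real (gauss (1 / c) t / c ^ DIM('a))"
proof -
  have cis_sum: "cis (\<Sum>b\<in>B. g b) = (\<Prod>b\<in>B. cis (g b))" if "finite B" for g :: "'a \<Rightarrow> real" and B
    using that by (induction B rule: finite_induct) (auto simp: cis_mult[symmetric])
  have g: "gauss k w = (\<Prod>b\<in>Basis. gauss k (w \<bullet> b))" for k and w :: 'a
  proof -
    have "(norm w)\<^sup>2 = (\<Sum>b\<in>Basis. (w \<bullet> b)\<^sup>2)"
      by (subst power2_norm_eq_inner, subst euclidean_inner) (simp add: power2_eq_square)
    then show ?thesis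
      unfolding gauss_def by (subst exp_sum[symmetric]) (simp_all add: sum_negf sum_distrib_left)
  qed
  have eq: "cis (2 * pi * (w \<bullet> t)) * of_real (gauss c w)
      = (\<Prod>b\<in>Basis. cis (2 * pi * ((w \<bullet> b) * (t \<bullet> b))) * of_real (gauss c (w \<bullet> b)))" for w
    by (subst g, subst euclidean_inner) (simp add: cis_sum sum_distrib_left prod.distrib)
  note * = integral_lborel_prod_Basis[of "\<lambda>b x. cis (2 * pi * (x * (t \<bullet> b))) * of_real (gauss c x)",
      OF gauss_ft_real(1)[OF c]]
  show "integrable lborel (\<lambda>w. cis (2 * pi * (w \<bullet> t)) * of_real (gauss c w))"
    unfolding eq by (rule *(1))
  have "(\<integral>w. cis (2 * pi * (w \<bullet> t)) * of_real (gauss c w) \<partial>lborel)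
    = (\<Prod>b\<in>Basis. of_real (gauss (1 / c) (t \<bullet> b) / c))"
    unfolding eq *(2) by (rule prod.cong[OF refl]) (rule gauss_ft_real(2)[OF c])
  also have "\<dots> = of_real (gauss (1 / c) t / c ^ DIM('a))"
    by (subst g[of "1 / c" t]) (simp add: prod_dividef)
  finally show "(\<integral>w. cis (2 * pi * (w \<bullet> t)) * of_real (gauss c w) \<partial>lborel) = of_real (gauss (1 / c) t / c ^ DIM('a))" .
qed

lemma gauss_integral:
  assumes c: "0 < c"
  shows "integrable lborel (gauss c :: 'a::euclidean_space \<Rightarrow> real)"
    "(\<integral>x. gauss c (x::'a) \<partial>lborel) = 1 / c ^ DIM('a)"
proof -
  have "integrable lborel (\<lambda>x::'a. complex_of_real (gauss c x))"
    using gauss_ft(1)[OF c, of 0] by simp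
  then show int: "integrable lborel (gauss c :: 'a \<Rightarrow> real)"
    by (simp only: complex_of_real_integrable_eq)
  have "complex_of_real (\<integral>x. gauss c (x::'a) \<partial>lborel) = of_real (1 / c ^ DIM('a))"
    using gauss_ft(2)[OF c, of "0::'a"] by (simp add: gauss_def)
  then show "(\<integral>x. gauss c (x::'a) \<partial>lborel) = 1 / c ^ DIM('a)" by (simp only: of_real_eq_iff)
qed

section \<open>Fourier transform, Gaussian regularisation and Plancherel's inequality\<close>

definition ft :: "('a::euclidean_space \<Rightarrow> complex) \<Rightarrow> 'a \<Rightarrow> complex" where
  "ft h w = (\<integral>y. cis (2 * pi * (w \<bullet> y)) * h y \<partial>lborel)"

lemma borel_measurable_cis [measurable (raw)]:
  "f \<in> borel_measurable M \<Longrightarrow> (\<lambda>x. cis (f x)) \<in> borel_measurable M"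
  by (simp add: cis_conv_exp)

lemma ft_measurable:
  assumes [measurable]: "h \<in> borel_measurable borel"
  shows "ft h \<in> borel_measurable borel"
  unfolding ft_def[abs_def]
  using borel_measurable_lborel_integral[of "\<lambda>z. cis (2 * pi * (fst z \<bullet> snd z)) * h (snd z)"] by simp

lemma integrable_cis_mult:
  assumes "integrable lborel (h :: 'a::euclidean_space \<Rightarrow> complex)"
  shows "integrable lborel (\<lambda>y. cis (2 * pi * (w \<bullet> y)) * h y)"
proof -
  have [measurable]: "h \<in> borel_measurable borel" using assms by auto
  show ?thesis by (rule Bochner_Integration.integrable_bound[OF assms]) (auto simp: norm_mult)
qed

lemma ft_bound:
  assumes "integrable lborel h"
  shows "norm (ft h w) \<le> (\<integral>x. norm (h x) \<partial>lborel)"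
  unfolding ft_def by (rule order_trans[OF integral_norm_bound]) (simp add: norm_mult)

text \<open>The Gaussian makes the frequency integral absolutely convergent; integrating the
  frequency out first leaves its transform, a mollifier of total mass 1, between \<open>u\<close>
  and \<open>v\<close>. This is Parseval's identity up to mollification, and both Plancherel's
  inequality and the inversion bound are limits of it.\<close>

lemma gauss_pairing:
  fixes u v :: "'a::euclidean_space \<Rightarrow> complex"
  assumes u: "integrable lborel u" and v: "integrable lborel v" and c: "0 < c"
  shows "(\<integral>w. of_real (gauss c w) * (ft u w * cnj (ft v w)) \<partial>lborel)
    = (\<integral>z. u (fst z) * cnj (v (snd z)) * of_real (gauss (1 / c) (fst z - snd z) / c ^ DIM('a)) \<partial>lborel)" (is ?eq)
    "integrable lborel (\<lambda>z. u (fst z) * cnj (v (snd z)) * of_real (gauss (1 / c) (fst z - snd z) / c ^ DIM('a)))" (is ?int)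
proof -
  have [measurable]: "u \<in> borel_measurable borel" "v \<in> borel_measurable borel" using u v by auto
  define W where "W z = u (fst z) * cnj (v (snd z))" for z
  have vc: "integrable lborel (\<lambda>x. cnj (v x))" using v by simp
  have W: "integrable lborel W" unfolding W_def by (rule integrable_lborel_mult[OF u vc])
  define K where "K p = cis (2 * pi * (fst p \<bullet> (fst (snd p) - snd (snd p))))" for p :: "'a \<times> 'a \<times> 'a"
  have [measurable]: "K \<in> borel_measurable borel" unfolding K_def[abs_def] by measurable
  have g: "integrable lborel (\<lambda>w::'a. complex_of_real (gauss c w))"
    using gauss_integral(1)[OF c, where 'a='a] by simp
  note * = fubini_bounded_kernel[OF g W, of K 1]
  have 1: "(\<integral>z. K (w, z) * W z \<partial>lborel) = ft u w * cnj (ft v w)" for w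
  proof -
    have "K (w, z) * W z = (cis (2 * pi * (w \<bullet> fst z)) * u (fst z)) * cnj (cis (2 * pi * (w \<bullet> snd z)) * v (snd z))" for z
      by (simp add: K_def W_def inner_diff_right right_diff_distrib cis_divide[symmetric] cis_cnj divide_inverse cis_inverse)
    then have "(\<integral>z. K (w, z) * W z \<partial>lborel) = (\<integral>z. (cis (2 * pi * (w \<bullet> fst z)) * u (fst z)) * cnj (cis (2 * pi * (w \<bullet> snd z)) * v (snd z)) \<partial>lborel)"
      by simp
    also have "\<dots> = (\<integral>x. cis (2 * pi * (w \<bullet> x)) * u x \<partial>lborel) * (\<integral>y. cnj (cis (2 * pi * (w \<bullet> y)) * v y) \<partial>lborel)"
      by (rule integral_lborel_mult) (use integrable_cis_mult[OF u] integrable_cis_mult[OF v] integrable_cnj in blast)+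
    also have "\<dots> = ft u w * cnj (ft v w)"
      unfolding ft_def by (subst Bochner_Integration.integral_cnj) (rule refl)
    finally show ?thesis .
  qed
  have 2: "(\<integral>w. K (w, z) * of_real (gauss c w) \<partial>lborel) = of_real (gauss (1 / c) (fst z - snd z) / c ^ DIM('a))" for z
    using gauss_ft(2)[OF c, of "fst z - snd z"] by (simp add: K_def)
  show ?eq using *(1) unfolding 1 2 by (simp add: K_def W_def mult.assoc)
  show ?int using *(3) unfolding 1 2 by (simp add: K_def W_def mult.assoc)
qed

lemma gauss_mollifier:
  assumes c: "0 < c"
  shows "integrable lborel (\<lambda>y::'a::euclidean_space. gauss (1 / c) (x - y) / c ^ DIM('a))"
   "(\<integral>y. gauss (1 / c) (x - y) / c ^ DIM('a) \<partial>lborel) = 1"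
   "integrable lborel (\<lambda>y::'a. gauss (1 / c) (y - x) / c ^ DIM('a))"
   "(\<integral>y. gauss (1 / c) (y - x) / c ^ DIM('a) \<partial>lborel) = 1"
proof -
  have eq: "gauss (1 / c) (y - x) = gauss (1 / c) (x - y)" for y by (simp add: gauss_def norm_minus_commute)
  have c': "0 < 1 / c" using c by simp
  have sc: "affine_scaling (\<lambda>y. x - y :: 'a) 1" by (rule affine_scaling_reflect)
  show 1: "integrable lborel (\<lambda>y::'a. gauss (1 / c) (x - y) / c ^ DIM('a))"
    using affine_scaling_integral(1)[OF sc, of "gauss (1 / c)"] gauss_integral(1)[OF c', where 'a='a] by simp
  have "(\<integral>y. gauss (1 / c) (x - y) \<partial>lborel) = c ^ DIM('a)"
    using affine_scaling_integral(2)[OF sc, of "gauss (1 / c)"] gauss_integral(2)[OF c', where 'a='a] c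
    by (simp only: gauss_measurable scaleR_one power_divide) simp
  moreover have "(\<integral>y. gauss (1 / c) (x - y) / c ^ DIM('a) \<partial>lborel) = (\<integral>y. gauss (1 / c) (x - y) \<partial>lborel) / c ^ DIM('a)"
    by (rule integral_divide_zero)
  ultimately show 2: "(\<integral>y. gauss (1 / c) (x - y) / c ^ DIM('a) \<partial>lborel) = 1"
    using c by (metis divide_self power_eq_0_iff order_less_irrefl)
  show "integrable lborel (\<lambda>y::'a. gauss (1 / c) (y - x) / c ^ DIM('a))"
   "(\<integral>y. gauss (1 / c) (y - x) / c ^ DIM('a) \<partial>lborel) = 1" unfolding eq by (rule 1, rule 2)
qed

lemma gauss_tendsto: "(\<lambda>n. gauss (1 / real (Suc n)) x) \<longlonglongrightarrow> 1"
proof -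
  have "(\<lambda>n. exp (- (pi * (1 / real (Suc n))\<^sup>2 * (norm x)\<^sup>2))) \<longlonglongrightarrow> exp (- (pi * 0\<^sup>2 * (norm x)\<^sup>2))"
    by (intro tendsto_intros LIMSEQ_Suc lim_1_over_n)
  then show ?thesis by (simp add: gauss_def)
qed

text \<open>The regularised left side is a mollified form in \<open>h\<close>, bounded uniformly in
  the parameter by |ab| \<le> (a^2 + b^2)/2 and mass 1 of the mollifier in either variable. Fatou's
  lemma removes the regularisation, which is why an inequality results; the L2 endpoint needs no
  more.\<close>

lemma plancherel_le:
  fixes h :: "'a::euclidean_space \<Rightarrow> complex"
  assumes h: "integrable lborel h" and h2: "integrable lborel (\<lambda>x. (norm (h x))\<^sup>2)"
  shows "(\<integral>\<^sup>+w. ennreal ((norm (ft h w))\<^sup>2) \<partial>lborel) \<le> ennreal (\<integral>x. (norm (h x))\<^sup>2 \<partial>lborel)"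
proof -
  have [measurable]: "h \<in> borel_measurable borel" using h by auto
  have [measurable]: "ft h \<in> borel_measurable borel" by (rule ft_measurable) simp
  define N where "N = (\<integral>x. (norm (h x))\<^sup>2 \<partial>lborel)"
  have step: "(\<integral>\<^sup>+w. ennreal (gauss c w * (norm (ft h w))\<^sup>2) \<partial>lborel) \<le> ennreal N" if c: "0 < c" for c
  proof -
    define G where "G x = gauss (1 / c) x / c ^ DIM('a)" for x :: 'a
    have G: "0 \<le> G x" for x using c by (simp add: G_def)
    have [measurable]: "G \<in> borel_measurable borel" unfolding G_def[abs_def] by measurable
    have intA: "integrable lborel (\<lambda>w. gauss c w * (norm (ft h w))\<^sup>2)"
    proof (rule Bochner_Integration.integrable_bound)
      show "integrable lborel (\<lambda>w::'a. gauss c w * (\<integral>x. norm (h x) \<partial>lborel)\<^sup>2)"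
        using gauss_integral(1)[OF c, where 'a='a] by simp
      show "AE w in lborel. norm (gauss c w * (norm (ft h w))\<^sup>2) \<le> norm (gauss c w * (\<integral>x. norm (h x) \<partial>lborel)\<^sup>2)"
        by (auto simp: abs_mult intro!: mult_left_mono power_mono ft_bound h)
    qed simp
    have "complex_of_real (\<integral>w. gauss c w * (norm (ft h w))\<^sup>2 \<partial>lborel)
        = (\<integral>w. of_real (gauss c w) * (ft h w * cnj (ft h w)) \<partial>lborel)"
      by (simp only: integral_complex_of_real[symmetric] of_real_mult complex_norm_square)
    also have "\<dots> = (\<integral>z. h (fst z) * cnj (h (snd z)) * of_real (G (fst z - snd z)) \<partial>lborel)"
      unfolding G_def by (rule gauss_pairing(1)[OF h h c])
    finally have eq: "complex_of_real (\<integral>w. gauss c w * (norm (ft h w))\<^sup>2 \<partial>lborel) = \<dots>" .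
    have i1: "integrable lborel (\<lambda>z. (norm (h (fst z)))\<^sup>2 * G (fst z - snd z))"
      and v1: "(\<integral>z. (norm (h (fst z)))\<^sup>2 * G (fst z - snd z) \<partial>lborel) = N"
      and i2: "integrable lborel (\<lambda>z. (norm (h (snd z)))\<^sup>2 * G (fst z - snd z))"
      and v2: "(\<integral>z. (norm (h (snd z)))\<^sup>2 * G (fst z - snd z) \<partial>lborel) = N"
    proof -
      have nnG: "(\<integral>\<^sup>+y. ennreal (G (x - y)) \<partial>lborel) = 1" "(\<integral>\<^sup>+y. ennreal (G (y - x)) \<partial>lborel) = 1" for x
        using gauss_mollifier[OF c, of x] G unfolding G_def[symmetric] by (auto simp: nn_integral_eq_integral)
      have nnN: "(\<integral>\<^sup>+x. ennreal ((norm (h x))\<^sup>2) \<partial>lborel) = ennreal N"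
        unfolding N_def by (rule nn_integral_eq_integral[OF h2]) simp
      have n1: "(\<integral>\<^sup>+z. ennreal ((norm (h (fst z)))\<^sup>2 * G (fst z - snd z)) \<partial>lborel) = ennreal N"
        by (subst nn_integral_lborel_pair(1)) (simp_all add: ennreal_mult G nn_integral_cmult nnG nnN)
      have n2: "(\<integral>\<^sup>+z. ennreal ((norm (h (snd z)))\<^sup>2 * G (fst z - snd z)) \<partial>lborel) = ennreal N"
        by (subst nn_integral_lborel_pair(2)) (simp_all add: ennreal_mult G nn_integral_cmult nnG nnN)
      have N0: "0 \<le> N" unfolding N_def by (rule integral_nonneg_AE) simp
      show "integrable lborel (\<lambda>z. (norm (h (fst z)))\<^sup>2 * G (fst z - snd z))"
        by (rule integrableI_nn_integral_finite[OF _ _ n1]) (auto simp: G)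
      show "integrable lborel (\<lambda>z. (norm (h (snd z)))\<^sup>2 * G (fst z - snd z))"
        by (rule integrableI_nn_integral_finite[OF _ _ n2]) (auto simp: G)
      show "(\<integral>z. (norm (h (fst z)))\<^sup>2 * G (fst z - snd z) \<partial>lborel) = N"
        using n1 N0 by (subst integral_eq_nn_integral) (auto simp: G)
      show "(\<integral>z. (norm (h (snd z)))\<^sup>2 * G (fst z - snd z) \<partial>lborel) = N"
        using n2 N0 by (subst integral_eq_nn_integral) (auto simp: G)
    qed
    have "(\<integral>w. gauss c w * (norm (ft h w))\<^sup>2 \<partial>lborel) \<le> norm (complex_of_real (\<integral>w. gauss c w * (norm (ft h w))\<^sup>2 \<partial>lborel))"
      by simp
    also have "\<dots> \<le> (\<integral>z. norm (h (fst z) * cnj (h (snd z)) * of_real (G (fst z - snd z))) \<partial>lborel)"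
      unfolding eq by (rule integral_norm_bound)
    also have "\<dots> \<le> (\<integral>z. (1/2) * ((norm (h (fst z)))\<^sup>2 * G (fst z - snd z)) + (1/2) * ((norm (h (snd z)))\<^sup>2 * G (fst z - snd z)) \<partial>lborel)"
    proof (rule integral_mono)
      show "integrable lborel (\<lambda>z. norm (h (fst z) * cnj (h (snd z)) * of_real (G (fst z - snd z))))"
        using gauss_pairing(2)[OF h h c] unfolding G_def by (rule integrable_norm)
      show "integrable lborel (\<lambda>z. (1/2) * ((norm (h (fst z)))\<^sup>2 * G (fst z - snd z)) + (1/2) * ((norm (h (snd z)))\<^sup>2 * G (fst z - snd z)))"
        using i1 i2 by auto
      have am: "a * b \<le> (1/2) * a\<^sup>2 + (1/2) * b\<^sup>2" for a b :: real
        using zero_le_power2[of "a - b"] by (simp add: power2_diff)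
      show "norm (h (fst z) * cnj (h (snd z)) * of_real (G (fst z - snd z))) \<le>
        (1/2) * ((norm (h (fst z)))\<^sup>2 * G (fst z - snd z)) + (1/2) * ((norm (h (snd z)))\<^sup>2 * G (fst z - snd z))" for z
        using mult_right_mono[OF am[of "norm (h (fst z))" "norm (h (snd z))"] G[of "fst z - snd z"]] G[of "fst z - snd z"]
        by (simp add: norm_mult distrib_right)
    qed
    also have "\<dots> = N" using i1 i2 v1 v2 by simp
    finally show ?thesis
      by (subst nn_integral_eq_integral[OF intA]) (auto intro: ennreal_leI)
  qed
  have "(\<integral>\<^sup>+w. ennreal ((norm (ft h w))\<^sup>2) \<partial>lborel)
      = (\<integral>\<^sup>+w. liminf (\<lambda>n. ennreal (gauss (1 / real (Suc n)) w * (norm (ft h w))\<^sup>2)) \<partial>lborel)"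
  proof (intro nn_integral_cong lim_imp_Liminf[symmetric] tendsto_ennrealI)
    show "(\<lambda>n. gauss (1 / real (Suc n)) w * (norm (ft h w))\<^sup>2) \<longlonglongrightarrow> (norm (ft h w))\<^sup>2" for w
      using tendsto_mult_right[OF gauss_tendsto[of w], of "(norm (ft h w))\<^sup>2"] by simp
  qed simp
  also have "\<dots> \<le> liminf (\<lambda>n. \<integral>\<^sup>+w. ennreal (gauss (1 / real (Suc n)) w * (norm (ft h w))\<^sup>2) \<partial>lborel)"
    by (rule nn_integral_liminf) simp
  also have "\<dots> \<le> liminf (\<lambda>_. ennreal N)"
    by (rule Liminf_mono, rule always_eventually, rule allI, rule step) simp
  also have "\<dots> = ennreal N" by (rule Liminf_const) simp
  finally show ?thesis unfolding N_def .
qed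

section \<open>Complex interpolation\<close>

text \<open>The maximum modulus principle requires a bounded region, while \<open>F\<close> is
  merely bounded on the strip. A factor exp (\<epsilon> (z^2 - 1)) forces decay in the imaginary
  direction and is removed by letting \<epsilon> tend to 0.\<close>

lemma three_lines:
  fixes F :: "complex \<Rightarrow> complex"
  assumes hol: "F holomorphic_on UNIV"
    and B: "\<And>z. 0 \<le> Re z \<Longrightarrow> Re z \<le> 1 \<Longrightarrow> norm (F z) \<le> B"
    and m0: "0 < m0" "\<And>z. Re z = 0 \<Longrightarrow> norm (F z) \<le> m0"
    and m1: "0 < m1" "\<And>z. Re z = 1 \<Longrightarrow> norm (F z) \<le> m1"
    and t: "0 \<le> t" "t \<le> 1"
  shows "norm (F (of_real t)) \<le> m0 powr (1 - t) * m1 powr t"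
proof -
  \<comment> \<open>Division by m0^(1-z) m1^z normalises both boundary bounds to 1.\<close>
  define G where "G z = F z * exp ((z - 1) * of_real (ln m0) - z * of_real (ln m1))" for z
  define e where "e x = exp ((x - 1) * ln m0 - x * ln m1)" for x :: real
  have nG: "norm (G z) = norm (F z) * e (Re z)" for z
    by (simp add: G_def e_def norm_mult norm_exp_eq_Re)
  define B' where "B' = \<bar>B\<bar> * exp (\<bar>ln m0\<bar> + \<bar>ln m1\<bar>)"
  have GB: "norm (G z) \<le> B'" if z: "0 \<le> Re z" "Re z \<le> 1" for z
  proof -
    have "(Re z - 1) * ln m0 \<le> \<bar>ln m0\<bar>"
    proof -
      have "\<bar>(Re z - 1) * ln m0\<bar> \<le> 1 * \<bar>ln m0\<bar>" unfolding abs_mult using z by (intro mult_right_mono) auto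
      then show ?thesis by simp
    qed
    moreover have "- (Re z * ln m1) \<le> \<bar>ln m1\<bar>"
    proof -
      have "\<bar>Re z * ln m1\<bar> \<le> 1 * \<bar>ln m1\<bar>" unfolding abs_mult using z by (intro mult_right_mono) auto
      then show ?thesis by simp
    qed
    ultimately have "e (Re z) \<le> exp (\<bar>ln m0\<bar> + \<bar>ln m1\<bar>)" by (simp add: e_def)
    moreover have "norm (F z) \<le> \<bar>B\<bar>" using B[OF z] by simp
    ultimately show ?thesis unfolding nG B'_def by (intro mult_mono) (auto simp: e_def)
  qed
  have G0: "norm (G z) \<le> 1" if z: "Re z = 0" for z
  proof -
    have "e 0 = 1 / m0" using m0(1) by (simp add: e_def exp_minus inverse_eq_divide)
    then have "norm (G z) = norm (F z) / m0" by (simp add: nG z)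
    then show ?thesis using m0(2)[OF z] m0(1) by simp
  qed
  have G1: "norm (G z) \<le> 1" if z: "Re z = 1" for z
  proof -
    have "e 1 = 1 / m1" using m1(1) by (simp add: e_def exp_minus inverse_eq_divide)
    then have "norm (G z) = norm (F z) / m1" by (simp add: nG z)
    then show ?thesis using m1(2)[OF z] m1(1) by simp
  qed
  have holG: "G holomorphic_on UNIV"
    unfolding G_def using hol by (intro holomorphic_intros)
  have key: "norm (G (of_real t)) \<le> exp (\<epsilon> * (1 - t\<^sup>2))" if eps: "0 < \<epsilon>" for \<epsilon>
  proof -
    define H where "H z = G z * exp (of_real \<epsilon> * (z\<^sup>2 - 1))" for z
    have nH: "norm (H z) = norm (G z) * exp (\<epsilon> * ((Re z)\<^sup>2 - (Im z)\<^sup>2 - 1))" for z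
      by (simp add: H_def norm_mult norm_exp_eq_Re power2_eq_square)
    \<comment> \<open>At height \<open>R\<close> the extra factor is at most 1 / (B' + 1), which
      beats the bound \<open>B'\<close> for \<open>G\<close> on the horizontal sides; on the
      vertical sides it is at most 1.\<close>
    define R where "R = sqrt (\<bar>ln (B' + 1)\<bar> / \<epsilon>)"
    have B'0: "0 \<le> B'" by (simp add: B'_def)
    have R: "0 \<le> R" "\<epsilon> * R\<^sup>2 = \<bar>ln (B' + 1)\<bar>" using eps by (auto simp: R_def)
    define Q where "Q = cbox (Complex 0 (-R)) (Complex 1 R)"
    have Q: "z \<in> Q \<longleftrightarrow> 0 \<le> Re z \<and> Re z \<le> 1 \<and> -R \<le> Im z \<and> Im z \<le> R" for z
      by (auto simp: Q_def in_cbox_complex_iff)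
    have "norm (H (of_real t)) \<le> 1"
    proof (rule maximum_modulus_frontier[of H Q])
      have holH: "H holomorphic_on UNIV" unfolding H_def using holG by (intro holomorphic_intros)
      then show "H holomorphic_on interior Q" by (rule holomorphic_on_subset) simp
      show "continuous_on (closure Q) H"
        using holomorphic_on_imp_continuous_on[OF holH] continuous_on_subset by blast
      show "bounded Q" by (simp add: Q_def bounded_cbox)
      show "of_real t \<in> Q" using t R by (simp add: Q)
      fix z assume "z \<in> frontier Q"
      then have z: "z \<in> Q" "z \<notin> box (Complex 0 (-R)) (Complex 1 R)"
        by (auto simp: Q_def frontier_def interior_cbox)
      have le1: "(Re z)\<^sup>2 \<le> 1" using z(1) by (simp add: Q power_le_one)
      consider "Re z = 0" | "Re z = 1" | "\<bar>Im z\<bar> = R"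
        using z by (auto simp: Q in_box_complex_iff)
      then show "norm (H z) \<le> 1"
      proof cases
        case 3
        have "(Im z)\<^sup>2 = R\<^sup>2" using 3 by (metis power2_abs)
        then have "\<epsilon> * ((Re z)\<^sup>2 - (Im z)\<^sup>2 - 1) \<le> - (\<epsilon> * R\<^sup>2)"
          using le1 eps by (simp add: algebra_simps)
        then have "exp (\<epsilon> * ((Re z)\<^sup>2 - (Im z)\<^sup>2 - 1)) \<le> exp (- \<bar>ln (B' + 1)\<bar>)" by (simp add: R)
        also have "\<dots> = 1 / (B' + 1)" using B'0 by (simp add: exp_minus inverse_eq_divide)
        finally have "norm (H z) \<le> B' * (1 / (B' + 1))"
          unfolding nH using GB[of z] z(1) B'0 by (intro mult_mono) (auto simp: Q)
        also have "\<dots> \<le> 1" using B'0 by (simp add: field_simps)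
        finally show ?thesis .
      next
        case 1
        have "exp (\<epsilon> * ((Re z)\<^sup>2 - (Im z)\<^sup>2 - 1)) \<le> 1"
          using le1 eps by (simp add: mult_le_0_iff) (smt (verit) zero_le_power2)
        then show ?thesis unfolding nH using G0[OF 1] by (intro mult_le_one) auto
      next
        case 2
        have "exp (\<epsilon> * ((Re z)\<^sup>2 - (Im z)\<^sup>2 - 1)) \<le> 1"
          using le1 eps by (simp add: mult_le_0_iff) (smt (verit) zero_le_power2)
        then show ?thesis unfolding nH using G1[OF 2] by (intro mult_le_one) auto
      qed
    qed
    then show ?thesis
      by (simp add: nH exp_diff exp_minus right_diff_distrib exp_add field_simps)
  qed
  have "norm (G (of_real t)) \<le> 1"
  proof (rule tendsto_lowerbound[of "\<lambda>\<epsilon>. exp (\<epsilon> * (1 - t\<^sup>2))"  _ "at_right 0"])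
    have "((\<lambda>\<epsilon>. exp (\<epsilon> * (1 - t\<^sup>2))) \<longlongrightarrow> exp (0 * (1 - t\<^sup>2))) (at_right 0)" by (intro tendsto_intros)
    then show "((\<lambda>\<epsilon>. exp (\<epsilon> * (1 - t\<^sup>2))) \<longlongrightarrow> 1) (at_right 0)" by simp
    show "\<forall>\<^sub>F \<epsilon> in at_right 0. norm (G (of_real t)) \<le> exp (\<epsilon> * (1 - t\<^sup>2))"
      by (rule eventually_mono[OF eventually_at_right_less]) (rule key)
  qed simp
  moreover have "e t * (m0 powr (1 - t) * m1 powr t) = 1"
    using m0(1) m1(1) by (simp add: e_def powr_def exp_add[symmetric] algebra_simps)
  ultimately have "norm (F (of_real t)) * e t \<le> (m0 powr (1 - t) * m1 powr t) * e t"
    by (simp add: nG mult.commute)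
  then show ?thesis by (simp add: e_def)
qed

text \<open>Because \<open>b\<close> is bounded, the exponential series is dominated by the one for
  \<open>R * norm z\<close> times |w|. It may be integrated term by term, which gives a power series
  converging on the whole plane.\<close>

lemma holomorphic_integral_exp:
  fixes w :: "'a \<Rightarrow> complex" and b :: "'a \<Rightarrow> real"
  assumes w: "integrable M w" and [measurable]: "b \<in> borel_measurable M" and b: "\<And>x. \<bar>b x\<bar> \<le> R"
  shows "(\<lambda>z. \<integral>x. w x * exp (z * of_real (b x)) \<partial>M) holomorphic_on UNIV"
proof -
  have [measurable]: "w \<in> borel_measurable M" using w by auto
  have R: "0 \<le> R" using b[of undefined] by simp
  define a where "a n = (\<integral>x. w x * of_real (b x ^ n / fact n) \<partial>M)" for n
  have intn: "integrable M (\<lambda>x. w x * of_real (b x ^ n / fact n))" for n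
  proof (rule Bochner_Integration.integrable_bound)
    show "integrable M (\<lambda>x. w x * of_real (R ^ n / fact n))" using w by simp
    show "AE x in M. norm (w x * of_real (b x ^ n / fact n)) \<le> norm (w x * of_real (R ^ n / fact n))"
      using b R by (auto simp: norm_mult norm_divide norm_power intro!: mult_left_mono divide_right_mono power_mono)
  qed simp
  have sums: "(\<lambda>n. a n * z ^ n) sums (\<integral>x. w x * exp (z * of_real (b x)) \<partial>M)" for z
  proof -
    define f where "f n x = w x * of_real (b x ^ n / fact n) * z ^ n" for n x
    have nf: "norm (f n x) \<le> norm (w x) * ((R * norm z) ^ n / fact n)" for n x
    proof -
      have "\<bar>b x\<bar> ^ n \<le> R ^ n" using b by (intro power_mono) auto
      then have "\<bar>b x\<bar> ^ n * norm z ^ n / fact n \<le> R ^ n * norm z ^ n / fact n"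
        by (intro divide_right_mono mult_right_mono) auto
      from mult_left_mono[OF this norm_ge_zero[of "w x"]] show ?thesis unfolding f_def
        by (simp add: norm_mult norm_divide norm_power power_mult_distrib mult.assoc)
    qed
    have sexp: "summable (\<lambda>n. (R * norm z) ^ n / fact n)"
      using summable_exp_generic[of "R * norm z"] by (simp add: divide_inverse mult.commute)
    have i1: "integrable M (f n)" for n unfolding f_def by (intro integrable_mult_left intn)
    have i2: "AE x in M. summable (\<lambda>n. norm (f n x))"
      by (rule AE_I2) (rule summable_comparison_test'[OF summable_mult[OF sexp], where N=0], use nf in auto)
    have i3: "summable (\<lambda>n. \<integral>x. norm (f n x) \<partial>M)"
    proof (rule summable_comparison_test'[OF summable_mult[OF sexp], where N=0])
      fix n
      have "(\<integral>x. norm (f n x) \<partial>M) \<le> (\<integral>x. norm (w x) * ((R * norm z) ^ n / fact n) \<partial>M)"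
        by (rule integral_mono) (use i1 w nf in auto)
      then show "norm (\<integral>x. norm (f n x) \<partial>M) \<le> (\<integral>x. norm (w x) \<partial>M) * ((R * norm z) ^ n / fact n)"
        by simp
    qed
    have "(\<lambda>n. \<integral>x. f n x \<partial>M) sums (\<integral>x. (\<Sum>n. f n x) \<partial>M)"
      by (rule sums_integral[OF i1 i2 i3])
    moreover have "(\<Sum>n. f n x) = w x * exp (z * of_real (b x))" for x
    proof -
      have "(\<lambda>n. w x * ((z * of_real (b x)) ^ n /\<^sub>R fact n)) sums (w x * exp (z * of_real (b x)))"
        by (intro sums_mult exp_converges)
      moreover have "w x * ((z * of_real (b x)) ^ n /\<^sub>R fact n) = f n x" for n
        by (simp add: f_def power_mult_distrib scaleR_conv_of_real divide_inverse)
      ultimately show ?thesis by (simp add: sums_iff)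
    qed
    moreover have "(\<integral>x. f n x \<partial>M) = a n * z ^ n" for n unfolding f_def a_def by simp
    ultimately show ?thesis by simp
  qed
  have "(\<lambda>z. \<integral>x. w x * exp (z * of_real (b x)) \<partial>M) holomorphic_on ball 0 r" for r
    by (rule power_series_holomorphic[where a=a]) (use sums in simp)
  then have "(\<lambda>z. \<integral>x. w x * exp (z * of_real (b x)) \<partial>M) holomorphic_on (\<Union>r\<in>UNIV. ball 0 r)"
    by (intro holomorphic_on_UN_open) auto
  moreover have "(\<Union>r. ball 0 r) = (UNIV :: complex set)"
    by auto (metis gt_ex)
  ultimately show ?thesis by simp
qed

text \<open>Not the principal power: the phase of \<open>w\<close> is kept and only its modulus is
  raised to \<open>\<zeta>\<close>. This makes the power entire in \<open>\<zeta>\<close>, equal to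
  \<open>w\<close> at 1, and of modulus depending only on Re \<zeta>.\<close>

definition cpow :: "complex \<Rightarrow> complex \<Rightarrow> complex" where
  "cpow \<zeta> w = (if w = 0 then 0 else sgn w * exp (\<zeta> * of_real (ln (norm w))))"

lemma cpow_1 [simp]: "cpow 1 w = w"
  by (simp add: cpow_def exp_of_real sgn_div_norm scaleR_conv_of_real divide_inverse)

lemma norm_cpow: "norm (cpow \<zeta> w) = norm w powr Re \<zeta>"
  by (simp add: cpow_def norm_mult norm_sgn powr_def)

lemma cpow_measurable [measurable]: 
  assumes [measurable]: "f \<in> borel_measurable M"
  shows "(\<lambda>x. cpow \<zeta> (f x)) \<in> borel_measurable M"
proof -
  have [measurable]: "(exp :: complex \<Rightarrow> complex) \<in> borel_measurable borel"
    by (intro borel_measurable_continuous_onI continuous_intros)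
  show ?thesis unfolding cpow_def by measurable
qed

text \<open>On the support ln |f| lies between -ln n and ln n, so the exponents in
  \<open>cpow\<close> stay bounded there; the lower cutoff is as necessary for this as the upper
  one.\<close>

definition truncated :: "nat \<Rightarrow> ('a \<Rightarrow> complex) \<Rightarrow> bool" where
  "truncated n f \<longleftrightarrow> 0 < n \<and> (\<forall>x. f x = 0 \<or> 1 / real n \<le> norm (f x) \<and> norm (f x) \<le> real n)"

lemma truncated_ln_bound:
  assumes "truncated n f" "f x \<noteq> 0"
  shows "\<bar>ln (norm (f x))\<bar> \<le> ln (real n)"
proof -
  have n: "0 < n" "1 / real n \<le> norm (f x)" "norm (f x) \<le> real n"
    using assms by (auto simp: truncated_def)
  have "ln (1 / real n) \<le> ln (norm (f x))" "ln (norm (f x)) \<le> ln (real n)"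
    using n assms(2) by (subst ln_le_cancel_iff; auto)+
  then show ?thesis using n by (simp add: ln_div)
qed

text \<open>The power differs from \<open>f\<close> in modulus by |f|^(Re \<zeta> - 1), which
  truncation bounds by a power of \<open>n\<close>. Integrability and boundedness of
  \<open>f\<close> therefore survive every complex power.\<close>

lemma truncated_cpow_bound:
  assumes "truncated n f"
  shows "norm (cpow \<zeta> (f x)) \<le> exp (\<bar>Re \<zeta> - 1\<bar> * ln (real n)) * norm (f x)"
proof (cases "f x = 0")
  case False
  have "norm (f x) powr Re \<zeta> = norm (f x) powr (Re \<zeta> - 1) * norm (f x) powr 1"
    by (subst powr_add[symmetric]) simp
  also have "\<dots> = exp ((Re \<zeta> - 1) * ln (norm (f x))) * norm (f x)"
    using False by (simp add: powr_def)
  also have "\<dots> \<le> exp (\<bar>Re \<zeta> - 1\<bar> * ln (real n)) * norm (f x)"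
  proof (intro mult_right_mono, subst exp_le_cancel_iff)
    have "(Re \<zeta> - 1) * ln (norm (f x)) \<le> \<bar>Re \<zeta> - 1\<bar> * \<bar>ln (norm (f x))\<bar>"
      by (simp add: abs_mult[symmetric])
    also have "\<dots> \<le> \<bar>Re \<zeta> - 1\<bar> * ln (real n)"
      using truncated_ln_bound[OF assms False] by (intro mult_left_mono) auto
    finally show "(Re \<zeta> - 1) * ln (norm (f x)) \<le> \<bar>Re \<zeta> - 1\<bar> * ln (real n)" .
  qed simp
  finally show ?thesis by (simp add: norm_cpow)
qed (simp add: cpow_def)

lemma truncated_cpow_integrable:
  assumes "truncated n f" and f: "integrable lborel f"
  shows "integrable lborel (\<lambda>x. cpow \<zeta> (f x))"
proof (rule Bochner_Integration.integrable_bound)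
  have [measurable]: "f \<in> borel_measurable borel" using f by auto
  show "integrable lborel (\<lambda>x. of_real (exp (\<bar>Re \<zeta> - 1\<bar> * ln (real n))) * f x)" using f by simp
  show "AE x in lborel. norm (cpow \<zeta> (f x)) \<le> norm (of_real (exp (\<bar>Re \<zeta> - 1\<bar> * ln (real n))) * f x)"
    using truncated_cpow_bound[OF assms(1)] by (simp add: norm_mult)
  show "(\<lambda>x. cpow \<zeta> (f x)) \<in> borel_measurable lborel" by simp
qed

lemma truncated_cpow_nice:
  assumes tr: "truncated n f" and f: "nice f"
  shows "nice (\<lambda>x. cpow \<zeta> (f x))"
  unfolding nice_def
proof
  show "integrable lborel (\<lambda>x. cpow \<zeta> (f x))" 
    by (rule truncated_cpow_integrable[OF tr]) (use f in \<open>simp add: nice_def\<close>)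
  obtain C where C: "\<And>x. norm (f x) \<le> C" using f by (auto simp: nice_def)
  have "norm (cpow \<zeta> (f x)) \<le> exp (\<bar>Re \<zeta> - 1\<bar> * ln (real n)) * C" for x
    by (rule order_trans[OF truncated_cpow_bound[OF tr] mult_left_mono[OF C]]) simp
  then show "\<exists>C. \<forall>x. norm (cpow \<zeta> (f x)) \<le> C" by blast
qed

section \<open>The trilinear estimate\<close>

text \<open>\<open>U\<close> and \<open>W\<close> stand for $(x, y) \mapsto A_{11} x + A_{12} y$ and $(x, y) \mapsto A_{21} x + A_{22} y$, with
  \<open>D1\<close>, \<open>D2\<close>, \<open>D\<close> the absolute values of the determinants of $A_{12}$, $A_{22}$ and $A$.\<close>

locale wigner_geometry =
  fixes U W :: "'a::euclidean_space \<times> 'a \<Rightarrow> 'a" and Y :: "'a \<times> 'a \<Rightarrow> 'a" and D1 D2 D :: real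
  assumes U_measurable [measurable]: "U \<in> borel_measurable borel"
    and W_measurable [measurable]: "W \<in> borel_measurable borel"
    and Y_measurable [measurable]: "Y \<in> borel_measurable borel"
    and U_scaling: "\<And>x. affine_scaling (\<lambda>y. U (x, y)) D1"
    and W_scaling: "\<And>x. affine_scaling (\<lambda>y. W (x, y)) D2"
    and UW_scaling: "affine_scaling (\<lambda>z. (U z, W z)) D"
    and Y_U: "\<And>x y. Y (x, U (x, y)) = y"
begin

text \<open>The complex conjugate of the matrix-Wigner distribution of the conjugate of
  \<open>g\<close> and of \<open>f\<close>. In this form it is bilinear without conjugations, as
  analytic dependence on an interpolation parameter requires, and the character has a positive
  sign.\<close>

definition T :: "('a \<Rightarrow> complex) \<Rightarrow> ('a \<Rightarrow> complex) \<Rightarrow> 'a \<times> 'a \<Rightarrow> complex" where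
  "T f g z = (\<integral>y. cis (2 * pi * (snd z \<bullet> y)) * (g (U (fst z, y)) * f (W (fst z, y))) \<partial>lborel)"

lemma D_pos: "0 < D1" "0 < D2" "0 < D"
  by (rule affine_scaling_pos[OF U_scaling] affine_scaling_pos[OF W_scaling] affine_scaling_pos[OF UW_scaling])+

lemma T_measurable:
  assumes [measurable]: "f \<in> borel_measurable borel" "g \<in> borel_measurable borel"
  shows "T f g \<in> borel_measurable borel"
  unfolding T_def[abs_def]
  using borel_measurable_lborel_integral[of "\<lambda>v. cis (2 * pi * (snd (fst v) \<bullet> snd v)) *
    (g (U (fst (fst v), snd v)) * f (W (fst (fst v), snd v)))"] by simp

lemma section_nice:
  assumes f: "nice f" and g: "nice g"
  shows "nice (\<lambda>y. g (U (x, y)) * f (W (x, y)))"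
proof -
  have [measurable]: "f \<in> borel_measurable borel" "g \<in> borel_measurable borel" using f g by (auto dest: niceD)
  obtain C where C: "0 < C" "\<And>x. norm (g x) \<le> C" using nice_bound[OF g] by blast
  obtain C' where C': "0 < C'" "\<And>x. norm (f x) \<le> C'" using nice_bound[OF f] by blast
  note [measurable] = borel_measurable_Pair_section(1)[OF U_measurable, of x] borel_measurable_Pair_section(1)[OF W_measurable, of x]
  have i: "integrable lborel (\<lambda>y. f (W (x, y)))"
    using affine_scaling_integral(1)[OF W_scaling, of f x] f by (simp add: nice_def)
  show ?thesis
    unfolding nice_def
  proof
    show "integrable lborel (\<lambda>y. g (U (x, y)) * f (W (x, y)))"
    proof (rule Bochner_Integration.integrable_bound)
      show "integrable lborel (\<lambda>y. of_real C * f (W (x, y)))" using i by simp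
      show "AE y in lborel. norm (g (U (x, y)) * f (W (x, y))) \<le> norm (of_real C * f (W (x, y)))"
        using C by (auto simp: norm_mult intro!: mult_right_mono)
    qed simp
    have "norm (g (U (x, y)) * f (W (x, y))) \<le> C * C'" for y
      unfolding norm_mult using C C' by (intro mult_mono) (auto intro: less_imp_le)
    then show "\<exists>C. \<forall>y. norm (g (U (x, y)) * f (W (x, y))) \<le> C" by blast
  qed
qed

lemma T_le_section: "norm (T f g z) \<le> (\<integral>y. norm (g (U (fst z, y))) * norm (f (W (fst z, y))) \<partial>lborel)"
  unfolding T_def by (rule order_trans[OF integral_norm_bound]) (simp add: norm_mult)

lemma T_sup:
  assumes f: "nice f" and g: "nice g" and p: "1 \<le> p" and pp: "1 / p + 1 / p' = 1"
  shows "norm (T f g z) \<le> D1 powr (- enn2real (1 / p')) * D2 powr (- enn2real (1 / p)) * (Lp_norm p' g * Lp_norm p f)"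
proof -
  note p' = conjugate_exponents[OF p pp]
  note F = Lp_affine_scaling[OF W_scaling[of "fst z"] nice_Lp[OF f p] p]
  note G = Lp_affine_scaling[OF U_scaling[of "fst z"] nice_Lp[OF g p'(1)] p'(1)]
  have "norm (T f g z) \<le> (\<integral>y. norm (f (W (fst z, y))) * norm (g (U (fst z, y))) \<partial>lborel)"
    using T_le_section by (simp add: mult.commute)
  also have "\<dots> \<le> Lp_norm p (\<lambda>y. f (W (fst z, y))) * Lp_norm p' (\<lambda>y. g (U (fst z, y)))"
    by (rule Lp_holder(2)[OF F(1) G(1) p pp])
  also have "\<dots> \<le> (D2 powr (- enn2real (1 / p)) * Lp_norm p f) * (D1 powr (- enn2real (1 / p')) * Lp_norm p' g)"
    by (intro mult_mono F(2) G(2)) auto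
  finally show ?thesis by (simp add: mult_ac)
qed

text \<open>For fixed \<open>x\<close> the function of \<omega> is a Fourier transform in
  \<open>y\<close>, so Plancherel applies section by section. The remaining integral decouples under
  (x, y) \<mapsto> (U, W), and the Jacobian of this substitution is the source of \<open>D\<close>
  in the bound.\<close>

lemma T_L2:
  assumes f: "nice f" and g: "nice g"
  shows "(\<integral>\<^sup>+z. ennreal ((norm (T f g z))\<^sup>2) \<partial>lborel)
    \<le> ennreal (1 / D * ((\<integral>x. (norm (f x))\<^sup>2 \<partial>lborel) * (\<integral>x. (norm (g x))\<^sup>2 \<partial>lborel)))"
proof -
  have [measurable]: "f \<in> borel_measurable borel" "g \<in> borel_measurable borel" using f g by (auto dest: niceD)
  have [measurable]: "T f g \<in> borel_measurable borel" by (rule T_measurable) auto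
  have sq: "integrable lborel (\<lambda>x. (norm (u x))\<^sup>2)" if "nice u" for u :: "'a \<Rightarrow> complex"
    using nice_powr_integrable[OF that, of 2] by (simp add: powr_numeral)
  have nsq: "(\<integral>\<^sup>+x. ennreal ((norm (u x))\<^sup>2) \<partial>lborel) = ennreal (\<integral>x. (norm (u x))\<^sup>2 \<partial>lborel)" if "nice u" for u :: "'a \<Rightarrow> complex"
    using nn_integral_eq_integral[OF sq[OF that]] by simp
  have "(\<integral>\<^sup>+z. ennreal ((norm (T f g z))\<^sup>2) \<partial>lborel) = (\<integral>\<^sup>+x. \<integral>\<^sup>+w. ennreal ((norm (T f g (x, w)))\<^sup>2) \<partial>lborel \<partial>lborel)"
    by (rule nn_integral_lborel_pair(1)) simp
  also have "\<dots> \<le> (\<integral>\<^sup>+x. \<integral>\<^sup>+y. ennreal ((norm (g (U (x, y)) * f (W (x, y))))\<^sup>2) \<partial>lborel \<partial>lborel)"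
  proof (rule nn_integral_mono)
    fix x
    let ?h = "\<lambda>y. g (U (x, y)) * f (W (x, y))"
    have n: "nice ?h" by (rule section_nice[OF f g])
    have "T f g (x, w) = ft ?h w" for w by (simp add: T_def ft_def)
    then have "(\<integral>\<^sup>+w. ennreal ((norm (T f g (x, w)))\<^sup>2) \<partial>lborel) \<le> ennreal (\<integral>y. (norm (?h y))\<^sup>2 \<partial>lborel)"
      using plancherel_le[OF _ sq[OF n]] n by (simp add: nice_def)
    then show "(\<integral>\<^sup>+w. ennreal ((norm (T f g (x, w)))\<^sup>2) \<partial>lborel) \<le> (\<integral>\<^sup>+y. ennreal ((norm (?h y))\<^sup>2) \<partial>lborel)"
      unfolding nsq[OF n] .
  qed
  also have "\<dots> = (\<integral>\<^sup>+z. ennreal ((norm (g (U z)))\<^sup>2) * ennreal ((norm (f (W z)))\<^sup>2) \<partial>lborel)"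
    by (subst nn_integral_lborel_pair(1)) (simp_all add: norm_mult power_mult_distrib ennreal_mult)
  also have "\<dots> = ennreal (1 / D) * (\<integral>\<^sup>+z. ennreal ((norm (g (fst z)))\<^sup>2) * ennreal ((norm (f (snd z)))\<^sup>2) \<partial>lborel)"
    using affine_scaling_nn_integral[OF UW_scaling, of "\<lambda>z. ennreal ((norm (g (fst z)))\<^sup>2) * ennreal ((norm (f (snd z)))\<^sup>2)"] by simp
  also have "(\<integral>\<^sup>+z. ennreal ((norm (g (fst z)))\<^sup>2) * ennreal ((norm (f (snd z)))\<^sup>2) \<partial>lborel)
    = ennreal (\<integral>x. (norm (g x))\<^sup>2 \<partial>lborel) * ennreal (\<integral>x. (norm (f x))\<^sup>2 \<partial>lborel)"
    by (subst nn_integral_lborel_pair(1)) (simp_all add: nn_integral_cmult nn_integral_multc nsq f g)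
  also have "ennreal (1 / D) * \<dots> = ennreal (1 / D * ((\<integral>x. (norm (f x))\<^sup>2 \<partial>lborel) * (\<integral>x. (norm (g x))\<^sup>2 \<partial>lborel)))"
    using D_pos by (subst ennreal_mult[symmetric]; (subst ennreal_mult[symmetric])?; simp add: mult.commute)
  finally show ?thesis .
qed

text \<open>The function \<open>f\<close> is integrable along \<open>W\<close> with a norm
  independent of \<open>x\<close>, \<open>g\<close> is bounded and \<open>s\<close> is integrable.
  Writing the form as a single integral over (x, \<omega>, y) is what holomorphy and dominated
  convergence are later applied to.\<close>

lemma triple_integrable:
  fixes s :: "'a \<times> 'a \<Rightarrow> complex"
  assumes s: "integrable lborel s" and f: "nice f" and g: "nice g"
  shows "integrable lborel (\<lambda>v. s (fst v) * (cis (2 * pi * (snd (fst v) \<bullet> snd v)) *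
      (g (U (fst (fst v), snd v)) * f (W (fst (fst v), snd v)))))" (is "integrable _ ?F")
    and "(\<integral>v. s (fst v) * (cis (2 * pi * (snd (fst v) \<bullet> snd v)) *
      (g (U (fst (fst v), snd v)) * f (W (fst (fst v), snd v)))) \<partial>lborel) = (\<integral>z. s z * T f g z \<partial>lborel)" (is ?eq)
proof -
  have [measurable]: "f \<in> borel_measurable borel" "g \<in> borel_measurable borel" "s \<in> borel_measurable borel"
    using s f g by (auto dest: niceD)
  obtain C where C: "0 < C" "\<And>x. norm (g x) \<le> C" using nice_bound[OF g] by blast
  show int: "integrable lborel ?F"
  proof (rule integrableI_bounded)
    have "(\<integral>\<^sup>+v. ennreal (norm (?F v)) \<partial>lborel)
      \<le> (\<integral>\<^sup>+v. ennreal (norm (s (fst v)) * C) * ennreal (norm (f (W (fst (fst v), snd v)))) \<partial>lborel)"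
    proof (rule nn_integral_mono)
      fix v
      have "norm (?F v) \<le> (norm (s (fst v)) * C) * norm (f (W (fst (fst v), snd v)))"
        using C by (auto simp: norm_mult mult.assoc intro!: mult_left_mono mult_right_mono)
      then show "ennreal (norm (?F v)) \<le> ennreal (norm (s (fst v)) * C) * ennreal (norm (f (W (fst (fst v), snd v))))"
        using C by (subst ennreal_mult[symmetric]) (auto intro: ennreal_leI)
    qed
    also have "\<dots> = (\<integral>\<^sup>+z. ennreal (norm (s z) * C) * (\<integral>\<^sup>+y. ennreal (norm (f (W (fst z, y)))) \<partial>lborel) \<partial>lborel)"
      by (subst nn_integral_lborel_pair(1)) (simp_all add: nn_integral_cmult)
    also have "\<dots> = (\<integral>\<^sup>+z. ennreal (norm (s z) * C) * (ennreal (1 / D2) * (\<integral>\<^sup>+y. ennreal (norm (f y)) \<partial>lborel)) \<partial>lborel)"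
      using affine_scaling_nn_integral[OF W_scaling, of "\<lambda>y. ennreal (norm (f y))"] by simp
    also have "\<dots> = (\<integral>\<^sup>+z. ennreal (norm (s z) * C) \<partial>lborel) * (ennreal (1 / D2) * (\<integral>\<^sup>+y. ennreal (norm (f y)) \<partial>lborel))"
      by (rule nn_integral_multc) simp
    also have "\<dots> < \<infinity>"
      using s C niceD(1)[OF f] by (simp add: ennreal_mult nn_integral_multc integrable_iff_bounded ennreal_mult_less_top)
    finally show "(\<integral>\<^sup>+v. ennreal (norm (?F v)) \<partial>lborel) < \<infinity>" .
  qed simp
  show ?eq using integral_lborel_pair(1)[OF int] unfolding T_def by simp
qed

lemma T_zero:
  assumes [measurable]: "f \<in> borel_measurable borel" "g \<in> borel_measurable borel"
    and "(AE x in lborel. f x = 0) \<or> (AE x in lborel. g x = 0)"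
  shows "T f g z = 0"
proof -
  have "AE y in lborel. g (U (fst z, y)) * f (W (fst z, y)) = 0"
    using assms(3) affine_scaling_AE[OF U_scaling, of "\<lambda>x. g x = 0" "fst z"]
      affine_scaling_AE[OF W_scaling, of "\<lambda>x. f x = 0" "fst z"]
    by (elim disjE) (auto elim!: eventually_mono)
  then show ?thesis unfolding T_def by (intro integral_eq_zero_AE) (auto elim!: eventually_mono)
qed

text \<open>For every \<open>x\<close> the affine maps in \<open>y\<close> pull null sets back to
  null sets. Hence \<open>T\<close> has well-defined values at every point, although its arguments
  matter only up to null sets.\<close>

lemma T_cong_AE:
  assumes [measurable]: "f \<in> borel_measurable borel" "g \<in> borel_measurable borel"
      "f' \<in> borel_measurable borel" "g' \<in> borel_measurable borel"
    and f: "AE x in lborel. f x = f' x" and g: "AE x in lborel. g x = g' x"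
  shows "T f g z = T f' g' z"
  unfolding T_def
proof (rule integral_cong_AE)
  note [measurable] = borel_measurable_Pair_section(1)[OF U_measurable, of "fst z"] borel_measurable_Pair_section(1)[OF W_measurable, of "fst z"]
  show "AE y in lborel. cis (2 * pi * (snd z \<bullet> y)) * (g (U (fst z, y)) * f (W (fst z, y)))
      = cis (2 * pi * (snd z \<bullet> y)) * (g' (U (fst z, y)) * f' (W (fst z, y)))"
    using affine_scaling_AE[OF U_scaling g, of "fst z"] affine_scaling_AE[OF W_scaling f, of "fst z"]
    by eventually_elim simp
qed simp_all

text \<open>The powers \<open>cpow\<close> embed \<open>s\<close>, \<open>f\<close>, \<open>g\<close> into an analytic family whose form is bounded on
  \<open>Re z = 0\<close> by \<open>T_sup\<close> and on \<open>Re z = 1\<close> by the Plancherel bound \<open>T_L2\<close>. Truncation makes the form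
  $\int w\, e^{z \beta}$ with \<open>w\<close> integrable and \<open>\<beta>\<close> bounded, hence entire in \<open>z\<close>.\<close>

lemma trilinear_truncated:
  fixes s :: "'a \<times> 'a \<Rightarrow> complex"
  assumes s: "truncated n s" "integrable lborel s" and f: "truncated n f" "nice f" and g: "truncated n g" "nice g"
    and q: "1 \<le> q" and p: "1 \<le> p" "1 \<le> p'"
    and S: "(\<integral>\<^sup>+z. ennreal (norm (s z) powr q) \<partial>lborel) \<le> ennreal S" "0 < S"
    and Phi: "(\<integral>x. norm (f x) powr p \<partial>lborel) \<le> \<Phi>" "0 < \<Phi>"
    and Gam: "(\<integral>x. norm (g x) powr p' \<partial>lborel) \<le> \<Gamma>" "0 < \<Gamma>"
    and ab: "0 \<le> a" "0 \<le> b" "a + b = 1"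
    and th: "0 \<le> \<theta>" "\<theta> \<le> 1" "q * (1 - \<theta> / 2) = 1" "p * ((1 - \<theta>) * a + \<theta> / 2) = 1" "p' * ((1 - \<theta>) * b + \<theta> / 2) = 1"
  shows "norm (\<integral>z. s z * T f g z \<partial>lborel)
     \<le> (S * (D1 powr (- b) * D2 powr (- a) * (\<Gamma> powr b * \<Phi> powr a))) powr (1 - \<theta>)
      * (sqrt (S * (1 / D * (\<Phi> * \<Gamma>)))) powr \<theta>"
proof -
  have [measurable]: "f \<in> borel_measurable borel" "g \<in> borel_measurable borel" "s \<in> borel_measurable borel"
    using s f g by (auto dest: niceD)
  \<comment> \<open>Exponents affine in z, all equal to 1 at z = \<theta>. On Re z = 0 their real
    parts are q, p a and p' b, which fit L1 for the symbol and L^(1/a), L^(1/b) for the functions;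
    on Re z = 1 they are q/2, p/2 and p'/2, which fit L2 throughout.\<close>
  define cs where "cs z = of_real q * ((1 - z) + z / 2)" for z :: complex
  define cf where "cf z = of_real p * ((1 - z) * of_real a + z / 2)" for z :: complex
  define cg where "cg z = of_real p' * ((1 - z) * of_real b + z / 2)" for z :: complex
  define sz where "sz z x = cpow (cs z) (s x)" for z x
  define fz where "fz z x = cpow (cf z) (f x)" for z x
  define gz where "gz z x = cpow (cg z) (g x)" for z x
  have [measurable]: "sz z \<in> borel_measurable borel" "fz z \<in> borel_measurable borel" "gz z \<in> borel_measurable borel" for z
    by (auto simp: sz_def[abs_def] fz_def[abs_def] gz_def[abs_def])
  have isz: "integrable lborel (sz z)" for z unfolding sz_def by (rule truncated_cpow_integrable[OF s])
  have nfz: "nice (fz z)" for z unfolding fz_def by (rule truncated_cpow_nice[OF f])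
  have ngz: "nice (gz z)" for z unfolding gz_def by (rule truncated_cpow_nice[OF g])
  define F where "F z = (\<integral>x. sz z x * T (fz z) (gz z) x \<partial>lborel)" for z
  let ?f = "\<lambda>v :: ('a \<times> 'a) \<times> 'a. f (W (fst (fst v), snd v))"
  let ?g = "\<lambda>v :: ('a \<times> 'a) \<times> 'a. g (U (fst (fst v), snd v))"
  let ?s = "\<lambda>v :: ('a \<times> 'a) \<times> 'a. s (fst v)"
  define I where "I z v = sz z (fst v) * (cis (2 * pi * (snd (fst v) \<bullet> snd v)) *
      (gz z (U (fst (fst v), snd v)) * fz z (W (fst (fst v), snd v))))" for z v
  have I: "integrable lborel (I z)" "F z = (\<integral>v. I z v \<partial>lborel)" for z
    unfolding I_def F_def using triple_integrable[OF isz nfz ngz, of z z z] by auto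
  define supp where "supp v \<longleftrightarrow> ?s v \<noteq> 0 \<and> ?f v \<noteq> 0 \<and> ?g v \<noteq> 0" for v
  \<comment> \<open>The coefficient of z in the combined exponent of the three powers; off the
    common support all integrands vanish and the value 0 is harmless.\<close>
  define \<beta> where "\<beta> v = (if supp v then - (q / 2) * ln (norm (?s v)) + p * (1 / 2 - a) * ln (norm (?f v))
     + p' * (1 / 2 - b) * ln (norm (?g v)) else 0)" for v
  have [measurable]: "\<beta> \<in> borel_measurable borel" unfolding \<beta>_def[abs_def] supp_def by measurable
  define R where "R = (q / 2 + p * \<bar>1 / 2 - a\<bar> + p' * \<bar>1 / 2 - b\<bar>) * ln (real n)"
  have n1: "1 \<le> n" using s(1) by (simp add: truncated_def)
  have \<beta>R: "\<bar>\<beta> v\<bar> \<le> R" for v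
  proof (cases "supp v")
    case True
    have l: "\<bar>ln (norm (?s v))\<bar> \<le> ln n" "\<bar>ln (norm (?f v))\<bar> \<le> ln n" "\<bar>ln (norm (?g v))\<bar> \<le> ln n"
      using True truncated_ln_bound[OF s(1)] truncated_ln_bound[OF f(1)] truncated_ln_bound[OF g(1)]
      unfolding supp_def by blast+
    have m: "\<bar>k * l\<bar> \<le> \<bar>k\<bar> * m" if "\<bar>l\<bar> \<le> m" for k l m :: real
      unfolding abs_mult using that by (intro mult_left_mono) auto
    have "\<bar>\<beta> v\<bar> \<le> \<bar>- (q / 2)\<bar> * ln n + \<bar>p * (1 / 2 - a)\<bar> * ln n + \<bar>p' * (1 / 2 - b)\<bar> * ln n"
      using m[OF l(1), of "- (q / 2)"] m[OF l(2), of "p * (1 / 2 - a)"] m[OF l(3), of "p' * (1 / 2 - b)"] True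
      unfolding \<beta>_def if_P[OF True] by linarith
    moreover have "\<bar>- (q / 2)\<bar> = q / 2" "\<bar>p * (1 / 2 - a)\<bar> = p * \<bar>1 / 2 - a\<bar>" "\<bar>p' * (1 / 2 - b)\<bar> = p' * \<bar>1 / 2 - b\<bar>"
      using q p by (simp_all add: abs_mult)
    ultimately show ?thesis by (simp only: R_def distrib_right)
  next
    case False
    then show ?thesis using n1 q p by (simp add: \<beta>_def R_def)
  qed
  have Iexp: "I z v = I 0 v * exp (z * of_real (\<beta> v))" for z v
  proof (cases "supp v")
    case True
    have "exp (cs z * of_real (ln (norm (?s v)))) * exp (cf z * of_real (ln (norm (?f v)))) * exp (cg z * of_real (ln (norm (?g v))))
      = exp (cs 0 * of_real (ln (norm (?s v)))) * exp (cf 0 * of_real (ln (norm (?f v)))) * exp (cg 0 * of_real (ln (norm (?g v))))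
        * exp (z * of_real (\<beta> v))"
      unfolding exp_add[symmetric] \<beta>_def if_P[OF True] cs_def cf_def cg_def
      by (rule arg_cong[where f=exp]) (simp add: algebra_simps)
    then show ?thesis using True
      by (simp add: I_def sz_def fz_def gz_def cpow_def supp_def mult_ac)
  next
    case False
    then show ?thesis by (auto simp: I_def sz_def fz_def gz_def cpow_def supp_def)
  qed
  have Feq: "F = (\<lambda>z. \<integral>v. I 0 v * exp (z * of_real (\<beta> v)) \<partial>lborel)"
    by (rule ext, subst I(2), rule Bochner_Integration.integral_cong[OF refl], rule Iexp)
  have hol: "F holomorphic_on UNIV"
    unfolding Feq by (rule holomorphic_integral_exp[OF I(1) _ \<beta>R]) simp
  have bd: "norm (F z) \<le> (\<integral>v. norm (I 0 v) * exp R \<partial>lborel)" if z: "0 \<le> Re z" "Re z \<le> 1" for z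
  proof -
    have "norm (F z) \<le> (\<integral>v. norm (I z v) \<partial>lborel)" unfolding I(2) by (rule integral_norm_bound)
    also have "\<dots> \<le> (\<integral>v. norm (I 0 v) * exp R \<partial>lborel)"
    proof (rule integral_mono)
      show "integrable lborel (\<lambda>v. norm (I z v))" using I(1) by simp
      show "integrable lborel (\<lambda>v. norm (I 0 v) * exp R)" using I(1) by simp
      fix v
      have "Re z * \<beta> v \<le> Re z * R" using z \<beta>R[of v] by (intro mult_left_mono) auto
      also have "\<dots> \<le> 1 * R" using z order_trans[OF abs_ge_zero \<beta>R] by (intro mult_right_mono) auto
      finally show "norm (I z v) \<le> norm (I 0 v) * exp R"
        unfolding Iexp[of z] norm_mult norm_exp_eq_Re by (intro mult_left_mono) auto
    qed
    finally show ?thesis .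
  qed
  define m0 where "m0 = S * (D1 powr (- b) * D2 powr (- a) * (\<Gamma> powr b * \<Phi> powr a))"
  define m1 where "m1 = sqrt (S * (1 / D * (\<Phi> * \<Gamma>)))"
  have pos: "0 < m0" "0 < m1" unfolding m0_def m1_def using S Phi Gam D_pos by auto
  have B0: "norm (F z) \<le> m0" if z: "Re z = 0" for z
  proof -
    \<comment> \<open>Converts the real weights a and b back into Lebesgue exponents 1/a and 1/b;
      weight 0 stands for the exponent \<infinity>.\<close>
    have rec: "\<exists>r::ennreal. 1 \<le> r \<and> 1 / r = ennreal c \<and> enn2real (1 / r) = c \<and> (c = 0 \<longrightarrow> r = \<infinity>) \<and> (0 < c \<longrightarrow> r = ennreal (1 / c))"
      if c: "0 \<le> c" "c \<le> 1" for c :: real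
    proof (cases "c = 0")
      case False
      then have c0: "0 < c" using c by simp
      then have "1 / ennreal (1 / c) = ennreal c"
        by (subst ennreal_1[symmetric], subst divide_ennreal) auto
      then show ?thesis using c c0 by (intro exI[of _ "ennreal (1 / c)"]) auto
    qed (auto intro!: exI[of _ "\<infinity>"])
    have a1: "a \<le> 1" "b \<le> 1" using ab by auto
    obtain r where r: "1 \<le> r" "1 / r = ennreal a" "enn2real (1 / r) = a" "a = 0 \<Longrightarrow> r = \<infinity>" "0 < a \<Longrightarrow> r = ennreal (1 / a)"
      using rec[OF ab(1) a1(1)] by blast
    obtain r' where r': "1 \<le> r'" "1 / r' = ennreal b" "enn2real (1 / r') = b" "b = 0 \<Longrightarrow> r' = \<infinity>" "0 < b \<Longrightarrow> r' = ennreal (1 / b)"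
      using rec[OF ab(2) a1(2)] by blast
    have rr: "1 / r + 1 / r' = 1" using r r' ab by (simp add: ennreal_plus[symmetric] del: ennreal_plus)
    \<comment> \<open>On this line the modulus of the power is |u|^(e c), whose power 1/c is |u|^e,
      so the norm with exponent 1/c is at most \<open>B powr c\<close>. For c = 0 the modulus is at
      most 1, and so is \<open>Lp_norm \<infinity>\<close>.\<close>
    have Lp: "Lp_norm r (\<lambda>x. cpow \<zeta> (u x)) \<le> B powr c"
      if "nice (\<lambda>x. cpow \<zeta> (u x))" "Re \<zeta> = e * c" "0 \<le> c" "c = 0 \<Longrightarrow> r = \<infinity>" "0 < c \<Longrightarrow> r = ennreal (1 / c)"
        "(\<integral>x. norm (u x) powr e \<partial>lborel) \<le> B" "0 < B" for \<zeta> r u e c and B :: real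
    proof (cases "c = 0")
      case True
      have "norm (cpow \<zeta> (u x)) \<le> 1" for x using that(2) True by (simp add: norm_cpow powr_def)
      then show ?thesis using Lp_space_infinityI(2)[of "\<lambda>x. cpow \<zeta> (u x)" 1] that True niceD(2) by auto
    next
      case False
      then have c: "0 < c" using that by simp
      have "norm (cpow \<zeta> (u x)) powr (1 / c) = norm (u x) powr e" for x
        using c that(2) by (simp add: norm_cpow powr_powr)
      then have "Lp_norm r (\<lambda>x. cpow \<zeta> (u x)) = (\<integral>x. norm (u x) powr e \<partial>lborel) powr c"
        using that(5)[OF c] c by (simp add: Lp_norm_def)
      also have "\<dots> \<le> B powr c" using that(6) c by (intro powr_mono2 integral_nonneg_AE) auto
      finally show ?thesis .
    qed
    have Lf: "Lp_norm r (fz z) \<le> \<Phi> powr a"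
      unfolding fz_def by (rule Lp[OF nfz[unfolded fz_def] _ ab(1) r(4,5) Phi]) (simp_all add: cf_def z)
    have Lg: "Lp_norm r' (gz z) \<le> \<Gamma> powr b"
      unfolding gz_def by (rule Lp[OF ngz[unfolded gz_def] _ ab(2) r'(4,5) Gam]) (simp_all add: cg_def z)
    define K where "K = D1 powr (- b) * D2 powr (- a) * (\<Gamma> powr b * \<Phi> powr a)"
    have TK: "norm (T (fz z) (gz z) x) \<le> K" for x
    proof -
      have "norm (T (fz z) (gz z) x) \<le> D1 powr (- b) * D2 powr (- a) * (Lp_norm r' (gz z) * Lp_norm r (fz z))"
        using T_sup[OF nfz ngz r(1) rr, of z z x] r r' by simp
      also have "\<dots> \<le> K" unfolding K_def using Lf Lg by (intro mult_left_mono mult_mono) auto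
      finally show ?thesis .
    qed
    have K0: "0 \<le> K" using order_trans[OF norm_ge_zero TK] .
    have ns: "norm (sz z x) = norm (s x) powr q" for x by (simp add: sz_def norm_cpow cs_def z)
    have isn: "integrable lborel (\<lambda>x. norm (s x) powr q)" using integrable_norm[OF isz[of z]] by (simp add: ns)
    have Sle: "(\<integral>x. norm (s x) powr q \<partial>lborel) \<le> S"
      using S by (subst (asm) nn_integral_eq_integral[OF isn]) auto
    have [measurable]: "T (fz z) (gz z) \<in> borel_measurable borel" by (rule T_measurable) auto
    have "norm (F z) \<le> (\<integral>x. norm (sz z x * T (fz z) (gz z) x) \<partial>lborel)" unfolding F_def by (rule integral_norm_bound)
    also have "\<dots> \<le> (\<integral>x. norm (s x) powr q * K \<partial>lborel)"
    proof (rule integral_mono)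
      have le: "norm (sz z x * T (fz z) (gz z) x) \<le> norm (s x) powr q * K" for x
        unfolding norm_mult ns using TK by (intro mult_left_mono) auto
      then show "norm (sz z x * T (fz z) (gz z) x) \<le> norm (s x) powr q * K" for x .
      show i: "integrable lborel (\<lambda>x. norm (s x) powr q * K)" using isn by simp
      show "integrable lborel (\<lambda>x. norm (sz z x * T (fz z) (gz z) x))"
      proof (rule Bochner_Integration.integrable_bound[OF i])
        show "AE x in lborel. norm (norm (sz z x * T (fz z) (gz z) x)) \<le> norm (norm (s x) powr q * K)"
          unfolding real_norm_def abs_norm_cancel by (intro AE_I2 order_trans[OF le abs_ge_self])
      qed simp
    qed
    also have "\<dots> = (\<integral>x. norm (s x) powr q \<partial>lborel) * K" by simp
    also have "\<dots> \<le> m0" unfolding m0_def K_def[symmetric] using Sle K0 by (intro mult_right_mono) auto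
    finally show ?thesis .
  qed
  have B1: "norm (F z) \<le> m1" if z: "Re z = 1" for z
  proof -
    have ns: "(norm (sz z x))\<^sup>2 = norm (s x) powr q" for x
      by (simp add: sz_def norm_cpow cs_def z powr_powr[symmetric] powr_numeral[symmetric] powr_powr del: powr_numeral)
    have nf: "(norm (fz z x))\<^sup>2 = norm (f x) powr p" for x
      by (simp add: fz_def norm_cpow cf_def z powr_numeral[symmetric] powr_powr del: powr_numeral)
    have ng: "(norm (gz z x))\<^sup>2 = norm (g x) powr p'" for x
      by (simp add: gz_def norm_cpow cg_def z powr_numeral[symmetric] powr_powr del: powr_numeral)
    have [measurable]: "T (fz z) (gz z) \<in> borel_measurable borel" by (rule T_measurable) auto
    have T2: "(\<integral>\<^sup>+x. ennreal ((norm (T (fz z) (gz z) x))\<^sup>2) \<partial>lborel) \<le> ennreal (1 / D * (\<Phi> * \<Gamma>))"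
    proof (rule order_trans[OF T_L2[OF nfz ngz]], rule ennreal_leI)
      show "1 / D * ((\<integral>x. (norm (fz z x))\<^sup>2 \<partial>lborel) * (\<integral>x. (norm (gz z x))\<^sup>2 \<partial>lborel)) \<le> 1 / D * (\<Phi> * \<Gamma>)"
        unfolding nf ng using Phi Gam D_pos by (intro mult_left_mono mult_mono) (auto intro: integral_nonneg_AE)
    qed
    have S2: "(\<integral>\<^sup>+x. ennreal ((norm (sz z x))\<^sup>2) \<partial>lborel) \<le> ennreal S" unfolding ns by (rule S(1))
    have "(ennreal (norm (F z)))\<^sup>2 \<le> (\<integral>\<^sup>+x. ennreal (norm (sz z x)) * ennreal (norm (T (fz z) (gz z) x)) \<partial>lborel)\<^sup>2"
    proof (rule power_mono)
      show "ennreal (norm (F z)) \<le> (\<integral>\<^sup>+x. ennreal (norm (sz z x)) * ennreal (norm (T (fz z) (gz z) x)) \<partial>lborel)"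
      proof (cases "integrable lborel (\<lambda>x. sz z x * T (fz z) (gz z) x)")
        case True
        then show ?thesis using integral_norm_bound_ennreal[OF True] by (simp add: F_def norm_mult ennreal_mult)
      next
        \<comment> \<open>The integral of a function that is not integrable is 0 by convention, so
          the estimate holds without first knowing that the product is integrable.\<close>
        case False
        then show ?thesis by (simp add: F_def not_integrable_integral_eq)
      qed
    qed simp
    also have "\<dots> \<le> (\<integral>\<^sup>+x. (ennreal (norm (sz z x)))\<^sup>2 \<partial>lborel) * (\<integral>\<^sup>+x. (ennreal (norm (T (fz z) (gz z) x)))\<^sup>2 \<partial>lborel)"
      by (rule Cauchy_Schwarz_nn_integral) simp_all
    also have "\<dots> \<le> ennreal S * ennreal (1 / D * (\<Phi> * \<Gamma>))"
      using S2 T2 by (intro mult_mono) (auto simp: ennreal_power)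
    also have "\<dots> = ennreal (S * (1 / D * (\<Phi> * \<Gamma>)))"
      using S Phi Gam D_pos by (subst ennreal_mult) auto
    finally have "ennreal ((norm (F z))\<^sup>2) \<le> ennreal (S * (1 / D * (\<Phi> * \<Gamma>)))" by (simp add: ennreal_power)
    then have "(norm (F z))\<^sup>2 \<le> S * (1 / D * (\<Phi> * \<Gamma>))"
      using S Phi Gam D_pos by (subst (asm) ennreal_le_iff) auto
    then show ?thesis unfolding m1_def by (rule real_le_rsqrt)
  qed
  have "norm (F (of_real \<theta>)) \<le> m0 powr (1 - \<theta>) * m1 powr \<theta>"
    by (rule three_lines[OF hol bd pos(1) B0 pos(2) B1 th(1,2)])
  moreover have "F (of_real \<theta>) = (\<integral>z. s z * T f g z \<partial>lborel)"
  proof -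
    have "cs (of_real \<theta>) = of_real (q * (1 - \<theta> / 2))" by (simp add: cs_def field_simps)
    then have "cs (of_real \<theta>) = 1" by (simp only: th of_real_1)
    moreover have "cf (of_real \<theta>) = of_real (p * ((1 - \<theta>) * a + \<theta> / 2))" by (simp add: cf_def)
    then have "cf (of_real \<theta>) = 1" by (simp only: th of_real_1)
    moreover have "cg (of_real \<theta>) = of_real (p' * ((1 - \<theta>) * b + \<theta> / 2))" by (simp add: cg_def)
    then have "cg (of_real \<theta>) = 1" by (simp only: th of_real_1)
    ultimately have "sz (of_real \<theta>) = s" "fz (of_real \<theta>) = f" "gz (of_real \<theta>) = g"
      by (auto simp: sz_def[abs_def] fz_def[abs_def] gz_def[abs_def])
    then show ?thesis by (simp add: F_def)
  qed
  ultimately show ?thesis unfolding m0_def m1_def by simp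
qed

end

lemma reciprocal_antimono:
  fixes p q :: ennreal
  assumes "1 \<le> p" "1 \<le> q"
  shows "enn2real (1 / p) \<le> enn2real (1 / q) \<longleftrightarrow> q \<le> p"
  using assms(1)
proof (cases p rule: exponent_cases)
  case (fin r)
  note P = this
  from assms(2) show ?thesis
  proof (cases q rule: exponent_cases)
    case (fin r')
    have "1 / r \<le> 1 / r' \<longleftrightarrow> r' \<le> r" using P fin by (simp add: field_simps)
    then show ?thesis unfolding P(5) fin(5) unfolding P(1) fin(1) using P fin by simp
  next
    case inf
    then show ?thesis unfolding P(5) inf(2) using P by (simp add: field_simps top_unique)
  qed
next
  case inf
  then show ?thesis by simp
qed

section \<open>Removing the truncation\<close>

definition trunc :: "nat \<Rightarrow> ('a \<Rightarrow> complex) \<Rightarrow> 'a \<Rightarrow> complex" where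
  "trunc n f x = (if 1 / real (Suc n) \<le> norm (f x) \<and> norm (f x) \<le> real (Suc n) then f x else 0)"

lemma trunc_truncated: "n \<le> m \<Longrightarrow> truncated (Suc m) (trunc n f)"
proof -
  assume nm: "n \<le> m"
  then have "1 / real (Suc m) \<le> 1 / real (Suc n)" "real (Suc n) \<le> real (Suc m)" by (auto simp: field_simps)
  then show ?thesis by (auto simp: truncated_def trunc_def simp del: of_nat_Suc)
qed

lemma trunc_le: "norm (trunc n f x) \<le> norm (f x)"
  by (simp add: trunc_def)

lemma trunc_measurable [measurable]:
  assumes [measurable]: "f \<in> borel_measurable M"
  shows "trunc n f \<in> borel_measurable M"
  unfolding trunc_def[abs_def] by measurable

lemma trunc_eventually: "\<forall>\<^sub>F n in sequentially. trunc n f x = f x"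
proof (cases "f x = 0")
  case False
  obtain N :: nat where N: "max (norm (f x)) (1 / norm (f x)) \<le> real N" using real_arch_simple by blast
  show ?thesis
  proof (rule eventually_sequentiallyI[of N])
    fix n assume "N \<le> n"
    then have n: "norm (f x) \<le> real (Suc n)" "1 / norm (f x) \<le> real (Suc n)" using N by auto
    then have "1 / real (Suc n) \<le> norm (f x)" using False by (simp add: field_simps)
    then show "trunc n f x = f x" using n by (simp add: trunc_def)
  qed
qed (simp add: trunc_def)

lemma trunc_tendsto: "(\<lambda>n. trunc n f x) \<longlonglongrightarrow> f x"
  by (rule tendsto_eventually[OF trunc_eventually])

context wigner_geometry
begin

text \<open>The functions \<open>f\<close> and \<open>g\<close> are released first: their
  truncations are dominated by them, so dominated convergence in the triple integral applies. The
  symbol stays at a fixed truncation level, which is also a valid level for all later stages m \<ge>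
  n.\<close>

lemma trilinear_truncated_symbol:
  fixes s :: "'a \<times> 'a \<Rightarrow> complex"
  assumes s: "truncated (Suc n) s" "integrable lborel s" and f: "nice f" and g: "nice g"
    and q: "1 \<le> q" and p: "1 \<le> p" "1 \<le> p'"
    and S: "(\<integral>\<^sup>+z. ennreal (norm (s z) powr q) \<partial>lborel) \<le> ennreal S" "0 < S"
    and Phi: "(\<integral>x. norm (f x) powr p \<partial>lborel) \<le> \<Phi>" "0 < \<Phi>"
    and Gam: "(\<integral>x. norm (g x) powr p' \<partial>lborel) \<le> \<Gamma>" "0 < \<Gamma>"
    and ab: "0 \<le> a" "0 \<le> b" "a + b = 1"
    and th: "0 \<le> \<theta>" "\<theta> \<le> 1" "q * (1 - \<theta> / 2) = 1" "p * ((1 - \<theta>) * a + \<theta> / 2) = 1" "p' * ((1 - \<theta>) * b + \<theta> / 2) = 1"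
  shows "norm (\<integral>z. s z * T f g z \<partial>lborel)
     \<le> (S * (D1 powr (- b) * D2 powr (- a) * (\<Gamma> powr b * \<Phi> powr a))) powr (1 - \<theta>)
      * (sqrt (S * (1 / D * (\<Phi> * \<Gamma>)))) powr \<theta>" (is "_ \<le> ?B")
proof -
  have [measurable]: "f \<in> borel_measurable borel" "g \<in> borel_measurable borel" "s \<in> borel_measurable borel"
    using s f g by (auto dest: niceD)
  have nf: "nice (trunc m f)" "nice (trunc m g)" for m
    by (rule nice_dominated[OF f], simp, rule trunc_le) (rule nice_dominated[OF g], simp, rule trunc_le)
  have le: "norm (\<integral>z. s z * T (trunc m f) (trunc m g) z \<partial>lborel) \<le> ?B" if m: "n \<le> m" for m
  proof (rule trilinear_truncated[OF _ s(2) trunc_truncated[OF order_refl] nf(1) trunc_truncated[OF order_refl] nf(2) q p S _ Phi(2) _ Gam(2) ab th])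
    show "truncated (Suc m) s"
    proof -
      have "1 / real (Suc m) \<le> 1 / real (Suc n)" "real (Suc n) \<le> real (Suc m)" using m by (auto simp: field_simps)
      then show ?thesis using s(1) order_trans unfolding truncated_def by blast
    qed
    have mono: "(\<integral>x. norm (trunc m u x) powr r \<partial>lborel) \<le> (\<integral>x. norm (u x) powr r \<partial>lborel)"
      if u: "nice u" and r: "1 \<le> r" for u :: "'a \<Rightarrow> complex" and r
    proof (rule integral_mono)
      have [measurable]: "u \<in> borel_measurable borel" using u by (rule niceD)
      show i: "integrable lborel (\<lambda>x. norm (u x) powr r)" by (rule nice_powr_integrable[OF u r])
      show le: "norm (trunc m u x) powr r \<le> norm (u x) powr r" for x using r by (intro powr_mono2 trunc_le) auto
      show "integrable lborel (\<lambda>x. norm (trunc m u x) powr r)"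
        by (rule Bochner_Integration.integrable_bound[OF i]) (use le in auto)
    qed
    show "(\<integral>x. norm (trunc m f x) powr p \<partial>lborel) \<le> \<Phi>" using mono[OF f p(1)] Phi by linarith
    show "(\<integral>x. norm (trunc m g x) powr p' \<partial>lborel) \<le> \<Gamma>" using mono[OF g p(2)] Gam by linarith
  qed
  have "(\<lambda>m. \<integral>v. s (fst v) * (cis (2 * pi * (snd (fst v) \<bullet> snd v)) *
      (trunc m g (U (fst (fst v), snd v)) * trunc m f (W (fst (fst v), snd v)))) \<partial>lborel)
     \<longlonglongrightarrow> (\<integral>v. s (fst v) * (cis (2 * pi * (snd (fst v) \<bullet> snd v)) *
      (g (U (fst (fst v), snd v)) * f (W (fst (fst v), snd v)))) \<partial>lborel)"
  proof (rule integral_dominated_convergence)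
    show "integrable lborel (\<lambda>v. norm (s (fst v) * (cis (2 * pi * (snd (fst v) \<bullet> snd v)) *
      (g (U (fst (fst v), snd v)) * f (W (fst (fst v), snd v))))))"
      by (rule integrable_norm[OF triple_integrable(1)[OF s(2) f g]])
    show "AE v in lborel. (\<lambda>m. s (fst v) * (cis (2 * pi * (snd (fst v) \<bullet> snd v)) *
      (trunc m g (U (fst (fst v), snd v)) * trunc m f (W (fst (fst v), snd v)))))
      \<longlonglongrightarrow> s (fst v) * (cis (2 * pi * (snd (fst v) \<bullet> snd v)) *
      (g (U (fst (fst v), snd v)) * f (W (fst (fst v), snd v))))"
      by (intro AE_I2 tendsto_intros trunc_tendsto)
    show "AE v in lborel. norm (s (fst v) * (cis (2 * pi * (snd (fst v) \<bullet> snd v)) *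
      (trunc m g (U (fst (fst v), snd v)) * trunc m f (W (fst (fst v), snd v)))))
      \<le> norm (s (fst v) * (cis (2 * pi * (snd (fst v) \<bullet> snd v)) *
      (g (U (fst (fst v), snd v)) * f (W (fst (fst v), snd v)))))" for m
      unfolding norm_mult by (intro AE_I2 mult_left_mono mult_mono trunc_le) auto
  qed simp_all
  then have "(\<lambda>m. \<integral>z. s z * T (trunc m f) (trunc m g) z \<partial>lborel) \<longlonglongrightarrow> (\<integral>z. s z * T f g z \<partial>lborel)"
    unfolding triple_integrable(2)[OF s(2) f g] triple_integrable(2)[OF s(2) nf] .
  then have "(\<lambda>m. norm (\<integral>z. s z * T (trunc m f) (trunc m g) z \<partial>lborel)) \<longlonglongrightarrow> norm (\<integral>z. s z * T f g z \<partial>lborel)"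
    by (rule tendsto_norm)
  then show ?thesis by (rule LIMSEQ_le_const2) (use le in blast)
qed

text \<open>Bounding the form for every truncated symbol dominated by \<open>s\<close> bounds the
  integral of |s| |T|, because a symbol of the same modulus may be given the opposite phase of
  \<open>T\<close>. Absolute integrability for an untruncated \<open>s\<close>, which need not lie
  in L1, then follows by Fatou's lemma.\<close>

lemma trilinear_bound_nn:
  fixes s :: "'a \<times> 'a \<Rightarrow> complex"
  assumes [measurable]: "s \<in> borel_measurable borel" and si: "integrable lborel (\<lambda>z. norm (s z) powr q)"
    and f: "nice f" and g: "nice g" and q: "1 \<le> q"
    and B: "\<And>s' n. truncated (Suc n) s' \<Longrightarrow> integrable lborel s' \<Longrightarrow> (\<And>z. norm (s' z) \<le> norm (s z))
      \<Longrightarrow> norm (\<integral>z. s' z * T f g z \<partial>lborel) \<le> B"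
  shows "integrable lborel (\<lambda>z. s z * T f g z)" "(\<integral>z. norm (s z) * norm (T f g z) \<partial>lborel) \<le> B"
proof -
  have [measurable]: "f \<in> borel_measurable borel" "g \<in> borel_measurable borel" using f g by (auto dest: niceD)
  have [measurable]: "T f g \<in> borel_measurable borel" by (rule T_measurable) auto
  have step: "(\<integral>\<^sup>+z. ennreal (norm (trunc n s z) * norm (T f g z)) \<partial>lborel) \<le> ennreal B" for n
  proof -
    \<comment> \<open>The conjugate sign of \<open>T f g\<close> makes the pairing equal to the
      integral of the moduli.\<close>
    define s' where "s' z = of_real (norm (trunc n s z)) * cnj (sgn (T f g z))" for z
    have [measurable]: "s' \<in> borel_measurable borel" unfolding s'_def[abs_def] by measurable
    have ns': "norm (s' z) = (if T f g z = 0 then 0 else norm (trunc n s z))" for z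
      by (simp add: s'_def norm_mult norm_sgn)
    have tr: "truncated (Suc n) s'"
      using trunc_truncated[of n n s] unfolding truncated_def
      by (auto simp: ns' simp del: of_nat_Suc) (auto simp: s'_def)
    have it: "integrable lborel (trunc n s)"
    \<comment> \<open>Where the truncation is nonzero, |s| \<ge> 1 / (n + 1), hence |s| \<le> (n +
      1)^(q - 1) |s|^q, which is integrable.\<close>
    proof (rule Bochner_Integration.integrable_bound)
      show "integrable lborel (\<lambda>z. real (Suc n) powr (q - 1) * norm (s z) powr q)" using si by simp
      have "norm (trunc n s z) \<le> real (Suc n) powr (q - 1) * norm (s z) powr q" for z
      proof (cases "trunc n s z = 0")
        case False
        then have z: "1 / real (Suc n) \<le> norm (s z)" "trunc n s z = s z" by (auto simp: trunc_def split: if_splits)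
        have "0 < 1 / real (Suc n)" by simp
          then have pos: "0 < norm (s z)" using z(1) by (rule less_le_trans)
        have "1 / norm (s z) \<le> real (Suc n)" using z(1) pos by (simp add: field_simps)
        then have "(1 / norm (s z)) powr (q - 1) \<le> real (Suc n) powr (q - 1)" using q by (intro powr_mono2) auto
        then have "(1 / norm (s z)) powr (q - 1) * norm (s z) powr q \<le> real (Suc n) powr (q - 1) * norm (s z) powr q"
          by (intro mult_right_mono) auto
        moreover have "(1 / norm (s z)) powr (q - 1) * norm (s z) powr q = norm (s z)"
        proof -
          have "(1 / norm (s z)) powr (q - 1) * norm (s z) powr q = norm (s z) powr (-(q - 1)) * norm (s z) powr q"
            using pos by (simp only: powr_minus powr_divide powr_one_eq_one inverse_eq_divide) 
          also have "\<dots> = norm (s z) powr 1" by (subst powr_add[symmetric]) simp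
          finally show ?thesis by simp
        qed
        ultimately show ?thesis using z by simp
      qed simp
      then show "AE z in lborel. norm (trunc n s z) \<le> norm (real (Suc n) powr (q - 1) * norm (s z) powr q)" by simp
    qed simp
    have is': "integrable lborel s'"
      by (rule Bochner_Integration.integrable_bound[OF it]) (auto simp: ns')
    have "norm (s' z) \<le> norm (s z)" for z using trunc_le[of n s z] by (simp add: ns')
    from B[OF tr is' this] have le: "norm (\<integral>z. s' z * T f g z \<partial>lborel) \<le> B" .
    have eq: "s' z * T f g z = of_real (norm (trunc n s z) * norm (T f g z))" for z
    proof -
      have "cnj (sgn (T f g z)) * T f g z = of_real (norm (T f g z))"
        using mult_cnj_sgn[of "T f g z"] by (simp add: mult.commute)
      then show ?thesis unfolding s'_def by (simp add: mult.assoc)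
    qed
    have i2: "integrable lborel (\<lambda>z. norm (trunc n s z) * norm (T f g z))"
    proof -
      obtain C where C: "\<And>z. norm (T f g z) \<le> C" using T_sup[OF f g, of 1 "\<infinity>"] by auto
      show ?thesis
      proof (rule Bochner_Integration.integrable_bound)
        show "integrable lborel (\<lambda>z. trunc n s z * of_real C)" using it by simp
        show "AE z in lborel. norm (norm (trunc n s z) * norm (T f g z)) \<le> norm (trunc n s z * of_real C)"
          using C order_trans[OF C abs_ge_self] by (auto simp: norm_mult abs_mult intro!: mult_left_mono AE_I2)
      qed simp
    qed
    have "norm (\<integral>z. s' z * T f g z \<partial>lborel) = (\<integral>z. norm (trunc n s z) * norm (T f g z) \<partial>lborel)"
      unfolding eq integral_complex_of_real norm_of_real by (intro abs_of_nonneg integral_nonneg_AE) auto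
    then show ?thesis using le by (subst nn_integral_eq_integral[OF i2]) (auto intro: ennreal_leI)
  qed
  have nn: "(\<integral>\<^sup>+z. ennreal (norm (s z) * norm (T f g z)) \<partial>lborel) \<le> ennreal B"
  proof -
    have "(\<integral>\<^sup>+z. ennreal (norm (s z) * norm (T f g z)) \<partial>lborel)
        = (\<integral>\<^sup>+z. liminf (\<lambda>n. ennreal (norm (trunc n s z) * norm (T f g z))) \<partial>lborel)"
      by (intro nn_integral_cong lim_imp_Liminf[symmetric] tendsto_ennrealI tendsto_intros trunc_tendsto) simp
    also have "\<dots> \<le> liminf (\<lambda>n. \<integral>\<^sup>+z. ennreal (norm (trunc n s z) * norm (T f g z)) \<partial>lborel)"
      by (rule nn_integral_liminf) simp
    also have "\<dots> \<le> liminf (\<lambda>_. ennreal B)"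
      by (rule Liminf_mono, rule always_eventually, rule allI, rule step)
    also have "\<dots> = ennreal B" by (rule Liminf_const) simp
    finally show ?thesis .
  qed
  have int: "integrable lborel (\<lambda>z. norm (s z) * norm (T f g z))"
    using nn by (intro integrableI_bounded) (auto simp: le_less_trans less_top abs_mult)
  then have "integrable lborel (\<lambda>z. norm (s z * T f g z))" by (simp add: norm_mult)
  then show "integrable lborel (\<lambda>z. s z * T f g z)" by (subst (asm) integrable_norm_iff) auto
  \<comment> \<open>The zero symbol is truncated at every level, so it may be inserted into the
    assumption to obtain \<open>0 \<le> B\<close>.\<close>
  have "(\<lambda>z. 0) \<in> borel_measurable lborel \<Longrightarrow> norm (\<integral>z. (0::complex) * T f g z \<partial>(lborel :: ('a \<times> 'a) measure)) \<le> B"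
    using B[of 0 "\<lambda>z. 0"] by (simp add: truncated_def)
  then have "0 \<le> B" by simp
  then show "(\<integral>z. norm (s z) * norm (T f g z) \<partial>lborel) \<le> B"
    using nn by (subst (asm) nn_integral_eq_integral[OF int]) auto
qed

definition bound_const :: "ennreal \<Rightarrow> ennreal \<Rightarrow> ennreal \<Rightarrow> real" where
  "bound_const p p' q' = D powr (- enn2real (1 / q')) * D1 powr (- (enn2real (1 / p') - enn2real (1 / q')))
     * D2 powr (- (enn2real (1 / p) - enn2real (1 / q')))"

lemma bound_const_pos: "0 < bound_const p p' q'"
  using D_pos by (simp add: bound_const_def)

text \<open>For q = 1 the exponent p or p' may be \<infinity>, where norms are not integrals, and
  the sup bound on \<open>T\<close> is used directly. For q > 1 the constraints on q and p force p,
  p' and q all to be finite, and interpolation applies.\<close>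

theorem trilinear:
  fixes s :: "'a \<times> 'a \<Rightarrow> complex"
  assumes s: "s \<in> Lp_space q" and f: "nice f" and g: "nice g"
    and p: "1 \<le> p" "1 / p + 1 / p' = 1" and q: "1 \<le> q" "1 / q + 1 / q' = 1"
    and pq: "q \<le> 2" "q \<le> p" "p \<le> q'"
  shows "integrable lborel (\<lambda>z. s z * T f g z)"
    "(\<integral>z. norm (s z) * norm (T f g z) \<partial>lborel) \<le> bound_const p p' q' * (Lp_norm q s * (Lp_norm p f * Lp_norm p' g))"
proof -
  have [measurable]: "f \<in> borel_measurable borel" "g \<in> borel_measurable borel" using f g by (auto dest: niceD)
  have [measurable]: "s \<in> borel_measurable borel" using s by measurable
  have [measurable]: "T f g \<in> borel_measurable borel" by (rule T_measurable) auto
  note p' = conjugate_exponents[OF p]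
  note q' = conjugate_exponents[OF q]
  define ip ip' iq iq' where "ip = enn2real (1 / p)" and "ip' = enn2real (1 / p')" and "iq = enn2real (1 / q)" and "iq' = enn2real (1 / q')"
  have e2: "enn2real (1 / 2) = 1 / 2"
  proof -
    have "(1::ennreal) \<le> 2" by simp
    then show ?thesis by (cases "2 :: ennreal" rule: exponent_cases) auto
  qed
  have i: "ip + ip' = 1" "iq + iq' = 1" using p' q' by (simp_all add: ip_def ip'_def iq_def iq'_def)
  have j: "1 / 2 \<le> iq" "ip \<le> iq" "iq' \<le> ip"
    using reciprocal_antimono[of 2 q] reciprocal_antimono[of p q] reciprocal_antimono[of q' p] p q pq q'(1) e2
    by (auto simp: ip_def iq_def iq'_def)
  have nn: "0 \<le> ip" "0 \<le> ip'" "0 \<le> iq'" by (simp_all add: ip_def ip'_def iq'_def)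
  have K: "bound_const p p' q' = D powr (- iq') * D1 powr (- (ip' - iq')) * D2 powr (- (ip - iq'))"
    by (simp add: bound_const_def ip_def ip'_def iq'_def)
  have "integrable lborel (\<lambda>z. s z * T f g z) \<and>
    (\<integral>z. norm (s z) * norm (T f g z) \<partial>lborel) \<le> bound_const p p' q' * (Lp_norm q s * (Lp_norm p f * Lp_norm p' g))"
  proof (cases "iq' = 0")
    case True
    have q1: "q \<noteq> \<infinity>" "enn2real q = 1"
      using q(1) by (cases q rule: exponent_cases; use i True in \<open>auto simp: iq_def\<close>)+
    have si: "integrable lborel (\<lambda>z. norm (s z))" using s q1 by (simp add: Lp_space_def)
    define C where "C = D1 powr (- ip') * D2 powr (- ip) * (Lp_norm p' g * Lp_norm p f)"
    have C: "norm (T f g z) \<le> C" for z unfolding C_def ip_def ip'_def by (rule T_sup[OF f g p])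
    have i1: "integrable lborel (\<lambda>z. norm (s z) * C)" using si by simp
    have i2: "integrable lborel (\<lambda>z. norm (s z) * norm (T f g z))"
      by (rule Bochner_Integration.integrable_bound[OF i1])
        (use C order_trans[OF C abs_ge_self] in \<open>auto simp: abs_mult intro!: mult_left_mono AE_I2\<close>)
    have "(\<integral>z. norm (s z) * norm (T f g z) \<partial>lborel) \<le> (\<integral>z. norm (s z) * C \<partial>lborel)"
      by (rule integral_mono[OF i2 i1]) (intro mult_left_mono C norm_ge_zero)
    also have "\<dots> = Lp_norm q s * C" using q1 by (simp add: Lp_norm_def)
    also have "\<dots> = bound_const p p' q' * (Lp_norm q s * (Lp_norm p f * Lp_norm p' g))"
      using D_pos by (simp add: K True C_def mult_ac)
    finally have le: "(\<integral>z. norm (s z) * norm (T f g z) \<partial>lborel) \<le> \<dots>" .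
    have "integrable lborel (\<lambda>z. norm (s z * T f g z))" using i2 by (simp add: norm_mult)
    then have "integrable lborel (\<lambda>z. s z * T f g z)" by (subst (asm) integrable_norm_iff) auto
    with le show ?thesis by simp
  next
    case False
    have pos: "0 < iq'" "0 < ip" "0 < ip'" "0 < iq" using False nn i j by auto
    obtain qr where Q: "q \<noteq> \<infinity>" "1 \<le> qr" "enn2real q = qr" "iq = 1 / qr"
      using q(1) by (cases q rule: exponent_cases) (use pos in \<open>auto simp: iq_def\<close>)
    obtain pr where P: "p \<noteq> \<infinity>" "1 \<le> pr" "enn2real p = pr" "ip = 1 / pr"
      using p(1) by (cases p rule: exponent_cases) (use pos in \<open>auto simp: ip_def\<close>)
    obtain pr' where P': "p' \<noteq> \<infinity>" "1 \<le> pr'" "enn2real p' = pr'" "ip' = 1 / pr'"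
      using p'(1) by (cases p' rule: exponent_cases) (use pos in \<open>auto simp: ip'_def\<close>)
    define S \<Phi> \<Gamma> where "S = (\<integral>z. norm (s z) powr qr \<partial>lborel)" and "\<Phi> = (\<integral>x. norm (f x) powr pr \<partial>lborel)"
      and "\<Gamma> = (\<integral>x. norm (g x) powr pr' \<partial>lborel)"
    have si: "integrable lborel (\<lambda>z. norm (s z) powr qr)" using s Q by (simp add: Lp_space_def)
    have fi: "integrable lborel (\<lambda>z. norm (f z) powr pr)" using nice_powr_integrable f P by blast
    have gi: "integrable lborel (\<lambda>z. norm (g z) powr pr')" using nice_powr_integrable g P' by blast
    have nn0: "0 \<le> S" "0 \<le> \<Phi>" "0 \<le> \<Gamma>" unfolding S_def \<Phi>_def \<Gamma>_def by (intro integral_nonneg_AE; simp)+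
    have norms: "Lp_norm q s = S powr iq" "Lp_norm p f = \<Phi> powr ip" "Lp_norm p' g = \<Gamma> powr ip'"
      using Q P P' by (simp_all add: Lp_norm_def S_def \<Phi>_def \<Gamma>_def)
    show ?thesis
    \<comment> \<open>Interpolation needs strictly positive masses. If one vanishes, the
      corresponding function is zero almost everywhere and so is the integrand.\<close>
    proof (cases "S = 0 \<or> \<Phi> = 0 \<or> \<Gamma> = 0")
      case True
      have ae: "AE z in lborel. s z * T f g z = 0"
        using True
      proof (elim disjE)
        assume "S = 0"
        then have "AE z in lborel. norm (s z) powr qr = 0"
          unfolding S_def using si by (subst (asm) integral_nonneg_eq_0_iff_AE) auto
        then show ?thesis by eventually_elim auto
      next
        assume "\<Phi> = 0"
        then have "AE z in lborel. norm (f z) powr pr = 0"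
          unfolding \<Phi>_def using fi by (subst (asm) integral_nonneg_eq_0_iff_AE) auto
        then have "AE z in lborel. f z = 0" by eventually_elim auto
        then show ?thesis by (simp add: T_zero)
      next
        assume "\<Gamma> = 0"
        then have "AE z in lborel. norm (g z) powr pr' = 0"
          unfolding \<Gamma>_def using gi by (subst (asm) integral_nonneg_eq_0_iff_AE) auto
        then have "AE z in lborel. g z = 0" by eventually_elim auto
        then show ?thesis by (simp add: T_zero)
      qed
      have "integrable lborel (\<lambda>z. s z * T f g z) \<longleftrightarrow> integrable lborel (\<lambda>z :: 'a \<times> 'a. 0 :: complex)"
        by (rule integrable_cong_AE) (simp_all only: ae, simp_all)
      then have 1: "integrable lborel (\<lambda>z. s z * T f g z)" by simp
      have "AE z in lborel. norm (s z * T f g z) = 0" using ae by eventually_elim simp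
      then have 2: "(\<integral>z. norm (s z * T f g z) \<partial>lborel) = 0" by (rule integral_eq_zero_AE)
      have "0 \<le> bound_const p p' q' * (Lp_norm q s * (Lp_norm p f * Lp_norm p' g))"
        using bound_const_pos[of p p' q'] by (intro mult_nonneg_nonneg) auto
      then show ?thesis using 1 2 by (simp add: norm_mult)
    next
      case False
      then have ps: "0 < S" "0 < \<Phi>" "0 < \<Gamma>" using nn0 by auto
      \<comment> \<open>Solves 1/q = 1 - \<theta>/2. Then a and b solve 1/p = (1 - \<theta>) a +
        \<theta>/2 and its analogue for p'; they are nonnegative exactly because q \<le> p \<le> q'.
        If \<theta> = 1, then p = q = 2, the weights drop out of these equations, and 1/2 is a
        choice with sum 1.\<close>
      define \<theta> where "\<theta> = 2 * iq'"
      define a where "a = (if \<theta> = 1 then 1 / 2 else (ip - \<theta> / 2) / (1 - \<theta>))"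
      define b where "b = (if \<theta> = 1 then 1 / 2 else (ip' - \<theta> / 2) / (1 - \<theta>))"
      have th: "0 \<le> \<theta>" "\<theta> \<le> 1" using pos i j by (auto simp: \<theta>_def)
      have ab: "0 \<le> a" "0 \<le> b" using th i j by (auto simp: a_def b_def \<theta>_def)
      have ab1: "a + b = 1"
      proof (cases "\<theta> = 1")
        case False
        then have "a + b = (ip - \<theta> / 2 + (ip' - \<theta> / 2)) / (1 - \<theta>)"
          by (simp only: a_def b_def if_False add_divide_distrib)
        also have "ip - \<theta> / 2 + (ip' - \<theta> / 2) = 1 - \<theta>" using i by simp
        finally show ?thesis using False by simp
      qed (simp add: a_def b_def)
      have ea: "(1 - \<theta>) * a = ip - iq'" "(1 - \<theta>) * b = ip' - iq'"
        using i j by (auto simp: a_def b_def \<theta>_def)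
      have ths: "qr * (1 - \<theta> / 2) = 1" "pr * ((1 - \<theta>) * a + \<theta> / 2) = 1" "pr' * ((1 - \<theta>) * b + \<theta> / 2) = 1"
      proof -
        have "1 - \<theta> / 2 = 1 / qr" using i Q by (simp add: \<theta>_def)
        then show "qr * (1 - \<theta> / 2) = 1" using Q by simp
        have "(1 - \<theta>) * a + \<theta> / 2 = 1 / pr" unfolding ea using P by (simp add: \<theta>_def)
        then show "pr * ((1 - \<theta>) * a + \<theta> / 2) = 1" using P by simp
        have "(1 - \<theta>) * b + \<theta> / 2 = 1 / pr'" unfolding ea using P' by (simp add: \<theta>_def)
        then show "pr' * ((1 - \<theta>) * b + \<theta> / 2) = 1" using P' by simp
      qed
      define B where "B = (S * (D1 powr (- b) * D2 powr (- a) * (\<Gamma> powr b * \<Phi> powr a))) powr (1 - \<theta>)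
        * (sqrt (S * (1 / D * (\<Phi> * \<Gamma>)))) powr \<theta>"
      \<comment> \<open>All factors are positive, so the identity is checked on logarithms, where it
        is linear in the exponents.\<close>
      have Beq: "B = bound_const p p' q' * (Lp_norm q s * (Lp_norm p f * Lp_norm p' g))"
      proof -
        have "ln B = (1 - \<theta>) * (ln S + (- b * ln D1 - a * ln D2 + (b * ln \<Gamma> + a * ln \<Phi>))) + \<theta> * ((ln S - ln D + (ln \<Phi> + ln \<Gamma>)) / 2)"
          unfolding B_def using ps D_pos by (simp add: ln_mult ln_powr ln_sqrt ln_div)
        also have "\<dots> = (1 - \<theta> / 2) * ln S + ((1 - \<theta>) * a + \<theta> / 2) * ln \<Phi> + ((1 - \<theta>) * b + \<theta> / 2) * ln \<Gamma>
            - ((1 - \<theta>) * b) * ln D1 - ((1 - \<theta>) * a) * ln D2 - \<theta> / 2 * ln D"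
          by (simp add: field_simps)
        also have "\<dots> = iq * ln S + ip * ln \<Phi> + ip' * ln \<Gamma> - (ip' - iq') * ln D1 - (ip - iq') * ln D2 - iq' * ln D"
        proof -
          have "1 - \<theta> / 2 = iq" "ip - iq' + \<theta> / 2 = ip" "ip' - iq' + \<theta> / 2 = ip'" "\<theta> / 2 = iq'" using i by (auto simp: \<theta>_def)
          then show ?thesis unfolding ea by simp
        qed
        also have "\<dots> = ln (bound_const p p' q' * (Lp_norm q s * (Lp_norm p f * Lp_norm p' g)))"
          unfolding K norms using ps D_pos by (simp add: ln_mult ln_powr) (simp add: algebra_simps)
        finally show ?thesis
          using ps D_pos by (subst (asm) ln_inj_iff) (auto simp: B_def K norms)
      qed
      have Bs: "norm (\<integral>z. s' z * T f g z \<partial>lborel) \<le> B"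
        if s': "truncated (Suc n) s'" "integrable lborel s'" "\<And>z. norm (s' z) \<le> norm (s z)"
        for s' :: "'a \<times> 'a \<Rightarrow> complex" and n
      proof -
        have "(\<integral>\<^sup>+z. ennreal (norm (s' z) powr qr) \<partial>lborel) \<le> (\<integral>\<^sup>+z. ennreal (norm (s z) powr qr) \<partial>lborel)"
          using s'(3) Q by (intro nn_integral_mono ennreal_leI powr_mono2) auto
        also have "\<dots> = ennreal S" unfolding S_def by (rule nn_integral_eq_integral[OF si]) simp
        finally have S': "(\<integral>\<^sup>+z. ennreal (norm (s' z) powr qr) \<partial>lborel) \<le> ennreal S" .
        show "norm (\<integral>z. s' z * T f g z \<partial>lborel) \<le> B"
          unfolding B_def
          by (rule trilinear_truncated_symbol[OF s'(1,2) f g Q(2) P(2) P'(2) S' ps(1) _ ps(2) _ ps(3) ab ab1 th ths])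
            (simp_all add: \<Phi>_def \<Gamma>_def)
      qed
      show ?thesis unfolding Beq[symmetric]
        by (intro conjI trilinear_bound_nn[OF _ si f g Q(2) Bs]) simp_all
    qed
  qed
  then show "integrable lborel (\<lambda>z. s z * T f g z)"
    "(\<integral>z. norm (s z) * norm (T f g z) \<partial>lborel) \<le> bound_const p p' q' * (Lp_norm q s * (Lp_norm p f * Lp_norm p' g))"
    by auto
qed


section \<open>The operator with symbol in $L^q$\<close>

text \<open>Taking u = U (x, y) as the integration variable turns the inner integral into a bounded
  kernel against \<open>g u\<close>. With \<open>s\<close> integrable, Fubini moves \<open>g\<close>
  to the outside and leaves a concrete function \<open>h\<close>.\<close>

lemma operator_integrable_symbol:
  fixes s :: "'a \<times> 'a \<Rightarrow> complex"
  assumes s: "integrable lborel s" and f: "nice f"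
  obtains h where "h \<in> borel_measurable borel"
    "\<And>g. nice g \<Longrightarrow> integrable lborel (\<lambda>u. h u * g u)"
    "\<And>g. nice g \<Longrightarrow> (\<integral>z. s z * T f g z \<partial>lborel) = (\<integral>u. h u * g u \<partial>lborel)"
proof -
  have [measurable]: "f \<in> borel_measurable borel" "s \<in> borel_measurable borel" using s f by (auto dest: niceD)
  obtain C where C: "0 < C" "\<And>x. norm (f x) \<le> C" using nice_bound[OF f] by blast
  \<comment> \<open>\<open>Y\<close> recovers y from (x, u), and the division by \<open>D1\<close>
    is the Jacobian of the substitution.\<close>
  define K where "K v = cis (2 * pi * (snd (fst v) \<bullet> Y (fst (fst v), snd v))) * f (W (fst (fst v), Y (fst (fst v), snd v))) / of_real D1"
    for v :: "('a \<times> 'a) \<times> 'a"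
  have [measurable]: "K \<in> borel_measurable borel" unfolding K_def[abs_def] by measurable
  have KC: "norm (K v) \<le> C / D1" for v
    using C D_pos by (auto simp: K_def norm_mult norm_divide intro!: divide_right_mono)
  define h where "h u = (\<integral>z. K (z, u) * s z \<partial>lborel)" for u
  have "(\<lambda>u. \<integral>z. K (snd (u, z), fst (u, z)) * s (snd (u, z)) \<partial>lborel) \<in> borel_measurable borel"
    using borel_measurable_lborel_integral[of "\<lambda>w. K (snd w, fst w) * s (snd w)"] by simp
  then have hm: "h \<in> borel_measurable borel" unfolding h_def[abs_def] by simp
  have Teq: "T f g z = (\<integral>u. K (z, u) * g u \<partial>lborel)" if g: "nice g" for g z
  proof -
    have [measurable]: "g \<in> borel_measurable borel" using g by (rule niceD)
    note [measurable] = borel_measurable_Pair_section(1)[OF \<open>K \<in> borel_measurable borel\<close>, of z]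
    have "(\<integral>u. K (z, u) * g u \<partial>lborel) = D1 *\<^sub>R (\<integral>y. K (z, U (fst z, y)) * g (U (fst z, y)) \<partial>lborel)"
      by (rule affine_scaling_integral(2)[OF U_scaling]) simp
    also have "\<dots> = (\<integral>y. of_real D1 * (K (z, U (fst z, y)) * g (U (fst z, y))) \<partial>lborel)"
      by (simp add: scaleR_conv_of_real)
    also have "\<dots> = T f g z"
      unfolding T_def using D_pos by (intro Bochner_Integration.integral_cong) (auto simp: K_def Y_U)
    finally show ?thesis by simp
  qed
  show ?thesis
  proof (rule that[OF hm])
    fix g :: "'a \<Rightarrow> complex" assume g: "nice g"
    note * = fubini_bounded_kernel[OF s niceD(1)[OF g], of K, OF _ KC]
    show "integrable lborel (\<lambda>u. h u * g u)"
      using *(3) by (simp add: h_def mult.commute)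
    show "(\<integral>z. s z * T f g z \<partial>lborel) = (\<integral>u. h u * g u \<partial>lborel)"
      using *(1) by (simp add: h_def Teq[OF g] mult.commute)
  qed
qed

end

text \<open>A symbol in Lq is integrable on each set where |s| is bounded below. Cutting along
  rapidly growing levels of this kind gives integrable pieces whose norms are summable, so that the
  operators attached to the pieces can be added up.\<close>

lemma symbol_decomposition:
  fixes s :: "'b::euclidean_space \<Rightarrow> complex"
  assumes s: "s \<in> Lp_space q" and q: "1 \<le> q" "q \<noteq> \<infinity>"
  obtains \<tau> :: "nat \<Rightarrow> 'b \<Rightarrow> complex" where
    "\<And>k. integrable lborel (\<tau> k)" "\<And>k. \<tau> k \<in> Lp_space q"
    "summable (\<lambda>k. Lp_norm q (\<tau> k))"
    "\<And>n z. norm (\<Sum>k<n. \<tau> k z) \<le> norm (s z)"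
    "\<And>z. (\<lambda>n. \<Sum>k<n. \<tau> k z) \<longlonglongrightarrow> s z"
proof -
  have [measurable]: "s \<in> borel_measurable borel" using s by measurable
  obtain r where r: "1 \<le> r" "enn2real q = r" using q(1) by (cases q rule: exponent_cases) (use q in auto)
  have si: "integrable lborel (\<lambda>z. norm (s z) powr r)" using s q r by (simp add: Lp_space_def)
  define E where "E n = {z. 1 \<le> real n * norm (s z)}" for n :: nat
  have [measurable]: "E n \<in> sets borel" for n unfolding E_def by measurable
  have Emono: "E n \<subseteq> E m" if "n \<le> m" for n m
  proof
    fix z assume "z \<in> E n"
    moreover have "real n * norm (s z) \<le> real m * norm (s z)" using that by (intro mult_right_mono) auto
    ultimately show "z \<in> E m" by (simp add: E_def)
  qed
  have Eev: "\<forall>\<^sub>F n in sequentially. z \<in> E n" if "s z \<noteq> 0" for z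
  proof -
    obtain N :: nat where N: "1 / norm (s z) \<le> real N" using real_arch_simple by blast
    then have "z \<in> E N" using that by (simp add: E_def field_simps)
    then show ?thesis using Emono by (intro eventually_sequentiallyI[of N]) blast
  qed
  define rest where "rest n = (\<integral>z. norm (s z * indicator (- E n) z) powr r \<partial>lborel)" for n
  have lim: "rest \<longlonglongrightarrow> (\<integral>z. (0::real) \<partial>(lborel :: 'b measure))"
    unfolding rest_def
  proof (rule integral_dominated_convergence[OF _ _ si])
    show "AE z in lborel. (\<lambda>n. norm (s z * indicator (- E n) z) powr r) \<longlonglongrightarrow> 0"
    proof (rule AE_I2, rule tendsto_eventually)
      show "\<forall>\<^sub>F n in sequentially. norm (s z * indicator (- E n) z) powr r = 0" for z
      proof (cases "s z = 0")
        case False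
        from Eev[OF this] show ?thesis by eventually_elim simp
      qed simp
    qed
    show "AE z in lborel. norm (norm (s z * indicator (- E n) z) powr r) \<le> norm (s z) powr r" for n
      by (auto simp: indicator_def)
  qed simp_all
  have "\<exists>N. \<forall>m\<ge>N. rest m < ((1/2) ^ k) powr r" for k
  proof -
    have "\<forall>\<^sub>F m in sequentially. rest m < ((1/2) ^ k) powr r"
      using order_tendstoD(2)[OF lim, of "((1/2) ^ k) powr r"] by simp
    then show ?thesis by (simp add: eventually_sequentially)
  qed
  then obtain M where M: "\<And>k m. M k \<le> m \<Longrightarrow> rest m < ((1/2) ^ k) powr r" by metis
  \<comment> \<open>Summing over all earlier indices makes the levels increasing and at least
    \<open>M k\<close>; the summand \<open>k\<close> makes them tend to infinity.\<close>
  define N where "N k = k + (\<Sum>i\<le>k. M i)" for k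
  have NM: "M k \<le> N k" for k unfolding N_def by (rule trans_le_add2) (simp add: member_le_sum)
  have Nk: "k \<le> N k" for k by (simp add: N_def)
  have Nmono: "N k \<le> N (Suc k)" for k by (simp add: N_def)
  \<comment> \<open>Starting from \<open>\<sigma> 0 = 0\<close> makes the first piece the whole
    restriction to \<open>E (N 0)\<close>, and the partial sums telescope to
    \<open>\<sigma> n\<close> without a correction term.\<close>
  define \<sigma> where "\<sigma> k z = (case k of 0 \<Rightarrow> 0 | Suc j \<Rightarrow> s z * indicator (E (N j)) z)" for k z
  define \<tau> where "\<tau> k z = \<sigma> (Suc k) z - \<sigma> k z" for k z
  have sum: "(\<Sum>k<n. \<tau> k z) = \<sigma> n z" for n z
    by (induction n) (simp_all add: \<tau>_def \<sigma>_def)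
  have \<tau>0: "\<tau> 0 z = s z * indicator (E (N 0)) z" for z by (simp add: \<tau>_def \<sigma>_def)
  have \<tau>S: "\<tau> (Suc k) z = s z * indicator (E (N (Suc k)) - E (N k)) z" for k z
    using Emono[OF Nmono[of k]] by (auto simp: \<tau>_def \<sigma>_def indicator_def)
  have \<tau>s: "norm (\<tau> k z) \<le> norm (s z)" for k z by (cases k) (auto simp: \<tau>0 \<tau>S indicator_def)
  have [measurable]: "\<tau> k \<in> borel_measurable borel" for k
    by (cases k) (simp_all add: \<tau>0[abs_def] \<tau>S[abs_def])
  have \<tau>L: "\<tau> k \<in> Lp_space q" "Lp_norm q (\<tau> k) \<le> Lp_norm q s" for k
    by (rule Lp_space_dominated[OF s], simp, rule \<tau>s)+
  have tail: "Lp_norm q (\<tau> (Suc k)) \<le> (1/2) ^ k" for k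
  proof -
    have 1: "integrable lborel (\<lambda>z. norm (s z * indicator (- E (N k)) z) powr r)"
      by (rule Bochner_Integration.integrable_bound[OF si]) (auto simp: indicator_def)
    have "(\<integral>z. norm (\<tau> (Suc k) z) powr r \<partial>lborel) \<le> rest (N k)"
      unfolding rest_def
    proof (rule integral_mono[OF _ 1])
      show "integrable lborel (\<lambda>z. norm (\<tau> (Suc k) z) powr r)"
        using \<tau>L(1)[of "Suc k"] q r by (simp add: Lp_space_def)
      show "norm (\<tau> (Suc k) z) powr r \<le> norm (s z * indicator (- E (N k)) z) powr r" for z
        by (auto simp: \<tau>S indicator_def)
    qed
    also have "\<dots> < ((1/2) ^ k) powr r" by (rule M[OF NM])
    finally have "(\<integral>z. norm (\<tau> (Suc k) z) powr r \<partial>lborel) powr (1 / r) \<le> (((1/2) ^ k) powr r) powr (1 / r)"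
      using r by (intro powr_mono2 integral_nonneg_AE) auto
    then show ?thesis using r q by (simp add: Lp_norm_def powr_powr)
  qed
  show ?thesis
  proof (rule that[of \<tau>])
    show "integrable lborel (\<tau> k)" for k
    proof (rule Bochner_Integration.integrable_bound)
      let ?n = "N k"
      have E: "\<tau> k z = 0 \<or> z \<in> E ?n" for z by (cases k) (auto simp: \<tau>0 \<tau>S indicator_def)
      show "integrable lborel (\<lambda>z. real ?n powr (r - 1) * norm (s z) powr r)" using si by simp
      have "norm (\<tau> k z) \<le> real ?n powr (r - 1) * norm (s z) powr r" for z
      proof (cases "\<tau> k z = 0")
        case False
        then have z: "1 \<le> real ?n * norm (s z)" using E[of z] by (auto simp: E_def)
        have "1 \<le> (real ?n * norm (s z)) powr (r - 1)" using z r by (intro ge_one_powr_ge_zero) auto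
        then have "1 * norm (s z) \<le> (real ?n * norm (s z)) powr (r - 1) * norm (s z)" by (intro mult_right_mono) auto
        also have "\<dots> = real ?n powr (r - 1) * (norm (s z) powr (r - 1) * norm (s z) powr 1)"
          by (simp add: powr_mult)
        also have "norm (s z) powr (r - 1) * norm (s z) powr 1 = norm (s z) powr r"
          by (subst powr_add[symmetric]) simp
        finally show ?thesis using \<tau>s[of k z] by simp
      qed simp
      then show "AE z in lborel. norm (\<tau> k z) \<le> norm (real ?n powr (r - 1) * norm (s z) powr r)" by simp
    qed simp
    show "\<tau> k \<in> Lp_space q" for k by (rule \<tau>L)
    have "summable (\<lambda>k. Lp_norm q (\<tau> (Suc k)))"
      by (rule summable_comparison_test'[of "\<lambda>k. (1/2::real) ^ k" 0]) (auto simp: tail summable_geometric)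
    then show "summable (\<lambda>k. Lp_norm q (\<tau> k))" by (subst (asm) summable_Suc_iff)
    show "norm (\<Sum>k<n. \<tau> k z) \<le> norm (s z)" for n z
      unfolding sum by (cases n) (auto simp: \<sigma>_def indicator_def)
    show "(\<lambda>n. \<Sum>k<n. \<tau> k z) \<longlonglongrightarrow> s z" for z
    proof (rule LIMSEQ_imp_Suc, rule tendsto_eventually, cases "s z = 0")
      case False
      then obtain n0 where n0: "\<And>n. n0 \<le> n \<Longrightarrow> z \<in> E n"
        using Eev[OF False] by (auto simp: eventually_sequentially)
      show "\<forall>\<^sub>F n in sequentially. (\<Sum>k<Suc n. \<tau> k z) = s z"
        unfolding sum \<sigma>_def by (rule eventually_sequentiallyI[of n0]) (simp add: n0 order_trans[OF _ Nk])
    qed (simp add: sum \<sigma>_def)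
  qed
qed

context wigner_geometry
begin

text \<open>The operators of the pieces of \<open>s\<close> have summable norms; their kernels are therefore summed
  pointwise, which avoids completeness of $L^p$.\<close>

theorem operator_bounded:
  fixes s :: "'a \<times> 'a \<Rightarrow> complex"
  assumes s: "s \<in> Lp_space q" and f: "nice f"
    and p: "1 \<le> p" "1 / p + 1 / p' = 1" and q: "1 \<le> q" "1 / q + 1 / q' = 1"
    and pq: "q \<le> 2" "q \<le> p" "p \<le> q'"
  obtains h where "h \<in> Lp_space p" "Lp_norm p h \<le> bound_const p p' q' * (Lp_norm q s * Lp_norm p f)"
    "\<And>g. nice g \<Longrightarrow> (\<integral>z. s z * T f g z \<partial>lborel) = (\<integral>u. h u * g u \<partial>lborel)"
proof -
  note p' = conjugate_exponents[OF p]
  define K where "K = bound_const p p' q'"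
  have K: "0 < K" unfolding K_def by (rule bound_const_pos)
  have [measurable]: "s \<in> borel_measurable borel" using s by measurable
  have [measurable]: "f \<in> borel_measurable borel" using f by (rule niceD)
  have "q \<noteq> \<infinity>" using pq(1) by (auto simp: top_unique)
  then obtain \<tau> where \<tau>: "\<And>k. integrable lborel (\<tau> k)" "\<And>k. \<tau> k \<in> Lp_space q"
    "summable (\<lambda>k. Lp_norm q (\<tau> k))"
    "\<And>n z. norm (\<Sum>k<n. \<tau> k z) \<le> norm (s z)"
    "\<And>z. (\<lambda>n. \<Sum>k<n. \<tau> k z) \<longlonglongrightarrow> s z"
    using symbol_decomposition[OF s q(1)] by metis
  have "\<exists>h. h \<in> borel_measurable borel \<and> (\<forall>g. nice g \<longrightarrow> integrable lborel (\<lambda>u. h u * g u)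
      \<and> (\<integral>z. \<tau> k z * T f g z \<partial>lborel) = (\<integral>u. h u * g u \<partial>lborel))" for k
    by (rule operator_integrable_symbol[OF \<tau>(1)[of k] f]) blast
  then obtain h where h: "\<And>k. h k \<in> borel_measurable borel"
    "\<And>k g. nice g \<Longrightarrow> integrable lborel (\<lambda>u. h k u * g u)"
    "\<And>k g. nice g \<Longrightarrow> (\<integral>z. \<tau> k z * T f g z \<partial>lborel) = (\<integral>u. h k u * g u \<partial>lborel)"
    by metis
  note [measurable] = h(1)
  \<comment> \<open>The form controls only integrals with phases. Giving \<open>g\<close> the
    opposite phase of \<open>h k\<close> does not increase its norm and turns the bound on the
    integral into one on the integral of the modulus.\<close>
  have hb: "(\<integral>u. norm (h k u * g u) \<partial>lborel) \<le> K * (Lp_norm q (\<tau> k) * (Lp_norm p f * Lp_norm p' g))"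
    if g: "nice g" for k g
  proof -
    have [measurable]: "g \<in> borel_measurable borel" using g by (rule niceD)
    define g' where "g' u = cnj (sgn (h k u)) * of_real (norm (g u))" for u
    have [measurable]: "g' \<in> borel_measurable borel" unfolding g'_def[abs_def] by measurable
    have le: "norm (g' u) \<le> norm (g u)" for u by (simp add: g'_def norm_mult norm_sgn)
    have g': "nice g'" by (rule nice_dominated[OF g _ le]) simp
    have eq: "h k u * g' u = of_real (norm (h k u * g u))" for u
      unfolding g'_def mult.assoc[symmetric] mult_cnj_sgn by (simp add: norm_mult)

    have "(\<integral>u. norm (h k u * g u) \<partial>lborel) = norm (\<integral>u. h k u * g' u \<partial>lborel)"
      unfolding eq integral_complex_of_real norm_of_real by (intro abs_of_nonneg[symmetric] integral_nonneg_AE) auto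
    also have "\<dots> = norm (\<integral>z. \<tau> k z * T f g' z \<partial>lborel)" by (simp add: h(3)[OF g'])
    also have "\<dots> \<le> (\<integral>z. norm (\<tau> k z) * norm (T f g' z) \<partial>lborel)"
      using integral_norm_bound[of lborel "\<lambda>z. \<tau> k z * T f g' z"] by (simp add: norm_mult)
    also have "\<dots> \<le> K * (Lp_norm q (\<tau> k) * (Lp_norm p f * Lp_norm p' g'))"
      unfolding K_def by (rule trilinear(2)[OF \<tau>(2) f g' p q pq])
    also have "\<dots> \<le> K * (Lp_norm q (\<tau> k) * (Lp_norm p f * Lp_norm p' g))"
      using K Lp_space_dominated(2)[OF nice_Lp[OF g p'(1)], of g'] le by (intro mult_left_mono) auto
    finally show ?thesis .
  qed
  have sumg: "summable (\<lambda>k. \<integral>u. norm (h k u * g u) \<partial>lborel)" if g: "nice g" for g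
  proof (rule summable_comparison_test'[where N=0])
    show "summable (\<lambda>k. K * (Lp_norm q (\<tau> k) * (Lp_norm p f * Lp_norm p' g)))"
      by (intro summable_mult summable_mult2 \<tau>(3))
    show "norm (\<integral>u. norm (h k u * g u) \<partial>lborel) \<le> K * (Lp_norm q (\<tau> k) * (Lp_norm p f * Lp_norm p' g))" for k
      using hb[OF g, of k] by (subst real_norm_def, subst abs_of_nonneg) (auto intro: integral_nonneg_AE)
  qed
  \<comment> \<open>One test function that vanishes nowhere suffices: summability of the integrals
    against a Gaussian gives pointwise summability almost everywhere, and the Gaussian can be
    divided out.\<close>
  have AEs: "AE u in lborel. summable (\<lambda>k. norm (h k u))"
  proof -
    define g where "g u = complex_of_real (gauss 1 u)" for u :: 'a
    have g: "nice g" unfolding nice_def g_def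
      using gauss_integral(1)[of 1, where 'a='a] by (auto intro!: exI[of _ 1])
    have nn: "(\<integral>\<^sup>+u. ennreal (norm (h k u * g u)) \<partial>lborel) = ennreal (\<integral>u. norm (h k u * g u) \<partial>lborel)" for k
      using integrable_norm[OF h(2)[OF g]] by (intro nn_integral_eq_integral) auto
    have [measurable]: "g \<in> borel_measurable borel" using g by (rule niceD)
    have "(\<integral>\<^sup>+u. (\<Sum>k. ennreal (norm (h k u * g u))) \<partial>lborel) = (\<Sum>k. \<integral>\<^sup>+u. ennreal (norm (h k u * g u)) \<partial>lborel)"
      by (rule nn_integral_suminf) simp
    also have "\<dots> = ennreal (\<Sum>k. \<integral>u. norm (h k u * g u) \<partial>lborel)"
      unfolding nn by (rule suminf_ennreal2) (auto intro: integral_nonneg_AE sumg[OF g])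
    also have "\<dots> \<noteq> \<infinity>" by simp
    finally have "AE u in lborel. (\<Sum>k. ennreal (norm (h k u * g u))) \<noteq> \<infinity>"
      by (intro nn_integral_PInf_AE) simp_all
    then show ?thesis
    proof eventually_elim
      case (elim u)
      then have "summable (\<lambda>k. norm (h k u * g u))"
        by (intro summable_suminf_not_top) auto
      then have "summable (\<lambda>k. norm (h k u) * gauss 1 u)" by (simp add: norm_mult g_def)
      then have "summable (\<lambda>k. norm (h k u) * gauss 1 u * (1 / gauss 1 u))" by (rule summable_mult2)
      then show ?case using gauss_pos[of 1 u] by simp
    qed
  qed
  define H where "H u = (\<Sum>k. h k u)" for u
  have [measurable]: "H \<in> borel_measurable borel" unfolding H_def[abs_def] by measurable
  have rep: "(\<integral>z. s z * T f g z \<partial>lborel) = (\<integral>u. H u * g u \<partial>lborel)" if g: "nice g" for g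
  proof -
    have [measurable]: "g \<in> borel_measurable borel" using g by (rule niceD)
    have [measurable]: "T f g \<in> borel_measurable borel" by (rule T_measurable) auto
    have [measurable]: "\<tau> k \<in> borel_measurable borel" for k using \<tau>(1)[of k] by auto
    have "(\<lambda>k. \<integral>u. h k u * g u \<partial>lborel) sums (\<integral>u. (\<Sum>k. h k u * g u) \<partial>lborel)"
    proof (rule sums_integral[OF h(2)[OF g] _ sumg[OF g]])
      show "AE u in lborel. summable (\<lambda>k. norm (h k u * g u))"
        using AEs by eventually_elim (auto simp: norm_mult intro: summable_mult2)
    qed
    moreover have "(\<integral>u. (\<Sum>k. h k u * g u) \<partial>lborel) = (\<integral>u. H u * g u \<partial>lborel)"
      by (rule integral_cong_AE) (simp_all, use AEs in eventually_elim, 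
        simp add: H_def suminf_mult2[OF summable_norm_cancel])
    moreover have "(\<lambda>n. \<Sum>k<n. \<integral>u. h k u * g u \<partial>lborel) \<longlonglongrightarrow> (\<integral>z. s z * T f g z \<partial>lborel)"
    proof -
      have it: "integrable lborel (\<lambda>z. \<tau> k z * T f g z)" for k by (rule trilinear(1)[OF \<tau>(2) f g p q pq])
      have "(\<Sum>k<n. \<integral>u. h k u * g u \<partial>lborel) = (\<integral>z. (\<Sum>k<n. \<tau> k z) * T f g z \<partial>lborel)" for n
        by (simp add: h(3)[OF g, symmetric] sum_distrib_right it)
      moreover have "(\<lambda>n. \<integral>z. (\<Sum>k<n. \<tau> k z) * T f g z \<partial>lborel) \<longlonglongrightarrow> (\<integral>z. s z * T f g z \<partial>lborel)"
      proof (rule integral_dominated_convergence)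
        show "integrable lborel (\<lambda>z. norm (s z * T f g z))"
          by (rule integrable_norm[OF trilinear(1)[OF s f g p q pq]])
        show "AE z in lborel. (\<lambda>n. (\<Sum>k<n. \<tau> k z) * T f g z) \<longlonglongrightarrow> s z * T f g z"
          by (intro AE_I2 tendsto_mult \<tau>(5) tendsto_const)
        show "AE z in lborel. norm ((\<Sum>k<n. \<tau> k z) * T f g z) \<le> norm (s z * T f g z)" for n
          unfolding norm_mult by (intro AE_I2 mult_right_mono \<tau>(4)) auto
      qed simp_all
      ultimately show ?thesis by simp
    qed
    ultimately show ?thesis by (auto simp: sums_def intro: LIMSEQ_unique)
  qed
  define c where "c = K * (Lp_norm q s * Lp_norm p f)"
  have c0: "0 \<le> c" unfolding c_def using K by auto
  have "H \<in> Lp_space p \<and> Lp_norm p H \<le> c"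
  proof (rule Lp_converse_holder[OF _ c0 p])
    fix g :: "'a \<Rightarrow> complex" assume g: "nice g"
    have "norm (\<integral>u. H u * g u \<partial>lborel) \<le> (\<integral>z. norm (s z) * norm (T f g z) \<partial>lborel)"
      using integral_norm_bound[of lborel "\<lambda>z. s z * T f g z"] by (simp add: norm_mult rep[OF g])
    also have "\<dots> \<le> K * (Lp_norm q s * (Lp_norm p f * Lp_norm p' g))"
      unfolding K_def by (rule trilinear(2)[OF s f g p q pq])
    finally show "norm (\<integral>u. H u * g u \<partial>lborel) \<le> c * Lp_norm p' g" by (simp add: c_def mult.assoc)
  qed simp
  then show ?thesis using rep by (intro that[of H]) (auto simp: c_def K_def)
qed

end

section \<open>Fourier inversion bound\<close>

lemma affine_scaling_homothety:
  assumes "c \<noteq> 0"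
  shows "affine_scaling (\<lambda>y. t + c *\<^sub>R y :: 'a::euclidean_space) (\<bar>c\<bar> ^ DIM('a))"
  unfolding affine_scaling_def
proof (intro conjI ballI)
  fix \<phi> :: "'a \<Rightarrow> ennreal" assume [measurable]: "\<phi> \<in> borel_measurable borel"
  have "(\<integral>\<^sup>+x. \<phi> x \<partial>lborel) = (\<integral>\<^sup>+x. \<phi> x \<partial>density (distr lborel borel (\<lambda>x. t + c *\<^sub>R x)) (\<lambda>_. \<bar>c\<bar> ^ DIM('a)))"
    using lborel_affine[OF assms, of t] by simp
  also have "\<dots> = ennreal (\<bar>c\<bar> ^ DIM('a)) * (\<integral>\<^sup>+x. \<phi> (t + c *\<^sub>R x) \<partial>lborel)"
    by (simp add: nn_integral_density nn_integral_distr nn_integral_cmult)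
  finally show "(\<integral>\<^sup>+x. \<phi> x \<partial>lborel) = ennreal (\<bar>c\<bar> ^ DIM('a)) * (\<integral>\<^sup>+x. \<phi> (t + c *\<^sub>R x) \<partial>lborel)" .
qed (use assms in auto)

text \<open>A weak inversion bound. The regularised pairing of \<open>h\<close> with \<phi> is an
  integral of \<open>ft h\<close> times the transform of \<phi>, which is at most the L1 norm of
  \<phi>. This holds uniformly in the regularisation, whose removal only needs continuity of
  \<phi>.\<close>

lemma inversion_test_function:
  fixes h :: "'a::euclidean_space \<Rightarrow> complex" and \<phi> :: "'a \<Rightarrow> real"
  assumes h: "integrable lborel h" and fh: "integrable lborel (ft h)"
    and \<phi>: "continuous_on UNIV \<phi>" "\<And>x. 0 \<le> \<phi> x" "\<And>x. \<phi> x \<le> 1" "integrable lborel \<phi>"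
  shows "norm (\<integral>x. h x * of_real (\<phi> x) \<partial>lborel) \<le> (\<integral>w. norm (ft h w) \<partial>lborel) * (\<integral>x. \<phi> x \<partial>lborel)"
proof -
  have [measurable]: "\<phi> \<in> borel_measurable borel" using \<phi>(1) by (rule borel_measurable_continuous_onI)
  have [measurable]: "h \<in> borel_measurable borel" using h by auto
  define v where "v x = complex_of_real (\<phi> x)" for x
  have v: "integrable lborel v" unfolding v_def using \<phi>(4) by simp
  have ftv: "norm (ft v w) \<le> (\<integral>x. \<phi> x \<partial>lborel)" for w
    using ft_bound[OF v, of w] \<phi>(2) by (simp add: v_def)
  have [measurable]: "ft v \<in> borel_measurable borel" "ft h \<in> borel_measurable borel"
    using v by (auto intro!: ft_measurable)
  define c where "c n = 1 / real (Suc n)" for n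
  have c: "0 < c n" for n by (simp add: c_def)
  \<comment> \<open>The mollification of \<phi>, written with the scale moved into its argument, so
    that the dominating Gaussian does not vary with \<open>n\<close>.\<close>
  define \<phi>c where "\<phi>c n x = (\<integral>y. \<phi> (x - c n *\<^sub>R y) * gauss 1 y \<partial>lborel)" for n x
  have g1: "integrable lborel (gauss 1 :: 'a \<Rightarrow> real)" "(\<integral>y. gauss 1 (y::'a) \<partial>lborel) = 1"
    using gauss_integral[of 1, where 'a='a] by auto
  have moll: "(\<integral>y. cnj (v y) * of_real (gauss (1 / c n) (x - y) / c n ^ DIM('a)) \<partial>lborel) = of_real (\<phi>c n x)" for n x
  proof -
    have sc: "affine_scaling (\<lambda>y. x + (- c n) *\<^sub>R y) (c n ^ DIM('a))"
      using affine_scaling_homothety[of "- c n" x] c[of n] by simp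
    have "(\<integral>y. \<phi> y * (gauss (1 / c n) (x - y) / c n ^ DIM('a)) \<partial>lborel)
       = c n ^ DIM('a) *\<^sub>R (\<integral>y. \<phi> (x + (- c n) *\<^sub>R y) * (gauss (1 / c n) (x - (x + (- c n) *\<^sub>R y)) / c n ^ DIM('a)) \<partial>lborel)"
      by (rule affine_scaling_integral(2)[OF sc]) simp
    also have "\<dots> = (\<integral>y. c n ^ DIM('a) * (\<phi> (x + (- c n) *\<^sub>R y) * (gauss (1 / c n) (x - (x + (- c n) *\<^sub>R y)) / c n ^ DIM('a))) \<partial>lborel)"
      by simp
    also have "\<dots> = \<phi>c n x"
      unfolding \<phi>c_def
    proof (rule Bochner_Integration.integral_cong[OF refl])
      fix y :: 'a
      have "gauss (1 / c n) (c n *\<^sub>R y) = gauss 1 y"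
        using c[of n] by (simp add: gauss_def power_mult_distrib power_divide)
      then show "c n ^ DIM('a) * (\<phi> (x + (- c n) *\<^sub>R y) * (gauss (1 / c n) (x - (x + (- c n) *\<^sub>R y)) / c n ^ DIM('a)))
        = \<phi> (x - c n *\<^sub>R y) * gauss 1 y"
        using c[of n] by simp
    qed
    finally have "complex_of_real (\<integral>y. \<phi> y * (gauss (1 / c n) (x - y) / c n ^ DIM('a)) \<partial>lborel) = of_real (\<phi>c n x)"
      by (simp only:)
    then show ?thesis unfolding integral_complex_of_real[symmetric] by (simp add: v_def)
  qed
  have [measurable]: "\<phi>c n \<in> borel_measurable borel" for n
  proof -
    have "(\<lambda>x. \<integral>y. complex_of_real (\<phi> (x - c n *\<^sub>R y) * gauss 1 y) \<partial>lborel) \<in> borel_measurable borel"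
      using borel_measurable_lborel_integral[of "\<lambda>z. complex_of_real (\<phi> (fst z - c n *\<^sub>R snd z) * gauss 1 (snd z))"] by simp
    then have "(\<lambda>x. Re (complex_of_real (\<phi>c n x))) \<in> borel_measurable borel"
      unfolding \<phi>c_def integral_complex_of_real by measurable
    then show ?thesis by simp
  qed
  have \<phi>c1: "\<bar>\<phi>c n x\<bar> \<le> 1" for n x
  proof -
    have "\<bar>\<phi>c n x\<bar> \<le> (\<integral>y. norm (\<phi> (x - c n *\<^sub>R y) * gauss 1 y) \<partial>lborel)"
      unfolding \<phi>c_def by (metis integral_norm_bound real_norm_def)
    also have "\<dots> \<le> (\<integral>y. gauss 1 (y::'a) \<partial>lborel)"
    proof (rule integral_mono[OF _ g1(1)])
      show le: "norm (\<phi> (x - c n *\<^sub>R y) * gauss 1 y) \<le> gauss 1 y" for y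
        using \<phi>(2,3)[of "x - c n *\<^sub>R y"] by (simp add: abs_mult mult_left_le_one_le)
      show "integrable lborel (\<lambda>y. norm (\<phi> (x - c n *\<^sub>R y) * gauss 1 y))"
        by (rule Bochner_Integration.integrable_bound[OF g1(1)]) (use le in auto)
    qed
    finally show ?thesis using g1 by simp
  qed
  have \<phi>clim: "(\<lambda>n. \<phi>c n x) \<longlonglongrightarrow> \<phi> x" for x
  proof -
    have "(\<lambda>n. \<phi>c n x) \<longlonglongrightarrow> (\<integral>y. \<phi> x * gauss 1 (y::'a) \<partial>lborel)"
      unfolding \<phi>c_def
    proof (rule integral_dominated_convergence[OF _ _ g1(1)])
      show "AE y in lborel. norm (\<phi> (x - c n *\<^sub>R y) * gauss 1 y) \<le> gauss 1 y" for n
        using \<phi>(2,3) by (auto simp: abs_mult mult_left_le_one_le)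
      show "AE y in lborel. (\<lambda>n. \<phi> (x - c n *\<^sub>R y) * gauss 1 y) \<longlonglongrightarrow> \<phi> x * gauss 1 y"
      proof (intro AE_I2 tendsto_mult tendsto_const)
        fix y
        have "(\<lambda>n. x - c n *\<^sub>R y) \<longlonglongrightarrow> x - 0 *\<^sub>R y"
          unfolding c_def by (intro tendsto_intros LIMSEQ_Suc lim_1_over_n)
        then have "(\<lambda>n. x - c n *\<^sub>R y) \<longlonglongrightarrow> x" by simp
        moreover have "isCont \<phi> x" using \<phi>(1) by (simp add: continuous_on_eq_continuous_at)
        ultimately show "(\<lambda>n. \<phi> (x - c n *\<^sub>R y)) \<longlonglongrightarrow> \<phi> x" by (rule isCont_tendsto_compose[rotated])
      qed
    qed simp_all
    then show ?thesis using g1 by simp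
  qed
  have bd: "norm (\<integral>x. h x * of_real (\<phi>c n x) \<partial>lborel) \<le> (\<integral>w. norm (ft h w) \<partial>lborel) * (\<integral>x. \<phi> x \<partial>lborel)" for n
  proof -
    have "(\<integral>z. h (fst z) * cnj (v (snd z)) * of_real (gauss (1 / c n) (fst z - snd z) / c n ^ DIM('a)) \<partial>lborel)
      = (\<integral>x. \<integral>y. h (fst (x, y)) * cnj (v (snd (x, y))) * of_real (gauss (1 / c n) (fst (x, y) - snd (x, y)) / c n ^ DIM('a)) \<partial>lborel \<partial>lborel)"
      by (rule integral_lborel_pair(1)[OF gauss_pairing(2)[OF h v c[of n]]])
    also have "\<dots> = (\<integral>x. h x * of_real (\<phi>c n x) \<partial>lborel)"
      by (simp only: fst_conv snd_conv mult.assoc integral_mult_right_zero moll)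
    finally have "(\<integral>x. h x * of_real (\<phi>c n x) \<partial>lborel)
       = (\<integral>z. h (fst z) * cnj (v (snd z)) * of_real (gauss (1 / c n) (fst z - snd z) / c n ^ DIM('a)) \<partial>lborel)" by (rule sym)
    also have "\<dots> = (\<integral>w. of_real (gauss (c n) w) * (ft h w * cnj (ft v w)) \<partial>lborel)"
      by (rule gauss_pairing(1)[OF h v c, symmetric])
    finally have "norm (\<integral>x. h x * of_real (\<phi>c n x) \<partial>lborel) \<le> (\<integral>w. norm (of_real (gauss (c n) w) * (ft h w * cnj (ft v w))) \<partial>lborel)"
      by (simp only: integral_norm_bound)
    also have "\<dots> \<le> (\<integral>w. norm (ft h w) * (\<integral>x. \<phi> x \<partial>lborel) \<partial>lborel)"
    proof (rule integral_mono)
      show i: "integrable lborel (\<lambda>w. norm (ft h w) * (\<integral>x. \<phi> x \<partial>lborel))" using fh by simp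
      show le: "norm (of_real (gauss (c n) w) * (ft h w * cnj (ft v w))) \<le> norm (ft h w) * (\<integral>x. \<phi> x \<partial>lborel)" for w
      proof -
        have "norm (of_real (gauss (c n) w) * (ft h w * cnj (ft v w))) = gauss (c n) w * (norm (ft h w) * norm (ft v w))"
          by (simp add: norm_mult)
        also have "\<dots> \<le> 1 * (norm (ft h w) * (\<integral>x. \<phi> x \<partial>lborel))"
          by (intro mult_mono ftv order_refl) auto
        finally show ?thesis by simp
      qed
      show "integrable lborel (\<lambda>w. norm (of_real (gauss (c n) w) * (ft h w * cnj (ft v w))))"
      proof (rule Bochner_Integration.integrable_bound[OF i])
        show "AE w in lborel. norm (norm (of_real (gauss (c n) w) * (ft h w * cnj (ft v w)))) \<le> norm (norm (ft h w) * (\<integral>x. \<phi> x \<partial>lborel))"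
          unfolding real_norm_def abs_norm_cancel by (intro AE_I2 order_trans[OF le abs_ge_self])
      qed simp
    qed
    finally show ?thesis by simp
  qed
  have "(\<lambda>n. \<integral>x. h x * of_real (\<phi>c n x) \<partial>lborel) \<longlonglongrightarrow> (\<integral>x. h x * of_real (\<phi> x) \<partial>lborel)"
  proof (rule integral_dominated_convergence[OF _ _ integrable_norm[OF h]])
    show "AE x in lborel. (\<lambda>n. h x * of_real (\<phi>c n x)) \<longlonglongrightarrow> h x * of_real (\<phi> x)"
      by (intro AE_I2 tendsto_intros \<phi>clim)
    show "AE x in lborel. norm (h x * of_real (\<phi>c n x)) \<le> norm (h x)" for n
      using \<phi>c1[of n] by (auto simp: norm_mult mult_left_le)
  qed simp_all
  then have "(\<lambda>n. norm (\<integral>x. h x * of_real (\<phi>c n x) \<partial>lborel)) \<longlonglongrightarrow> norm (\<integral>x. h x * of_real (\<phi> x) \<partial>lborel)"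
    by (rule tendsto_norm)
  then show ?thesis by (rule LIMSEQ_le_const2) (use bd in blast)
qed

text \<open>The indicator is the decreasing limit of continuous cutoffs linear in the distance to
  \<open>K\<close>, and the weak bound passes to the limit on both sides.\<close>

lemma inversion_compact:
  fixes h :: "'a::euclidean_space \<Rightarrow> complex"
  assumes h: "integrable lborel h" and fh: "integrable lborel (ft h)" and K: "compact K" "K \<noteq> {}"
  shows "norm (\<integral>x. h x * indicator K x \<partial>lborel) \<le> (\<integral>w. norm (ft h w) \<partial>lborel) * measure lborel K"
proof -
  have [measurable]: "K \<in> sets borel" using K by (intro borel_compact)
  have [measurable]: "h \<in> borel_measurable borel" using h by auto
  define \<phi> where "\<phi> n x = max 0 (1 - real n * infdist x K)" for n x
  have cont: "continuous_on UNIV (\<phi> n)" for n unfolding \<phi>_def by (intro continuous_intros)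
  have [measurable]: "\<phi> n \<in> borel_measurable borel" for n by (rule borel_measurable_continuous_onI[OF cont])
  have \<phi>01: "0 \<le> \<phi> n x" "\<phi> n x \<le> 1" for n x by (auto simp: \<phi>_def infdist_nonneg)
  obtain R where R: "K \<subseteq> cball 0 R" using compact_imp_bounded[OF K(1)] by (auto simp: bounded_iff subset_eq)
  \<comment> \<open>At distance at least 1 from \<open>K\<close> the cutoff vanishes as soon as n
    \<ge> 1, so one ball carries all of them; this is why the sequence is used from
    \<open>Suc n\<close> on.\<close>
  have dom: "\<phi> n x \<le> indicator (cball 0 (R + 1)) x" if n: "1 \<le> n" for n x
  proof (cases "x \<in> cball 0 (R + 1)")
    case False
    have "1 \<le> infdist x K"
      unfolding infdist_notempty[OF K(2)]
    proof (rule cINF_greatest[OF K(2)])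
      fix k assume "k \<in> K"
      then have "norm k \<le> R" using R by auto
      moreover have "R + 1 < norm x" using False by simp
      moreover have "norm x \<le> norm k + dist x k" by (metis add.commute dist_norm norm_triangle_sub)
      ultimately show "1 \<le> dist x k" by linarith
    qed
    then have "1 * 1 \<le> real n * infdist x K" using n by (intro mult_mono) auto
    then show ?thesis using False by (simp add: \<phi>_def)
  qed (simp add: \<phi>01)
  have icb: "integrable lborel (indicator (cball 0 (R + 1)) :: 'a \<Rightarrow> real)"
    using emeasure_lborel_cball_finite by (simp add: integrable_indicator_iff less_top)
  have lim: "(\<lambda>n. \<phi> (Suc n) x) \<longlonglongrightarrow> indicator K x" for x
  proof (cases "x \<in> K")
    case False
    then have "0 < infdist x K" using K compact_imp_closed[OF K(1)] in_closed_iff_infdist_zero[of K x] infdist_nonneg[of x K] by (simp add: less_le)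
    then obtain N :: nat where N: "1 < real N * infdist x K" using reals_Archimedean3 by blast
    show ?thesis
    proof (rule tendsto_eventually, rule eventually_sequentiallyI[of N])
      fix n assume "N \<le> n"
      then have "real N * infdist x K \<le> real (Suc n) * infdist x K" by (intro mult_right_mono) (auto simp: infdist_nonneg)
      then show "\<phi> (Suc n) x = indicator K x" using N False by (simp add: \<phi>_def del: of_nat_Suc)
    qed
  qed (simp add: \<phi>_def)
  have int: "integrable lborel (\<phi> (Suc n))" for n
    by (rule Bochner_Integration.integrable_bound[OF icb]) (use dom[of "Suc n"] \<phi>01 in auto)
  have le: "norm (\<integral>x. h x * of_real (\<phi> (Suc n) x) \<partial>lborel) \<le> (\<integral>w. norm (ft h w) \<partial>lborel) * (\<integral>x. \<phi> (Suc n) x \<partial>lborel)" for n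
    by (rule inversion_test_function[OF h fh cont \<phi>01 int])
  have l1: "(\<lambda>n. \<integral>x. h x * of_real (\<phi> (Suc n) x) \<partial>lborel) \<longlonglongrightarrow> (\<integral>x. h x * of_real (indicator K x) \<partial>lborel)"
  proof (rule integral_dominated_convergence[OF _ _ integrable_norm[OF h]])
    show "AE x in lborel. (\<lambda>n. h x * of_real (\<phi> (Suc n) x)) \<longlonglongrightarrow> h x * of_real (indicator K x)"
      by (intro AE_I2 tendsto_intros lim)
    show "AE x in lborel. norm (h x * of_real (\<phi> (Suc n) x)) \<le> norm (h x)" for n
      using \<phi>01 by (auto simp: norm_mult mult_left_le)
  qed simp_all
  have l2: "(\<lambda>n. \<integral>x. \<phi> (Suc n) x \<partial>lborel) \<longlonglongrightarrow> (\<integral>x. indicator K x \<partial>lborel)"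
  proof (rule integral_dominated_convergence[OF _ _ icb])
    show "AE x in lborel. norm (\<phi> (Suc n) x) \<le> indicator (cball 0 (R + 1)) x" for n
      using dom[of "Suc n"] \<phi>01 by simp
  qed (use lim in simp_all)
  have "norm (\<integral>x. h x * of_real (indicator K x) \<partial>lborel) \<le> (\<integral>w. norm (ft h w) \<partial>lborel) * (\<integral>x. indicator K x \<partial>lborel)"
    by (rule LIMSEQ_le[OF tendsto_norm[OF l1] tendsto_mult[OF tendsto_const l2]]) (use le in blast)
  moreover have "complex_of_real (indicator K x) = indicator K x" for x by (simp add: indicator_def)
  ultimately show ?thesis by simp
qed

text \<open>The bound on averages over compact sets is upgraded to a pointwise one: a set of
  positive measure on which \<open>h\<close> is too large in a fixed direction would, by inner
  regularity, contain a compact set of positive measure violating that bound.\<close>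

lemma inversion_bound:
  fixes h :: "'a::euclidean_space \<Rightarrow> complex"
  assumes h: "integrable lborel h" and fh: "integrable lborel (ft h)"
  shows "AE x in lborel. norm (h x) \<le> (\<integral>w. norm (ft h w) \<partial>lborel)"
proof -
  have [measurable]: "h \<in> borel_measurable borel" using h by auto
  define M where "M = (\<integral>w. norm (ft h w) \<partial>lborel)"
  have M0: "0 \<le> M" unfolding M_def by (rule integral_nonneg_AE) auto
  \<comment> \<open>Countably many directions suffice, so that the exceptional sets may be united;
    openness of the strict inequality lets the dense set reach every value of
    \<open>h\<close>.\<close>
  obtain Q :: "complex set" where Q: "countable Q" "\<And>X. open X \<Longrightarrow> X \<noteq> {} \<Longrightarrow> \<exists>d\<in>Q. d \<in> X"
    using countable_dense_setE by metis
  have null: "AE x in lborel. \<not> (norm x \<le> real n \<and> M * norm c < Re (c * h x))" for c and n :: nat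
  proof (rule ccontr)
    assume n: "\<not> ?thesis"
    define E where "E = {x. norm x \<le> real n \<and> M * norm c < Re (c * h x)}"
    have [measurable]: "E \<in> sets borel" unfolding E_def by measurable
    have Efin: "emeasure lborel E < \<infinity>"
    proof -
      have "emeasure lborel E \<le> emeasure lborel (cball (0::'a) (real n))"
        by (intro emeasure_mono) (auto simp: E_def)
      then show ?thesis using emeasure_lborel_cball_finite[of "0::'a" "real n"] by (simp add: le_less_trans less_top)
    qed
    have E0: "emeasure lborel E \<noteq> 0"
    proof
      assume "emeasure lborel E = 0"
      then have "AE x in lborel. x \<notin> E" by (intro AE_not_in) (simp add: null_sets_def)
      with n show False by (simp add: E_def)
    qed
    have Eeq: "emeasure lborel E = ennreal (measure lborel E)"
      using Efin by (intro emeasure_eq_ennreal_measure) auto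
    have "measure lborel E \<noteq> 0"
    proof
      assume "measure lborel E = 0"
      with Eeq have "emeasure lborel E = 0" by (simp only: ennreal_0)
      with E0 show False by contradiction
    qed
    then have mE: "0 < measure lborel E" using measure_nonneg[of lborel E] by linarith
    have EL: "E \<in> sets lebesgue" by simp
    obtain K where K: "closed K" "K \<subseteq> E" "emeasure lebesgue (E - K) < ennreal (measure lborel E)"
      by (rule sets_lebesgue_inner_closed[OF EL mE])
    have [measurable]: "K \<in> sets borel" using K by auto
    have cK: "compact K"
      using K(1,2) by (auto simp: compact_eq_bounded_closed E_def intro!: boundedI[of _ "real n"])
    have Kpos: "0 < measure lborel K"
    proof (rule ccontr)
      assume "\<not> 0 < measure lborel K"
      then have "measure lborel K = 0" using measure_nonneg[of lborel K] by linarith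
      moreover have Kf: "emeasure lborel K < \<infinity>" using Efin emeasure_mono[OF K(2), of lborel] by (simp add: le_less_trans)
      ultimately have "emeasure lborel K = 0" using emeasure_eq_ennreal_measure[of lborel K] by (simp add: less_top)
      then have "emeasure lborel (E - K) = emeasure lborel E" using Kf K(2) by (subst emeasure_Diff) auto
      then show False using K(3) Eeq by simp
    qed
    then have Kne: "K \<noteq> {}" by auto
    have Kf: "emeasure lborel K < \<infinity>" using Efin emeasure_mono[OF K(2), of lborel] by (simp add: le_less_trans)
    have iK: "integrable lborel (indicator K :: 'a \<Rightarrow> real)" using Kf by (simp add: integrable_indicator_iff)
    have ihK: "integrable lborel (\<lambda>x. h x * indicator K x)"
      by (rule Bochner_Integration.integrable_bound[OF h]) (auto simp: norm_mult indicator_def)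
    have irK: "integrable lborel (\<lambda>x. Re (c * h x) * indicator K x)"
    proof -
      have "integrable lborel (\<lambda>x. c * (h x * indicator K x))" using ihK by (rule integrable_mult_right)
      then have "integrable lborel (\<lambda>x. Re (c * (h x * indicator K x)))" by (rule integrable_Re)
      moreover have "Re (c * (h x * indicator K x)) = Re (c * h x) * indicator K x" for x by (simp add: indicator_def)
      ultimately show ?thesis by simp
    qed
    have "(\<integral>x. Re (c * h x) * indicator K x \<partial>lborel) = Re (c * (\<integral>x. h x * indicator K x \<partial>lborel))"
    proof -
      have "Re (c * (\<integral>x. h x * indicator K x \<partial>lborel)) = (\<integral>x. Re (c * (h x * indicator K x)) \<partial>lborel)"
        using ihK by (subst integral_mult_right_zero[symmetric], subst integral_Re) auto
      moreover have "Re (c * (h x * indicator K x)) = Re (c * h x) * indicator K x" for x by (simp add: indicator_def)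
      ultimately show ?thesis by simp
    qed
    also have "\<dots> \<le> norm (c * (\<integral>x. h x * indicator K x \<partial>lborel))" by (rule complex_Re_le_cmod)
    also have "\<dots> \<le> norm c * (M * measure lborel K)"
      unfolding norm_mult M_def by (intro mult_left_mono inversion_compact[OF h fh cK Kne]) auto
    also have "\<dots> = (\<integral>x. (M * norm c) * indicator K x \<partial>lborel)" by simp
    finally have le: "(\<integral>x. Re (c * h x) * indicator K x - (M * norm c) * indicator K x \<partial>lborel) \<le> 0"
      using irK iK by (subst Bochner_Integration.integral_diff) auto
    have nn: "0 \<le> Re (c * h x) * indicator K x - (M * norm c) * indicator K x" for x
      using K(2) by (auto simp: E_def indicator_def)
    then have "(\<integral>x. Re (c * h x) * indicator K x - (M * norm c) * indicator K x \<partial>lborel) = 0"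
      using le by (intro antisym integral_nonneg_AE) auto
    then have "AE x in lborel. Re (c * h x) * indicator K x - (M * norm c) * indicator K x = 0"
      using nn irK iK by (subst (asm) integral_nonneg_eq_0_iff_AE) auto
    then have "AE x in lborel. x \<notin> K"
      by eventually_elim (use K(2) in \<open>auto simp: E_def indicator_def split: if_splits\<close>)
    then have "emeasure lborel K = 0" by (subst (asm) AE_iff_measurable[OF _ refl]) auto
    then show False using Kpos by (simp add: measure_def)
  qed
  have "AE x in lborel. \<forall>c\<in>Q. \<forall>n::nat. \<not> (norm x \<le> real n \<and> M * norm c < Re (c * h x))"
    using Q(1) null by (simp add: AE_ball_countable AE_all_countable del: not_le de_Morgan_conj)
  then have "AE x in lborel. norm (h x) \<le> M"
  proof eventually_elim
    case (elim x)
    show ?case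
    proof (rule ccontr)
      assume "\<not> norm (h x) \<le> M"
      then have gt: "M < norm (h x)" by simp
      define X where "X = {c. M * norm c < Re (c * h x)}"
      have "open X" unfolding X_def by (intro open_Collect_less continuous_intros)
      \<comment> \<open>The conjugate of \<open>h x\<close> is the direction in which the real part
        is largest relative to the modulus.\<close>
      moreover have "cnj (h x) \<in> X"
      proof -
        have "Re (cnj (h x) * h x) = norm (h x) * norm (h x)"
          by (simp add: cmod_def power2_eq_square)
        then show ?thesis using gt M0 by (auto simp: X_def intro!: mult_strict_right_mono)
      qed
      ultimately obtain c where "c \<in> Q" "c \<in> X" using Q(2)[of X] by auto
      moreover obtain n :: nat where "norm x \<le> real n" using real_arch_simple by blast
      ultimately show False using elim by (auto simp: X_def)
    qed
  qed
  then show ?thesis by (simp add: M_def)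
qed


section \<open>Schwartz functions and the embedding of $M^1$\<close>

lemma schwartz_differentiable: "\<phi> \<in> schwartz \<Longrightarrow> vs \<in> lists Basis \<Longrightarrow> partials vs \<phi> differentiable (at x)"
  by (simp add: schwartz_def)

lemma schwartz_decay:
  assumes "\<phi> \<in> schwartz" "vs \<in> lists Basis"
  obtains C where "0 < C" "\<And>x. (1 + norm x) ^ k * norm (partials vs \<phi> x) \<le> C"
proof -
  have "bounded (range (\<lambda>x. (1 + norm x) ^ k *\<^sub>R partials vs \<phi> x))" using assms by (simp add: schwartz_def)
  then obtain C where C: "0 < C" "\<And>x. norm ((1 + norm x) ^ k *\<^sub>R partials vs \<phi> x) \<le> C"
    by (auto simp: bounded_pos)
  show ?thesis
  proof (rule that[OF C(1)])
    show "(1 + norm x) ^ k * norm (partials vs \<phi> x) \<le> C" for x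
      using C(2)[of x] by (simp add: abs_of_nonneg)
  qed
qed

lemma schwartz_partials_continuous:
  assumes "\<phi> \<in> schwartz" "vs \<in> lists Basis"
  shows "continuous_on UNIV (partials vs \<phi>)"
  using schwartz_differentiable[OF assms] differentiable_imp_continuous_within
  by (auto simp: continuous_on_eq_continuous_within)

lemma schwartz_continuous: "\<phi> \<in> schwartz \<Longrightarrow> continuous_on UNIV \<phi>"
  using schwartz_partials_continuous[of \<phi> "[]"] by simp

lemma schwartz_measurable [measurable_dest]: "\<phi> \<in> schwartz \<Longrightarrow> \<phi> \<in> borel_measurable borel"
  by (intro borel_measurable_continuous_onI schwartz_continuous)

lemma partials_shift:
  assumes "\<phi> \<in> schwartz" "vs \<in> lists Basis"
  shows "partials vs (\<lambda>t. \<phi> (t - x)) = (\<lambda>t. partials vs \<phi> (t - x))"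
  using assms(2)
proof (induction vs)
  case (Cons v vs)
  have "frechet_derivative (\<lambda>t. partials vs \<phi> (t - x)) (at y) = frechet_derivative (partials vs \<phi>) (at (y - x))" for y
  proof -
    have "(partials vs \<phi> has_derivative frechet_derivative (partials vs \<phi>) (at (y - x))) (at (y - x))"
      using schwartz_differentiable[OF assms(1), of vs "y - x"] Cons.hyps by (simp add: frechet_derivative_works[symmetric])
    moreover have "((\<lambda>t. t - x) has_derivative (\<lambda>t. t)) (at y)" by (auto intro!: derivative_eq_intros)
    ultimately have "((\<lambda>t. partials vs \<phi> (t - x)) has_derivative frechet_derivative (partials vs \<phi>) (at (y - x))) (at y)"
      using diff_chain_at[of "\<lambda>t. t - x" "\<lambda>t. t" y "partials vs \<phi>"] by (simp add: o_def)
    then show ?thesis by (rule frechet_derivative_at[symmetric])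
  qed
  then show ?case using Cons by simp
qed simp

lemma schwartz_shift:
  assumes \<phi>: "\<phi> \<in> schwartz"
  shows "(\<lambda>t. \<phi> (t - x)) \<in> schwartz"
  unfolding schwartz_def
proof (intro CollectI ballI conjI allI)
  fix vs :: "'a list" and k :: nat assume vs: "vs \<in> lists Basis"
  show "partials vs (\<lambda>t. \<phi> (t - x)) differentiable (at y)" for y
    unfolding partials_shift[OF \<phi> vs]
    by (rule differentiable_compose[of "partials vs \<phi>" "\<lambda>t. t - x"]) (auto intro!: schwartz_differentiable[OF \<phi> vs] derivative_intros)
  obtain C where C: "0 < C" "\<And>y. (1 + norm y) ^ k * norm (partials vs \<phi> y) \<le> C"
    using schwartz_decay[OF \<phi> vs] by blast
  have "norm ((1 + norm t) ^ k *\<^sub>R partials vs (\<lambda>t. \<phi> (t - x)) t) \<le> (1 + norm x) ^ k * C" for t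
  proof -
    \<comment> \<open>Peetre's inequality: translation by x changes the polynomial weight by at most
      a factor depending on x.\<close>
    have "1 + norm t \<le> (1 + norm x) * (1 + norm (t - x))"
    proof -
      have "(1 + norm x) * (1 + norm (t - x)) = 1 + norm x + norm (t - x) + norm x * norm (t - x)"
        by (simp add: algebra_simps)
      moreover have "0 \<le> norm x * norm (t - x)" by simp
      ultimately show ?thesis using norm_triangle_sub[of t x] by linarith
    qed
    then have "(1 + norm t) ^ k \<le> ((1 + norm x) * (1 + norm (t - x))) ^ k" by (intro power_mono) auto
    then have "(1 + norm t) ^ k * norm (partials vs \<phi> (t - x)) \<le> ((1 + norm x) ^ k * (1 + norm (t - x)) ^ k) * norm (partials vs \<phi> (t - x))"
      unfolding power_mult_distrib by (intro mult_right_mono) auto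
    also have "\<dots> \<le> (1 + norm x) ^ k * C" using C(2)[of "t - x"] by (simp add: mult.assoc mult_left_mono)
    finally show ?thesis by (simp add: partials_shift[OF \<phi> vs] abs_of_nonneg)
  qed
  then show "bounded (range (\<lambda>t. (1 + norm t) ^ k *\<^sub>R partials vs (\<lambda>t. \<phi> (t - x)) t))"
    by (auto simp: bounded_iff)
qed

text \<open>Conjugate-linearity of the pairing conjugates the modulation, while \<open>ft\<close>
  carries a positive sign, hence the frequency \<open>- w\<close>.\<close>

lemma stft_L2_pairing: "stft \<gamma> (L2_pairing f) (x, w) = ft (\<lambda>t. f t * cnj (\<gamma> (t - x))) (- w)"
  by (simp add: stft_def L2_pairing_def ft_def cis_cnj mult_ac)

text \<open>Fourier inversion bounds \<open>f * cnj (\<gamma> (\<cdot> - x))\<close> by the \<open>x\<close>-section of the short-time Fourier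
  transform, so that integrating over \<open>x\<close> a neighbourhood of a point where \<open>\<gamma>\<close> does not
  vanish gives both the $L^\infty$ and the $L^1$ bound.\<close>

lemma M1_AE_nice:
  fixes f :: "'a::euclidean_space \<Rightarrow> complex"
  assumes \<gamma>: "\<gamma> \<in> schwartz" "\<gamma> x0 \<noteq> 0" and f: "f \<in> M1 \<gamma>"
  obtains f' where "nice f'" "AE x in lborel. f x = f' x"
proof -
  have [measurable]: "f \<in> borel_measurable borel" using f by (simp add: M1_def)
  have [measurable]: "\<gamma> \<in> borel_measurable borel" using \<gamma>(1) by measurable
  have fint: "integrable lborel (\<lambda>t. f t * cnj (\<gamma> (t - x)))" for x
    using f schwartz_shift[OF \<gamma>(1), of x] by (simp add: M1_def)
  define V where "V = stft \<gamma> (L2_pairing f)"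
  have "V \<in> Lp_space 1" using f by (simp add: M1_def modulation_space_def V_def)
  then have [measurable]: "V \<in> borel_measurable borel" and nV: "integrable lborel (\<lambda>z. norm (V z))"
    by (measurable, simp add: Lp_space_def)
  define v where "v x = (\<integral>w. norm (V (x, w)) \<partial>lborel)" for x
  have v: "integrable lborel v" unfolding v_def by (rule integral_lborel_pair(3)[OF nV])
  have v0: "0 \<le> v x" for x unfolding v_def by (rule integral_nonneg_AE) simp
  have [measurable]: "v \<in> borel_measurable borel" using v by auto
  define N where "N = (\<integral>x. v x \<partial>lborel)"
  have nnv: "(\<integral>\<^sup>+x. ennreal (v x) \<partial>lborel) = ennreal N"
    unfolding N_def by (rule nn_integral_eq_integral[OF v]) (simp add: v0)
  have N0: "0 \<le> N" unfolding N_def by (rule integral_nonneg_AE) (simp add: v0)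
  define c where "c = norm (\<gamma> x0) / 2"
  have c: "0 < c" using \<gamma>(2) by (simp add: c_def)
  have "isCont (\<lambda>x. norm (\<gamma> x)) x0"
    using schwartz_continuous[OF \<gamma>(1)] by (simp add: continuous_on_eq_continuous_at)
  then have "\<forall>\<^sub>F x in at x0. c < norm (\<gamma> x)"
    using \<gamma>(2) by (intro order_tendstoD(1)[of _ "norm (\<gamma> x0)"]) (auto simp: isCont_def c_def)
  then obtain r where r: "0 < r" "\<And>x. x \<noteq> x0 \<Longrightarrow> dist x x0 < r \<Longrightarrow> c < norm (\<gamma> x)"
    by (auto simp: eventually_at)
  define B where "B = ball x0 r"
  have \<gamma>B: "c \<le> norm (\<gamma> x)" if "x \<in> B" for x
    using that r(2)[of x] by (cases "x = x0") (auto simp: B_def c_def dist_commute less_imp_le)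
  have [measurable]: "B \<in> sets borel" by (simp add: B_def)
  define b where "b = measure lborel B"
  have Bfin: "emeasure lborel B < \<infinity>" unfolding B_def using emeasure_lborel_ball_finite by (simp add: less_top)
  have eB: "emeasure lborel B = ennreal b" unfolding b_def using Bfin by (intro emeasure_eq_ennreal_measure) auto
  have b: "0 < b"
  proof -
    have "emeasure lborel B \<noteq> 0"
    proof
      assume "emeasure lborel B = 0"
      then have "negligible B" by (auto simp: negligible_iff_null_sets null_sets_def emeasure_completion)
      then show False using open_not_negligible[of B] r(1) by (auto simp: B_def)
    qed
    then have "b \<noteq> 0" using eB by auto
    then show ?thesis unfolding b_def using measure_nonneg[of lborel B] by linarith
  qed
  \<comment> \<open>Inversion together with the lower bound for the window on \<open>B\<close> gives
    this for almost every pair, and it is read in both orders: for fixed t, integrating over x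
    bounds |f t|; for fixed x, integrating over t and then over x bounds the L1 norm.\<close>
  define P where "P z \<longleftrightarrow> (snd z - fst z \<in> B \<longrightarrow> c * norm (f (snd z)) \<le> v (fst z))" for z
  have "AE x in lborel. integrable lborel (\<lambda>w. norm (V (x, w)))"
    by (rule integral_lborel_pair(5)[OF nV])
  then have PAE: "AE x in lborel. AE t in lborel. P (x, t)"
  proof eventually_elim
    case (elim x)
    let ?h = "\<lambda>t. f t * cnj (\<gamma> (t - x))"
    have [measurable]: "ft ?h \<in> borel_measurable borel" by (rule ft_measurable) measurable
    have V: "V (x, w) = ft ?h (0 - w)" for w by (simp add: V_def stft_L2_pairing)
    have "integrable lborel (\<lambda>w. norm (ft ?h (0 - w)))" using elim by (simp only: V)
    then have "integrable lborel (\<lambda>w. norm (ft ?h w))"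
      using affine_scaling_integral(1)[OF affine_scaling_reflect, of "\<lambda>w. norm (ft ?h w)" 0] by simp
    then have fi: "integrable lborel (ft ?h)" by (subst (asm) integrable_norm_iff) auto
    have "(\<integral>w. norm (ft ?h w) \<partial>lborel) = v x"
      unfolding v_def V
      using affine_scaling_integral(2)[OF affine_scaling_reflect, of "\<lambda>w. norm (ft ?h w)" 0] by simp
    then have "AE t in lborel. norm (?h t) \<le> v x" using inversion_bound[OF fint fi] by simp
    then show ?case
    proof eventually_elim
      case (elim t)
      have "c * norm (f t) \<le> norm (f t) * norm (\<gamma> (t - x))" if "t - x \<in> B"
        using mult_left_mono[OF \<gamma>B[OF that], of "norm (f t)"] by (simp add: mult.commute)
      then show ?case using elim by (auto simp: P_def norm_mult intro: order_trans)
    qed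
  qed
  have ind1: "(\<integral>\<^sup>+x. indicator B (t - x) \<partial>lborel) = ennreal b" for t
    using nn_integral_lborel_reflect[of "indicator B" t] by (simp add: eB)
  have ind2: "(\<integral>\<^sup>+t. indicator B (t - x) \<partial>lborel) = ennreal b" for x
    using nn_integral_lborel_shift[of "indicator B" "- x"] by (simp add: eB)
  \<comment> \<open>Exchanging the two almost everywhere quantifiers requires this set to be
    measurable in the product space.\<close>
  have "{z \<in> space (lborel \<Otimes>\<^sub>M lborel). (\<lambda>x t. P (x, t)) (fst z) (snd z)} \<in> sets (lborel \<Otimes>\<^sub>M lborel)"
    unfolding lborel_prod P_def by simp
  then have "AE t in lborel. AE x in lborel. P (x, t)"
    using PAE lborel_pair.AE_commute[of "\<lambda>x t. P (x, t)"] by (simp add: split_def)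
  then have bound: "AE t in lborel. norm (f t) \<le> N / (c * b)"
  proof eventually_elim
    case (elim t)
    have "ennreal (c * norm (f t) * b) = (\<integral>\<^sup>+x. ennreal (c * norm (f t)) * indicator B (t - x) \<partial>lborel)"
      using c b by (simp add: nn_integral_cmult ind1 ennreal_mult)
    also have "\<dots> \<le> (\<integral>\<^sup>+x. ennreal (v x) \<partial>lborel)"
      by (rule nn_integral_mono_AE, use elim in eventually_elim) (auto simp: P_def indicator_def intro: ennreal_leI)
    finally have "c * norm (f t) * b \<le> N" unfolding nnv using N0 by simp
    then show ?case using c b by (simp add: field_simps)
  qed
  have "ennreal (c * b) * (\<integral>\<^sup>+t. ennreal (norm (f t)) \<partial>lborel) = (\<integral>\<^sup>+t. \<integral>\<^sup>+x. ennreal (c * norm (f t)) * indicator B (t - x) \<partial>lborel \<partial>lborel)"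
  proof -
    have "(\<integral>\<^sup>+x. ennreal (c * norm (f t)) * indicator B (t - x) \<partial>lborel) = ennreal (c * b) * ennreal (norm (f t))" for t
    proof -
      have "(\<integral>\<^sup>+x. ennreal (c * norm (f t)) * indicator B (t - x) \<partial>lborel) = ennreal (c * norm (f t)) * ennreal b"
        by (simp add: nn_integral_cmult ind1)
      also have "\<dots> = ennreal (c * b) * ennreal (norm (f t))"
        using c b by (simp add: ennreal_mult[symmetric] mult_ac)
      finally show ?thesis .
    qed
    then show ?thesis by (simp add: nn_integral_cmult)
  qed
  also have "\<dots> = (\<integral>\<^sup>+x. \<integral>\<^sup>+t. ennreal (c * norm (f t)) * indicator B (t - x) \<partial>lborel \<partial>lborel)"
    using nn_integral_lborel_pair(1,2)[of "\<lambda>z. ennreal (c * norm (f (fst z))) * indicator B (fst z - snd z)"] by simp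
  also have "\<dots> \<le> (\<integral>\<^sup>+x. ennreal (v x) * ennreal b \<partial>lborel)"
  proof (rule nn_integral_mono_AE, use PAE in eventually_elim)
    fix x assume "AE t in lborel. P (x, t)"
    then have "(\<integral>\<^sup>+t. ennreal (c * norm (f t)) * indicator B (t - x) \<partial>lborel) \<le> (\<integral>\<^sup>+t. ennreal (v x) * indicator B (t - x) \<partial>lborel)"
      by (intro nn_integral_mono_AE, elim eventually_mono) (auto simp: P_def indicator_def intro: ennreal_leI)
    also have "\<dots> = ennreal (v x) * ennreal b" by (simp add: nn_integral_cmult ind2)
    finally show "(\<integral>\<^sup>+t. ennreal (c * norm (f t)) * indicator B (t - x) \<partial>lborel) \<le> ennreal (v x) * ennreal b" .
  qed
  also have "\<dots> = ennreal N * ennreal b" by (simp add: nn_integral_multc nnv)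
  also have "\<dots> < \<infinity>" by (simp add: ennreal_mult_less_top)
  finally have "(\<integral>\<^sup>+t. ennreal (norm (f t)) \<partial>lborel) < \<infinity>"
    using c b by (auto simp: ennreal_mult_less_top)
  then have fi: "integrable lborel f" by (intro integrableI_bounded) auto
  define f' where "f' t = (if norm (f t) \<le> N / (c * b) then f t else 0)" for t
  have ae: "AE t in lborel. f t = f' t" using bound by eventually_elim (simp add: f'_def)
  have "nice f'"
    unfolding nice_def
  proof
    show "integrable lborel f'"
      by (rule Bochner_Integration.integrable_bound[OF fi]) (auto simp: f'_def[abs_def])
    show "\<exists>C. \<forall>t. norm (f' t) \<le> C"
      using N0 c b by (intro exI[of _ "N / (c * b)"]) (auto simp: f'_def)
  qed
  then show ?thesis using ae that by blast
qed

section \<open>Polynomial decay and Gaussians in $M^1$\<close>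

definition decay :: "nat \<Rightarrow> 'a::real_normed_vector \<Rightarrow> real" where
  "decay k x = 1 / (1 + norm x) ^ k"

lemma decay_pos [simp]: "0 < decay k x" and decay_nonneg [simp]: "0 \<le> decay k x"
  and decay_le_1 [simp]: "decay k x \<le> 1"
proof -
  have p: "0 < 1 + norm x" using norm_ge_zero[of x] by linarith
  then show "0 < decay k x" "0 \<le> decay k x" by (auto simp: decay_def)
  show "decay k x \<le> 1" using p one_le_power[of "1 + norm x" k] by (simp add: decay_def divide_le_eq)
qed

lemma decay_measurable [measurable]: "decay k \<in> borel_measurable borel"
  unfolding decay_def[abs_def] by measurable

text \<open>Peetre's inequality for the weight. Dividing by \<open>decay k y\<close> costs
  polynomial growth in y, which a Gaussian in y can afford.\<close>

lemma decay_submult: "decay k (x - y) \<le> decay k x / decay k y"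
proof -
  have p: "0 < 1 + norm x" "0 < 1 + norm y" "0 < 1 + norm (x - y)"
    using norm_ge_zero[of x] norm_ge_zero[of y] norm_ge_zero[of "x - y"] by linarith+
  have "1 + norm x \<le> (1 + norm y) * (1 + norm (x - y))"
  proof -
    have "(1 + norm y) * (1 + norm (x - y)) = 1 + norm y + norm (x - y) + norm y * norm (x - y)"
      by (simp add: algebra_simps)
    moreover have "0 \<le> norm y * norm (x - y)" by simp
    ultimately show ?thesis using norm_triangle_sub[of x y] by linarith
  qed
  then have "(1 + norm x) ^ k \<le> (1 + norm y) ^ k * (1 + norm (x - y)) ^ k"
    using p unfolding power_mult_distrib[symmetric] by (intro power_mono) auto
  then show ?thesis using p by (simp add: decay_def field_simps)
qed

text \<open>Each factor 1 + (x \<bullet> b)^2 is at most (1 + |x|)^2, so the weight is dominated by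
  a product of one-dimensional functions 1 / (1 + t^2); this explains twice the dimension as
  exponent.\<close>

lemma decay_integrable: "integrable lborel (decay (2 * DIM('a)) :: 'a::euclidean_space \<Rightarrow> real)"
proof (rule integrableI_bounded)
  have "integrable lborel (\<lambda>x::real. inverse (1 + x\<^sup>2))"
    using integrable_inverse_1_plus_square by (simp add: set_integrable_def)
  then have fin: "(\<integral>\<^sup>+x. ennreal (inverse (1 + (x::real)\<^sup>2)) \<partial>lborel) < \<infinity>"
    by (subst nn_integral_eq_integral) auto
  have "(\<integral>\<^sup>+x. ennreal (norm (decay (2 * DIM('a)) (x::'a))) \<partial>lborel)
     \<le> (\<integral>\<^sup>+x. (\<Prod>b\<in>(Basis::'a set). ennreal (inverse (1 + (x \<bullet> b)\<^sup>2))) \<partial>lborel)"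
  proof (rule nn_integral_mono)
    fix x :: 'a
    have "(\<Prod>b\<in>Basis. 1 + (x \<bullet> b)\<^sup>2) \<le> (\<Prod>b\<in>(Basis::'a set). (1 + norm x)\<^sup>2)"
    proof (rule prod_mono)
      fix b :: 'a assume "b \<in> Basis"
      then have "\<bar>x \<bullet> b\<bar> \<le> norm x" by (rule Basis_le_norm)
      then have "(x \<bullet> b)\<^sup>2 \<le> (norm x)\<^sup>2" by (metis abs_le_square_iff abs_norm_cancel)
      moreover have "(1 + norm x)\<^sup>2 = 1 + 2 * norm x + (norm x)\<^sup>2" by (simp add: power2_sum)
      ultimately show "0 \<le> 1 + (x \<bullet> b)\<^sup>2 \<and> 1 + (x \<bullet> b)\<^sup>2 \<le> (1 + norm x)\<^sup>2"
        using norm_ge_zero[of x] zero_le_power2[of "x \<bullet> b"] by linarith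
    qed
    also have "\<dots> = (1 + norm x) ^ (2 * DIM('a))" by (simp add: power_mult[symmetric])
    finally have le: "(\<Prod>b\<in>Basis. 1 + (x \<bullet> b)\<^sup>2) \<le> (1 + norm x) ^ (2 * DIM('a))" .
    have "0 < (\<Prod>b\<in>Basis. 1 + (x \<bullet> b)\<^sup>2)" by (intro prod_pos) (auto simp: add_pos_nonneg)
    then have "decay (2 * DIM('a)) x \<le> 1 / (\<Prod>b\<in>Basis. 1 + (x \<bullet> b)\<^sup>2)"
      unfolding decay_def using le by (intro divide_left_mono) (auto simp: zero_less_mult_iff)
    also have "\<dots> = (\<Prod>b\<in>Basis. inverse (1 + (x \<bullet> b)\<^sup>2))" using prod_inversef[of "\<lambda>b. 1 + (x \<bullet> b)\<^sup>2" "Basis :: 'a set"]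
      by (simp add: o_def inverse_eq_divide)
    finally show "ennreal (norm (decay (2 * DIM('a)) x)) \<le> (\<Prod>b\<in>Basis. ennreal (inverse (1 + (x \<bullet> b)\<^sup>2)))"
      by (subst prod_ennreal) (auto intro: ennreal_leI)
  qed
  also have "\<dots> = (\<Prod>b\<in>(Basis::'a set). (\<integral>\<^sup>+x. ennreal (inverse (1 + x\<^sup>2)) \<partial>lborel))"
    by (rule nn_integral_lborel_prod) auto
  also have "\<dots> < \<infinity>" using fin by (simp add: power_less_top_ennreal)
  finally show "(\<integral>\<^sup>+x. ennreal (norm (decay (2 * DIM('a)) (x::'a))) \<partial>lborel) < \<infinity>" .
qed simp

lemma gauss_decay:
  assumes c: "0 < c"
  obtains C where "0 < C" "\<And>x::'a::euclidean_space. gauss c x \<le> C * decay k x"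
proof -
  define a where "a = pi * c\<^sup>2"
  have a: "0 < a" using c by (simp add: a_def)
  \<comment> \<open>The exponential series gives (1 + r)^k \<le> k! exp (1 + r), and completing the
    square gives r - a r^2 \<le> 1/(4a).\<close>
  define C where "C = fact k * exp (1 + 1 / (4 * a))"
  show ?thesis
  proof (rule that[of C])
    show "0 < C" by (simp add: C_def)
    fix x :: 'a
    let ?r = "norm x"
    have p: "0 < 1 + ?r" using norm_ge_zero[of x] by linarith
    have "(1 + ?r) ^ k / fact k \<le> exp (1 + ?r)"
    proof -
      have "(\<lambda>n. (1 + ?r) ^ n /\<^sub>R fact n) sums exp (1 + ?r)" by (rule exp_converges)
      then have "sum (\<lambda>n. (1 + ?r) ^ n /\<^sub>R fact n) {k} \<le> exp (1 + ?r)"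
        using p by (intro sum_le_suminf[THEN order_trans]) (auto simp: sums_iff)
      then show ?thesis by (simp add: divide_inverse mult.commute)
    qed
    then have "(1 + ?r) ^ k \<le> fact k * exp (1 + ?r)" by (simp add: field_simps)
    then have "(1 + ?r) ^ k * gauss c x \<le> fact k * exp (1 + ?r) * exp (- (a * ?r\<^sup>2))"
      by (simp add: gauss_def a_def mult_right_mono)
    also have "\<dots> = fact k * exp (1 + ?r - a * ?r\<^sup>2)" by (simp add: exp_diff exp_minus field_simps)
    also have "\<dots> \<le> C"
    proof -
      have "0 \<le> (2 * a * ?r - 1)\<^sup>2 / (4 * a)" using a by simp
      also have "\<dots> = a * ?r\<^sup>2 - ?r + 1 / (4 * a)" using a by (simp add: power2_eq_square field_simps)
      finally have "1 + ?r - a * ?r\<^sup>2 \<le> 1 + 1 / (4 * a)" by simp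
      then show ?thesis unfolding C_def by (intro mult_left_mono) auto
    qed
    finally show "gauss c x \<le> C * decay k x" using p by (simp add: decay_def field_simps)
  qed
qed

text \<open>By the fundamental theorem on unit segments, averaging Q' over y + s v with s in [0, 1]
  yields Q (y + v) - Q y, whose integral over y is 0 by translation invariance; Fubini identifies it
  with the integral of Q'. Integrability of \<open>Q\<close> replaces any argument about boundary
  terms.\<close>

lemma integral_directional_derivative:
  fixes Q Q' :: "'a::euclidean_space \<Rightarrow> complex"
  assumes Q: "integrable lborel Q" and Q': "integrable lborel Q'" "continuous_on UNIV Q'"
    and der: "\<And>y s. ((\<lambda>s. Q (y + s *\<^sub>R v)) has_vector_derivative Q' (y + s *\<^sub>R v)) (at s)"
  shows "(\<integral>y. Q' y \<partial>lborel) = 0"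
proof -
  have [measurable]: "Q \<in> borel_measurable borel" "Q' \<in> borel_measurable borel" using Q Q' by auto
  have ftc: "(\<integral>s. indicator {0..1} s *\<^sub>R Q' (y + s *\<^sub>R v) \<partial>lborel) = Q (y + v) - Q y" for y
  proof -
    have "(\<integral>s. indicator {0..1} s *\<^sub>R Q' (y + s *\<^sub>R v) \<partial>lborel) = Q (y + 1 *\<^sub>R v) - Q (y + 0 *\<^sub>R v)"
      by (rule integral_FTC_atLeastAtMost)
        (auto intro!: has_vector_derivative_at_within[OF der] continuous_on_compose2[OF Q'(2)] continuous_intros)
    then show ?thesis by simp
  qed
  define F where "F z = indicator {0..1::real} (snd z) *\<^sub>R Q' (fst z + snd z *\<^sub>R v)" for z :: "'a \<times> real"
  have [measurable]: "F \<in> borel_measurable borel" unfolding F_def[abs_def] by measurable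
  have int: "integrable lborel F"
  proof (rule integrableI_bounded)
    have "(\<integral>\<^sup>+z. ennreal (norm (F z)) \<partial>lborel) = (\<integral>\<^sup>+s. \<integral>\<^sup>+y. ennreal (norm (F (y, s))) \<partial>lborel \<partial>lborel)"
      by (rule nn_integral_lborel_pair(2)) simp
    also have "\<dots> = (\<integral>\<^sup>+s. indicator {0..1::real} s * (\<integral>\<^sup>+y. ennreal (norm (Q' y)) \<partial>lborel) \<partial>lborel)"
    proof (rule nn_integral_cong)
      fix s :: real
      have "(\<integral>\<^sup>+y. ennreal (norm (F (y, s))) \<partial>lborel) = (\<integral>\<^sup>+y. indicator {0..1::real} s * ennreal (norm (Q' (s *\<^sub>R v + y))) \<partial>lborel)"
        by (intro nn_integral_cong) (auto simp: F_def indicator_def add.commute)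
      also have "\<dots> = indicator {0..1} s * (\<integral>\<^sup>+y. ennreal (norm (Q' y)) \<partial>lborel)"
        using nn_integral_lborel_shift[of "\<lambda>y. ennreal (norm (Q' y))" "s *\<^sub>R v"] by (simp add: nn_integral_cmult)
      finally show "(\<integral>\<^sup>+y. ennreal (norm (F (y, s))) \<partial>lborel) = indicator {0..1} s * (\<integral>\<^sup>+y. ennreal (norm (Q' y)) \<partial>lborel)" .
    qed
    also have "\<dots> = (\<integral>\<^sup>+y. ennreal (norm (Q' y)) \<partial>lborel)" by (simp add: nn_integral_multc)
    also have "\<dots> < \<infinity>" using Q'(1) by (simp add: integrable_iff_bounded)
    finally show "(\<integral>\<^sup>+z. ennreal (norm (F z)) \<partial>lborel) < \<infinity>" .
  qed simp
  have sh: "integrable lborel (\<lambda>y. Q (y + v))" "(\<integral>y. Q (y + v) \<partial>lborel) = (\<integral>y. Q y \<partial>lborel)"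
    using affine_scaling_integral[OF affine_scaling_shift, of Q v] Q by auto
  have "(\<integral>z. F z \<partial>lborel) = (\<integral>y. Q (y + v) - Q y \<partial>lborel)"
    unfolding integral_lborel_pair(1)[OF int] by (simp add: F_def ftc)
  also have "\<dots> = 0" using sh Q by simp
  finally have "0 = (\<integral>s. \<integral>y. F (y, s) \<partial>lborel \<partial>lborel)" using integral_lborel_pair(2)[OF int] by simp
  also have "\<dots> = (\<integral>s. indicator {0..1::real} s *\<^sub>R (\<integral>y. Q' y \<partial>lborel) \<partial>lborel)"
  proof (rule Bochner_Integration.integral_cong[OF refl])
    fix s :: real
    have "(\<integral>y. F (y, s) \<partial>lborel) = indicator {0..1} s *\<^sub>R (\<integral>y. Q' (y + s *\<^sub>R v) \<partial>lborel)"
      unfolding F_def by simp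
    also have "(\<integral>y. Q' (y + s *\<^sub>R v) \<partial>lborel) = (\<integral>y. Q' y \<partial>lborel)"
      using affine_scaling_integral(2)[OF affine_scaling_shift, of Q' "s *\<^sub>R v"] by simp
    finally show "(\<integral>y. F (y, s) \<partial>lborel) = indicator {0..1} s *\<^sub>R (\<integral>y. Q' y \<partial>lborel)" .
  qed
  also have "\<dots> = (\<integral>y. Q' y \<partial>lborel)" by simp
  finally show ?thesis by simp
qed

section \<open>Fourier decay of Schwartz functions\<close>

lemma schwartz_decay_bound:
  fixes \<phi> :: "'a::euclidean_space \<Rightarrow> complex"
  assumes "\<phi> \<in> schwartz" "vs \<in> lists Basis"
  obtains C where "0 < C" "\<And>x. norm (partials vs \<phi> x) \<le> C * decay k x"
proof -
  obtain C where C: "0 < C" "\<And>x. (1 + norm x) ^ k * norm (partials vs \<phi> x) \<le> C"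
    using schwartz_decay[OF assms] by blast
  show ?thesis
  proof (rule that[OF C(1)])
    fix x :: 'a
    have "0 < 1 + norm x" using norm_ge_zero[of x] by linarith
    then show "norm (partials vs \<phi> x) \<le> C * decay k x" using C(2)[of x] by (simp add: decay_def field_simps)
  qed
qed

lemma schwartz_partials_integrable:
  fixes \<phi> :: "'a::euclidean_space \<Rightarrow> complex"
  assumes "\<phi> \<in> schwartz" "vs \<in> lists Basis"
  shows "integrable lborel (partials vs \<phi>)"
proof -
  obtain C where C: "0 < C" "\<And>x. norm (partials vs \<phi> x) \<le> C * decay (2 * DIM('a)) x"
    using schwartz_decay_bound[OF assms, of "2 * DIM('a)"] by blast
  have i: "integrable lborel (\<lambda>x::'a. C * decay (2 * DIM('a)) x)" using decay_integrable[where 'a='a] by simp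
  have [measurable]: "partials vs \<phi> \<in> borel_measurable borel"
    by (rule borel_measurable_continuous_onI[OF schwartz_partials_continuous[OF assms]])
  show ?thesis
    by (rule Bochner_Integration.integrable_bound[OF i]) (use C in \<open>auto intro!: AE_I2 simp: abs_mult\<close>)
qed

text \<open>Integration by parts: the directional derivative of the character times the partial
  derivative integrates to zero, and its product rule has the two transforms as terms.\<close>

lemma ft_partials:
  fixes \<phi> :: "'a::euclidean_space \<Rightarrow> complex"
  assumes \<phi>: "\<phi> \<in> schwartz" and v: "v \<in> Basis" and vs: "vs \<in> lists Basis"
  shows "ft (partials (v # vs) \<phi>) w = - (2 * pi * (w \<bullet> v)) * \<i> * ft (partials vs \<phi>) w"
proof -
  define P where "P = partials vs \<phi>"
  define P' where "P' = partials (v # vs) \<phi>"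
  have vvs: "v # vs \<in> lists Basis" using v vs by simp
  have P'_eq: "P' = (\<lambda>y. frechet_derivative P (at y) v)" by (simp add: P'_def P_def)
  have iP: "integrable lborel P" "integrable lborel P'"
    unfolding P_def P'_def by (rule schwartz_partials_integrable[OF \<phi>], fact)+
  have cP: "continuous_on UNIV P" "continuous_on UNIV P'"
    unfolding P_def P'_def by (rule schwartz_partials_continuous[OF \<phi>], fact)+
  define e where "e y = cis (2 * pi * (w \<bullet> y))" for y
  define Q where "Q y = e y * P y" for y
  define Q' where "Q' y = e y * P' y + (2 * pi * (w \<bullet> v)) * \<i> * (e y * P y)" for y
  have ce: "continuous_on UNIV e"
    unfolding e_def cis_conv_exp by (intro continuous_intros)
  have ie: "integrable lborel (\<lambda>y. e y * P y)" "integrable lborel (\<lambda>y. e y * P' y)"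
    unfolding e_def using integrable_cis_mult iP by blast+
  have "(\<integral>y. Q' y \<partial>lborel) = 0"
  proof (rule integral_directional_derivative[of Q Q' v])
    show "integrable lborel Q" unfolding Q_def by (rule ie)
    show "integrable lborel Q'" unfolding Q'_def using ie by simp
    show "continuous_on UNIV Q'" unfolding Q'_def using ce cP by (intro continuous_intros)
    fix y :: 'a and s :: real
    have "(P has_derivative frechet_derivative P (at (y + s *\<^sub>R v))) (at (y + s *\<^sub>R v))"
      using schwartz_differentiable[OF \<phi> vs] by (simp add: P_def frechet_derivative_works[symmetric])
    moreover have "((\<lambda>s. y + s *\<^sub>R v) has_derivative (\<lambda>s. s *\<^sub>R v)) (at s)"
      by (auto intro!: derivative_eq_intros)
    ultimately have "((\<lambda>s. P (y + s *\<^sub>R v)) has_derivative (\<lambda>h. frechet_derivative P (at (y + s *\<^sub>R v)) (h *\<^sub>R v))) (at s)"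
      using diff_chain_at[of "\<lambda>s. y + s *\<^sub>R v" "\<lambda>s. s *\<^sub>R v" s P] by (simp add: o_def)
    moreover have "frechet_derivative P (at (y + s *\<^sub>R v)) (h *\<^sub>R v) = h *\<^sub>R P' (y + s *\<^sub>R v)" for h
    proof -
      have "linear (frechet_derivative P (at (y + s *\<^sub>R v)))"
        using schwartz_differentiable[OF \<phi> vs] by (simp add: P_def linear_frechet_derivative)
      then show ?thesis by (simp add: P'_eq linear_scale)
    qed
    ultimately have dP: "((\<lambda>s. P (y + s *\<^sub>R v)) has_vector_derivative P' (y + s *\<^sub>R v)) (at s)"
      by (simp add: has_vector_derivative_def)
    have de: "((\<lambda>s. e (y + s *\<^sub>R v)) has_vector_derivative (2 * pi * (w \<bullet> v)) * \<i> * e (y + s *\<^sub>R v)) (at s)"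
    proof -
      have "((\<lambda>s. exp (\<i> * of_real (2 * pi * (w \<bullet> y + s * (w \<bullet> v))))) has_vector_derivative
          (2 * pi * (w \<bullet> v)) * \<i> * exp (\<i> * of_real (2 * pi * (w \<bullet> y + s * (w \<bullet> v))))) (at s)"
      proof -
        have "((\<lambda>z. exp (\<i> * (2 * of_real pi * (of_real (w \<bullet> y) + z * of_real (w \<bullet> v))))) has_field_derivative
          (2 * pi * (w \<bullet> v)) * \<i> * exp (\<i> * (2 * of_real pi * (of_real (w \<bullet> y) + of_real s * of_real (w \<bullet> v))))) (at (of_real s))"
          by (auto intro!: derivative_eq_intros)
        from has_vector_derivative_real_field[OF this] show ?thesis by simp
      qed
      then show ?thesis by (simp add: e_def cis_conv_exp inner_add_right)
    qed
    have "((\<lambda>s. e (y + s *\<^sub>R v) * P (y + s *\<^sub>R v)) has_vector_derivative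
        e (y + s *\<^sub>R v) * P' (y + s *\<^sub>R v) + ((2 * pi * (w \<bullet> v)) * \<i> * e (y + s *\<^sub>R v)) * P (y + s *\<^sub>R v)) (at s)"
      by (rule has_vector_derivative_mult[OF de dP])
    then show "((\<lambda>s. Q (y + s *\<^sub>R v)) has_vector_derivative Q' (y + s *\<^sub>R v)) (at s)"
      by (simp add: Q_def Q'_def mult.assoc)
  qed
  moreover have "(\<integral>y. Q' y \<partial>lborel) = ft P' w + (2 * pi * (w \<bullet> v)) * \<i> * ft P w"
    unfolding Q'_def using ie by (simp add: ft_def e_def)
  ultimately show ?thesis unfolding P_def[symmetric] P'_def[symmetric] by (simp add: add_eq_0_iff2)
qed

text \<open>Differentiating k times in one coordinate direction multiplies the transform by the k-th
  power of that frequency coordinate; the direction is chosen as the one in which w is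
  largest.\<close>

lemma schwartz_ft_decay:
  fixes \<phi> :: "'a::euclidean_space \<Rightarrow> complex"
  assumes \<phi>: "\<phi> \<in> schwartz"
  obtains C where "0 < C" "\<And>w. norm (ft \<phi> w) \<le> C * decay k w"
proof -
  define I where "I vs = (\<integral>x. norm (partials vs \<phi> x) \<partial>lborel)" for vs
  have I0: "0 \<le> I vs" for vs unfolding I_def by (rule integral_nonneg_AE) simp
  have pw: "norm (ft (partials (replicate n v) \<phi>) w) = (2 * pi * \<bar>w \<bullet> v\<bar>) ^ n * norm (ft \<phi> w)"
    if v: "v \<in> Basis" for n v w
  proof (induction n)
    case (Suc n)
    have "replicate n v \<in> lists Basis" using v by (auto simp: in_lists_conv_set)
    from ft_partials[OF \<phi> v this, of w] Suc show ?case
      by (simp add: norm_mult abs_mult)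
  qed simp
  have b: "\<bar>w \<bullet> v\<bar> ^ k * norm (ft \<phi> w) \<le> I (replicate k v)" if v: "v \<in> Basis" for v w
  proof -
    have "\<bar>w \<bullet> v\<bar> ^ k \<le> (2 * pi * \<bar>w \<bullet> v\<bar>) ^ k"
    proof (rule power_mono)
      have "1 * \<bar>w \<bullet> v\<bar> \<le> (2 * pi) * \<bar>w \<bullet> v\<bar>" using pi_gt3 by (intro mult_right_mono) auto
      then show "\<bar>w \<bullet> v\<bar> \<le> 2 * pi * \<bar>w \<bullet> v\<bar>" by simp
    qed simp
    then have "\<bar>w \<bullet> v\<bar> ^ k * norm (ft \<phi> w) \<le> norm (ft (partials (replicate k v) \<phi>) w)"
      unfolding pw[OF v] by (rule mult_right_mono) simp
    also have "\<dots> \<le> I (replicate k v)"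
      unfolding I_def by (rule ft_bound[OF schwartz_partials_integrable[OF \<phi>]]) (use v in \<open>auto simp: in_lists_conv_set\<close>)
    finally show ?thesis .
  qed
  \<comment> \<open>2^k comes from (1 + r)^k \<le> 2^k (1 + r^k), and the power of the dimension
    from bounding |w| by the dimension times its largest coordinate. The sum runs over all
    directions because the largest one varies with w.\<close>
  define C where "C = 2 ^ k * (I [] + real DIM('a) ^ k * (\<Sum>v\<in>(Basis::'a set). I (replicate k v))) + 1"
  show ?thesis
  proof (rule that[of C])
    show "0 < C" unfolding C_def using I0
      by (intro add_nonneg_pos mult_nonneg_nonneg add_nonneg_nonneg sum_nonneg) auto
    fix w :: 'a
    have p: "0 < 1 + norm w" using norm_ge_zero[of w] by linarith
    have f0: "norm (ft \<phi> w) \<le> I []" using ft_bound[OF schwartz_partials_integrable[OF \<phi>, of "[]"], of w] by (simp add: I_def)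
    have nw: "norm w ^ k * norm (ft \<phi> w) \<le> real DIM('a) ^ k * (\<Sum>v\<in>(Basis::'a set). I (replicate k v))"
    proof -
      define m where "m = Max ((\<lambda>v. \<bar>w \<bullet> v\<bar>) ` Basis)"
      have mB: "\<bar>w \<bullet> v\<bar> \<le> m" if "v \<in> Basis" for v unfolding m_def using that by (intro Max_ge) auto
      have "m \<in> (\<lambda>v. \<bar>w \<bullet> v\<bar>) ` Basis" unfolding m_def by (intro Max_in) auto
      then obtain u where u: "u \<in> Basis" "m = \<bar>w \<bullet> u\<bar>" by auto
      have "norm w \<le> (\<Sum>v\<in>Basis. \<bar>w \<bullet> v\<bar>)" by (rule norm_le_l1)
      also have "\<dots> \<le> real DIM('a) * m" using sum_bounded_above[of Basis "\<lambda>v. \<bar>w \<bullet> v\<bar>" m] mB by simp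
      finally have "norm w ^ k \<le> (real DIM('a) * m) ^ k" by (intro power_mono) auto
      then have "norm w ^ k * norm (ft \<phi> w) \<le> real DIM('a) ^ k * (m ^ k * norm (ft \<phi> w))"
        by (simp add: power_mult_distrib mult.assoc[symmetric] mult_right_mono)
      also have "\<dots> \<le> real DIM('a) ^ k * I (replicate k u)"
        using b[OF u(1), of w] by (intro mult_left_mono) (auto simp: u(2))
      also have "\<dots> \<le> real DIM('a) ^ k * (\<Sum>v\<in>(Basis::'a set). I (replicate k v))"
        using u(1) I0 by (intro mult_left_mono member_le_sum) auto
      finally show ?thesis .
    qed
    have "(1 + norm w) ^ k \<le> 2 ^ k * (1 + norm w ^ k)"
    proof (cases "norm w \<le> 1")
      case True
      then have "(1 + norm w) ^ k \<le> 2 ^ k" by (intro power_mono) auto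
      also have "\<dots> \<le> 2 ^ k * (1 + norm w ^ k)" by simp
      finally show ?thesis .
    next
      case False
      then have "(1 + norm w) ^ k \<le> (2 * norm w) ^ k" by (intro power_mono) auto
      also have "\<dots> \<le> 2 ^ k * (1 + norm w ^ k)" by (simp add: power_mult_distrib)
      finally show ?thesis .
    qed
    then have "(1 + norm w) ^ k * norm (ft \<phi> w) \<le> 2 ^ k * (1 + norm w ^ k) * norm (ft \<phi> w)"
      by (rule mult_right_mono) simp
    also have "\<dots> = 2 ^ k * (norm (ft \<phi> w) + norm w ^ k * norm (ft \<phi> w))" by (simp add: algebra_simps)
    also have "\<dots> \<le> C" unfolding C_def using f0 nw
      by (intro order_trans[OF mult_left_mono[OF add_mono[OF f0 nw]]]) auto
    finally show "norm (ft \<phi> w) \<le> C * decay k w" using p by (simp add: decay_def field_simps)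
  qed
qed

section \<open>Gaussians belong to M1\<close>

lemma decay_mult_self: "decay k x * decay k x = decay (2 * k) x"
  by (simp add: decay_def mult_2 power_add)

text \<open>Decay in x is visible from the overlap of the Gaussian with the shifted window. Decay in
  w appears after moving to the frequency side, where the Gaussian averages the rapidly decaying
  transform of the window. Each bound is uniform in the other variable.\<close>

lemma stft_gauss_bounds:
  fixes \<gamma> :: "'a::euclidean_space \<Rightarrow> complex"
  assumes \<gamma>: "\<gamma> \<in> schwartz" and c: "0 < c"
  obtains C where "0 < C" "\<And>x w. norm (ft (\<lambda>t. of_real (gauss c t) * cnj (\<gamma> (t - x))) (- w)) \<le> C * decay k x"
    "\<And>x w. norm (ft (\<lambda>t. of_real (gauss c t) * cnj (\<gamma> (t - x))) (- w)) \<le> C * decay k w"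
proof -
  have [measurable]: "\<gamma> \<in> borel_measurable borel" using \<gamma> by measurable
  define G where "G x t = complex_of_real (gauss c t) * cnj (\<gamma> (t - x))" for x t
  \<comment> \<open>Peetre's inequality leaves the reciprocal weight in the integration variable,
    and Gaussian decay absorbs it. Needed for both the spatial and the frequency width.\<close>
  have gi: "integrable lborel (\<lambda>t::'a. gauss d t / decay k t)" if d: "0 < d" for d
  proof -
    obtain C where C: "0 < C" "\<And>x::'a. gauss d x \<le> C * decay (k + 2 * DIM('a)) x" by (rule gauss_decay[OF d, where k="k + 2 * DIM('a)" and 'a='a]) blast
    have i: "integrable lborel (\<lambda>x::'a. C * decay (2 * DIM('a)) x)" using decay_integrable[where 'a='a] by simp
    show ?thesis
    proof (rule Bochner_Integration.integrable_bound[OF i])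
      have "gauss d t / decay k t \<le> C * decay (2 * DIM('a)) t" for t :: 'a
      proof -
        have "gauss d t / decay k t \<le> C * decay (k + 2 * DIM('a)) t / decay k t"
          by (intro divide_right_mono C) simp
        also have "\<dots> = C * decay (2 * DIM('a)) t"
        proof -
          have "0 < 1 + norm t" using norm_ge_zero[of t] by linarith
          then show ?thesis by (simp add: decay_def power_add)
        qed
        finally show ?thesis .
      qed
      then show "AE t in lborel. norm (gauss d t / decay k t) \<le> norm (C * decay (2 * DIM('a)) (t::'a))" using C(1) by simp
    qed simp
  qed
  obtain C1 where C1: "0 < C1" "\<And>x. norm (partials [] \<gamma> x) \<le> C1 * decay k x"
    using schwartz_decay_bound[OF \<gamma>, of "[]" k] by auto
  obtain C2 where C2: "0 < C2" "\<And>w. norm (ft \<gamma> w) \<le> C2 * decay k w" using schwartz_ft_decay[OF \<gamma>, of k] by blast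
  define J where "J d = (\<integral>t. gauss d t / decay k (t::'a) \<partial>lborel)" for d
  have J0: "0 \<le> J d" for d unfolding J_def by (rule integral_nonneg_AE) simp
  have i\<gamma>: "integrable lborel \<gamma>" using schwartz_partials_integrable[OF \<gamma>, of "[]"] by simp
  have c': "0 < 1 / c" using c by simp
  show ?thesis
  proof (rule that[of "C1 * J c + (1 / c) ^ DIM('a) * (C2 * J (1 / c)) + 1"], goal_cases)
    case 1
    show ?case using C1 C2 J0 c by (intro add_nonneg_pos add_nonneg_nonneg mult_nonneg_nonneg) (auto intro: less_imp_le)
  next
    case (2 x w)
    have "norm (ft (G x) (- w)) \<le> (\<integral>t. norm (cis (2 * pi * (- w \<bullet> t)) * G x t) \<partial>lborel)"
      unfolding ft_def by (rule integral_norm_bound)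
    also have "\<dots> \<le> (\<integral>t. C1 * decay k x * (gauss c (t::'a) / decay k t) \<partial>lborel)"
    proof (rule integral_mono)
      show i: "integrable lborel (\<lambda>t::'a. C1 * decay k x * (gauss c t / decay k t))" by (intro integrable_mult_right gi c)
      show le: "norm (cis (2 * pi * (- w \<bullet> t)) * G x t) \<le> C1 * decay k x * (gauss c t / decay k t)" for t
      proof -
        have "norm (\<gamma> (t - x)) \<le> C1 * decay k (t - x)" using C1(2)[of "t - x"] by simp
        also have "decay k (t - x) = decay k (x - t)" by (simp add: decay_def norm_minus_commute)
        also have "C1 * decay k (x - t) \<le> C1 * (decay k x / decay k t)" using C1(1) by (intro mult_left_mono decay_submult) auto
        finally have "gauss c t * norm (\<gamma> (t - x)) \<le> gauss c t * (C1 * (decay k x / decay k t))" by (intro mult_left_mono) auto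
        then show ?thesis by (simp add: G_def norm_mult mult_ac)
      qed
      show "integrable lborel (\<lambda>t. norm (cis (2 * pi * (- w \<bullet> t)) * G x t))"
      proof (rule Bochner_Integration.integrable_bound[OF i])
        show "AE t in lborel. norm (norm (cis (2 * pi * (- w \<bullet> t)) * G x t)) \<le> norm (C1 * decay k x * (gauss c t / decay k t))"
          unfolding real_norm_def abs_norm_cancel by (intro AE_I2 order_trans[OF le abs_ge_self])
      qed (simp add: G_def)
    qed
    also have "\<dots> = C1 * J c * decay k x" unfolding J_def by (subst integral_mult_right_zero) (simp add: mult_ac)
    also have "\<dots> \<le> (C1 * J c + (1 / c) ^ DIM('a) * (C2 * J (1 / c)) + 1) * decay k x"
      using C2 J0[of "1 / c"] c by (intro mult_right_mono) auto
    finally show ?case by (simp add: G_def[abs_def])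
  next
    case (3 x w)
    define K where "K z = cis (2 * pi * (fst z \<bullet> snd z))" for z :: "'a \<times> 'a"
    have [measurable]: "K \<in> borel_measurable borel" unfolding K_def[abs_def] by measurable
    \<comment> \<open>Writing the Gaussian as a superposition of characters turns multiplication by
      it into an average of frequency shifts of the transform of the window.\<close>
    have gK: "complex_of_real (gauss c t) = of_real ((1 / c) ^ DIM('a)) * (\<integral>\<xi>. K (t, \<xi>) * of_real (gauss (1 / c) \<xi>) \<partial>lborel)" for t
      using gauss_ft(2)[OF c', of t] c by (simp add: K_def inner_commute)
    define u where "u t = cis (2 * pi * (- w \<bullet> t)) * cnj (\<gamma> (t - x))" for t
    have isx: "integrable lborel (\<lambda>t. \<gamma> (t - x))"
      using affine_scaling_integral(1)[OF affine_scaling_diff, of \<gamma> x] i\<gamma> by simp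
    have iu: "integrable lborel u" unfolding u_def by (rule integrable_cis_mult) (use isx in simp)
    have ig: "integrable lborel (\<lambda>\<xi>::'a. complex_of_real (gauss (1 / c) \<xi>))"
      using gauss_integral(1)[OF c', where 'a='a] by simp
    have inner: "norm (\<integral>t. K (t, \<xi>) * u t \<partial>lborel) = norm (ft \<gamma> (w - \<xi>))" for \<xi>
    proof -
      have "(\<integral>t. K (t, \<xi>) * u t \<partial>lborel) = (\<integral>t. cnj (cis (2 * pi * ((w - \<xi>) \<bullet> t)) * \<gamma> (t - x)) \<partial>lborel)"
      proof (rule Bochner_Integration.integral_cong[OF refl])
        fix t
        have "K (t, \<xi>) * cis (2 * pi * (- w \<bullet> t)) = cis (- (2 * pi * ((w - \<xi>) \<bullet> t)))"
          by (simp add: K_def cis_mult inner_diff_left inner_commute[of t \<xi>] algebra_simps)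
        then show "K (t, \<xi>) * u t = cnj (cis (2 * pi * ((w - \<xi>) \<bullet> t)) * \<gamma> (t - x))"
          by (simp add: u_def cis_cnj mult.assoc[symmetric])
      qed
      also have "norm \<dots> = norm (\<integral>t. cis (2 * pi * ((w - \<xi>) \<bullet> t)) * \<gamma> (t - x) \<partial>lborel)"
        by (subst Bochner_Integration.integral_cnj) simp
      also have "(\<integral>t. cis (2 * pi * ((w - \<xi>) \<bullet> t)) * \<gamma> (t - x) \<partial>lborel)
         = (\<integral>t. cis (2 * pi * ((w - \<xi>) \<bullet> (t + x))) * \<gamma> (t + x - x) \<partial>lborel)"
        using affine_scaling_integral(2)[OF affine_scaling_shift, of "\<lambda>t. cis (2 * pi * ((w - \<xi>) \<bullet> t)) * \<gamma> (t - x)" x] by simp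
      also have "\<dots> = (\<integral>t. cis (2 * pi * ((w - \<xi>) \<bullet> x)) * (cis (2 * pi * ((w - \<xi>) \<bullet> t)) * \<gamma> t) \<partial>lborel)"
        by (rule Bochner_Integration.integral_cong[OF refl]) (simp add: inner_add_right cis_mult[symmetric] distrib_left mult_ac)
      also have "norm \<dots> = norm (ft \<gamma> (w - \<xi>))" by (simp add: norm_mult ft_def)
      finally show ?thesis .
    qed
    have "ft (G x) (- w) = (\<integral>t. u t * of_real (gauss c t) \<partial>lborel)"
      unfolding ft_def G_def u_def by (simp add: mult_ac)
    also have "\<dots> = of_real ((1 / c) ^ DIM('a)) * (\<integral>t. u t * (\<integral>\<xi>. K (t, \<xi>) * of_real (gauss (1 / c) \<xi>) \<partial>lborel) \<partial>lborel)"
      unfolding gK by (subst integral_mult_right_zero[symmetric]) (simp only: mult.left_commute)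
    also have "\<dots> = of_real ((1 / c) ^ DIM('a)) * (\<integral>\<xi>. of_real (gauss (1 / c) \<xi>) * (\<integral>t. K (t, \<xi>) * u t \<partial>lborel) \<partial>lborel)"
      by (subst fubini_bounded_kernel(1)[OF iu ig, of K 1]) (simp_all add: K_def)
    finally have "norm (ft (G x) (- w)) = (1 / c) ^ DIM('a) * norm (\<integral>\<xi>. of_real (gauss (1 / c) \<xi>) * (\<integral>t. K (t, \<xi>) * u t \<partial>lborel) \<partial>lborel)"
      using c by (simp add: norm_mult norm_divide norm_power)
    also have "\<dots> \<le> (1 / c) ^ DIM('a) * (\<integral>\<xi>. norm (of_real (gauss (1 / c) \<xi>) * (\<integral>t. K (t, \<xi>) * u t \<partial>lborel)) \<partial>lborel)"
      using c by (intro mult_left_mono integral_norm_bound) auto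
    also have "(\<integral>\<xi>. norm (of_real (gauss (1 / c) \<xi>) * (\<integral>t. K (t, \<xi>) * u t \<partial>lborel)) \<partial>lborel)
       \<le> (\<integral>\<xi>. C2 * decay k w * (gauss (1 / c) (\<xi>::'a) / decay k \<xi>) \<partial>lborel)"
    proof (rule integral_mono)
      show "integrable lborel (\<lambda>\<xi>::'a. C2 * decay k w * (gauss (1 / c) \<xi> / decay k \<xi>))" by (intro integrable_mult_right gi c')
      show "integrable lborel (\<lambda>\<xi>. norm (of_real (gauss (1 / c) \<xi>) * (\<integral>t. K (t, \<xi>) * u t \<partial>lborel)))"
        by (rule integrable_norm[OF fubini_bounded_kernel(3)[OF iu ig, of K 1]]) (simp_all add: K_def)
      fix \<xi>
      have "norm (ft \<gamma> (w - \<xi>)) \<le> C2 * (decay k w / decay k \<xi>)"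
        using C2 by (intro order_trans[OF C2(2)] mult_left_mono decay_submult) auto
      then have "gauss (1 / c) \<xi> * norm (ft \<gamma> (w - \<xi>)) \<le> gauss (1 / c) \<xi> * (C2 * (decay k w / decay k \<xi>))"
        by (intro mult_left_mono) auto
      then show "norm (of_real (gauss (1 / c) \<xi>) * (\<integral>t. K (t, \<xi>) * u t \<partial>lborel)) \<le> C2 * decay k w * (gauss (1 / c) \<xi> / decay k \<xi>)"
        unfolding norm_mult inner by (simp add: mult_ac)
    qed
    also have "\<dots> = C2 * J (1 / c) * decay k w" unfolding J_def by (subst integral_mult_right_zero) (simp add: mult_ac)
    finally have "norm (ft (G x) (- w)) \<le> (1 / c) ^ DIM('a) * (C2 * J (1 / c) * decay k w)"
      using c by (simp add: mult_left_mono)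
    also have "\<dots> \<le> (C1 * J c + (1 / c) ^ DIM('a) * (C2 * J (1 / c)) + 1) * decay k w"
      using C1 J0[of c] by (simp add: distrib_right mult_ac)
    finally show ?case by (simp add: G_def[abs_def])
  qed
qed

lemma gauss_nice: "0 < c \<Longrightarrow> nice (\<lambda>x::'a::euclidean_space. complex_of_real (gauss c x))"
  unfolding nice_def using gauss_integral(1)[of c, where 'a='a] by (auto intro!: exI[of _ 1])

text \<open>Valid for every Schwartz window, which is what allows Gaussians to be inserted into a
  continuity hypothesis formulated with the given \<open>\<gamma>\<close>.\<close>

lemma gauss_M1:
  fixes \<gamma> :: "'a::euclidean_space \<Rightarrow> complex"
  assumes \<gamma>: "\<gamma> \<in> schwartz" and c: "0 < c"
  shows "(\<lambda>x. complex_of_real (gauss c x)) \<in> M1 \<gamma>"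
proof -
  let ?g = "\<lambda>x::'a. complex_of_real (gauss c x)"
  have [measurable]: "\<gamma> \<in> borel_measurable borel" using \<gamma> by measurable
  have gi: "integrable lborel ?g" using gauss_nice[OF c, where 'a='a] by (simp add: nice_def)
  have int: "integrable lborel (\<lambda>x. ?g x * cnj (\<phi> x))" if \<phi>: "\<phi> \<in> schwartz" for \<phi>
  proof -
    have [measurable]: "\<phi> \<in> borel_measurable borel" using \<phi> by measurable
    obtain C where C: "0 < C" "\<And>x. (1 + norm x) ^ 0 * norm (partials [] \<phi> x) \<le> C"
      using schwartz_decay[OF \<phi>, of "[]" 0] by auto
    have i: "integrable lborel (\<lambda>x. of_real C * ?g x)" using gi by (rule integrable_mult_right)
    show ?thesis
      by (rule Bochner_Integration.integrable_bound[OF i])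
        (use C in \<open>auto simp: norm_mult mult.commute[of C] intro!: mult_left_mono\<close>)
  qed
  have td: "tempered_distribution (L2_pairing ?g)"
    unfolding tempered_distribution_def
  proof (intro conjI ballI allI)
    show "L2_pairing ?g (\<lambda>x. \<phi> x + \<psi> x) = L2_pairing ?g \<phi> + L2_pairing ?g \<psi>" if "\<phi> \<in> schwartz" "\<psi> \<in> schwartz" for \<phi> \<psi>
      using int[OF that(1)] int[OF that(2)] by (simp add: L2_pairing_def distrib_left)
    show "L2_pairing ?g (\<lambda>x. a * \<phi> x) = cnj a * L2_pairing ?g \<phi>" for a \<phi>
      by (simp add: L2_pairing_def mult.left_commute)
    have "norm (L2_pairing ?g \<phi>) \<le> (\<integral>x. gauss c (x::'a) \<partial>lborel) * schwartz_norm 0 \<phi>" if \<phi>: "\<phi> \<in> schwartz" for \<phi>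
    proof -
      obtain C where C: "0 < C" "\<And>x. (1 + norm x) ^ 0 * norm (partials [] \<phi> x) \<le> C"
        using schwartz_decay[OF \<phi>, of "[]" 0] by auto
      have s: "schwartz_norm 0 \<phi> = (SUP x. norm (\<phi> x))"
      proof -
        have "{vs \<in> lists (Basis::'a set). length vs \<le> 0} = {[]}" by auto
        then show ?thesis by (simp add: schwartz_norm_def)
      qed
      have le: "norm (\<phi> x) \<le> schwartz_norm 0 \<phi>" for x
        unfolding s by (rule cSUP_upper) (use C in \<open>auto intro!: bdd_aboveI[of _ C]\<close>)
      have "norm (L2_pairing ?g \<phi>) \<le> (\<integral>x. norm (?g x * cnj (\<phi> x)) \<partial>lborel)"
        unfolding L2_pairing_def by (rule integral_norm_bound)
      also have "\<dots> \<le> (\<integral>x. gauss c (x::'a) * schwartz_norm 0 \<phi> \<partial>lborel)"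
      proof (rule integral_mono)
        show "integrable lborel (\<lambda>x. norm (?g x * cnj (\<phi> x)))" by (rule integrable_norm[OF int[OF \<phi>]])
        show "integrable lborel (\<lambda>x::'a. gauss c x * schwartz_norm 0 \<phi>)" using gauss_integral(1)[OF c, where 'a='a] by simp
        show "norm (?g x * cnj (\<phi> x)) \<le> gauss c x * schwartz_norm 0 \<phi>" for x
          using le by (simp add: norm_mult mult_left_mono)
      qed
      finally show ?thesis by simp
    qed
    then show "\<exists>C N. \<forall>\<phi>\<in>schwartz. norm (L2_pairing ?g \<phi>) \<le> C * schwartz_norm N \<phi>" by blast
  qed
  define V where "V = stft \<gamma> (L2_pairing ?g)"
  have Veq: "V z = (\<integral>t. cis (2 * pi * (- snd z \<bullet> t)) * (?g t * cnj (\<gamma> (t - fst z))) \<partial>lborel)" for z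
    unfolding V_def using stft_L2_pairing[of \<gamma> ?g "fst z" "snd z"] by (simp add: ft_def)
  have "(\<lambda>v. cis (2 * pi * (- snd (fst v) \<bullet> snd v)) * (?g (snd v) * cnj (\<gamma> (snd v - fst (fst v))))) \<in> borel_measurable borel"
    by measurable
  from borel_measurable_lborel_integral[OF this] have Vm[measurable]: "V \<in> borel_measurable borel"
    unfolding Veq[abs_def] by simp
  define k where "k = 2 * DIM('a)"
  obtain C where C: "0 < C" "\<And>x w. norm (ft (\<lambda>t. ?g t * cnj (\<gamma> (t - x))) (- w)) \<le> C * decay (2 * k) x"
    "\<And>x w. norm (ft (\<lambda>t. ?g t * cnj (\<gamma> (t - x))) (- w)) \<le> C * decay (2 * k) w"
    by (rule stft_gauss_bounds[OF \<gamma> c]) blast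
  \<comment> \<open>The geometric mean of the two one-sided bounds decays in both variables; halving
    the rate in this way is the reason for starting from \<open>2 * k\<close>.\<close>
  have Vle: "norm (V z) \<le> C * (decay k (fst z) * decay k (snd z))" for z
  proof -
    have V2: "norm (V z) \<le> C * decay (2 * k) (fst z)" "norm (V z) \<le> C * decay (2 * k) (snd z)"
      using C(2)[of "fst z" "snd z"] C(3)[of "fst z" "snd z"] by (simp_all add: Veq ft_def)
    then have "norm (V z) * norm (V z) \<le> (C * decay (2 * k) (fst z)) * (C * decay (2 * k) (snd z))"
      using C(1) by (intro mult_mono) auto
    also have "\<dots> = (C * (decay k (fst z) * decay k (snd z)))\<^sup>2"
      unfolding decay_mult_self[symmetric] by (simp add: power2_eq_square)
    finally have "(norm (V z))\<^sup>2 \<le> (C * (decay k (fst z) * decay k (snd z)))\<^sup>2" by (simp add: power2_eq_square)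
    then show ?thesis by (rule power2_le_imp_le) (use C in simp)
  qed
  have i: "integrable lborel (\<lambda>z::'a \<times> 'a. C * (decay k (fst z) * decay k (snd z)))"
    unfolding k_def by (intro integrable_mult_right integrable_lborel_mult decay_integrable)
  have "integrable lborel (\<lambda>z. norm (V z))"
  proof (rule Bochner_Integration.integrable_bound[OF i])
    show "AE z in lborel. norm (norm (V z)) \<le> norm (C * (decay k (fst z) * decay k (snd z)))"
      unfolding real_norm_def abs_norm_cancel by (intro AE_I2 order_trans[OF Vle abs_ge_self])
  qed simp
  then have "V \<in> Lp_space 1" using Vm by (simp add: Lp_space_def)
  then show ?thesis using int td by (simp add: M1_def modulation_space_def V_def)
qed

section \<open>Gaussian test functions\<close>

lemma gauss_powr: "0 \<le> r \<Longrightarrow> gauss c x powr r = gauss (c * sqrt r) x"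
  by (simp add: gauss_def powr_def power_mult_distrib mult_ac)

text \<open>The exact value carries a factor r^(-d/2), at most 1, which is dropped: only the power
  of \<open>c\<close> matters in the comparison of exponents.\<close>

lemma gauss_scaled_integral_le:
  assumes "0 < c" "1 \<le> r"
  shows "(\<integral>x. gauss (c * sqrt r) (x::'a::euclidean_space) \<partial>lborel) \<le> 1 / c ^ DIM('a)"
proof -
  have "(\<integral>x. gauss (c * sqrt r) (x::'a) \<partial>lborel) = 1 / (c * sqrt r) ^ DIM('a)"
    using assms by (intro gauss_integral) auto
  also have "\<dots> \<le> 1 / c ^ DIM('a)"
  proof -
    have "c * 1 \<le> c * sqrt r" using assms by (intro mult_left_mono) auto
    then show ?thesis using assms by (intro divide_left_mono power_mono mult_pos_pos zero_less_power) auto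
  qed
  finally show ?thesis .
qed

lemma inverse_power_powr: "0 < c \<Longrightarrow> (1 / c ^ n) powr a = c powr (- (real n * a))"
  by (simp add: powr_realpow[symmetric] powr_divide powr_powr powr_minus inverse_eq_divide)

lemma gauss_Lp_norm_le:
  assumes c: "0 < c" and p: "1 \<le> p"
  shows "Lp_norm p (\<lambda>x::'a::euclidean_space. complex_of_real (gauss c x)) \<le> c powr (- (real DIM('a) * enn2real (1 / p)))"
  using p
proof (cases p rule: exponent_cases)
  case (fin r)
  have "(\<integral>x. gauss c (x::'a) powr r \<partial>lborel) \<le> 1 / c ^ DIM('a)"
    using gauss_scaled_integral_le[OF c fin(3), where 'a='a] fin by (simp add: gauss_powr)
  then have "(\<integral>x. gauss c (x::'a) powr r \<partial>lborel) powr (1 / r) \<le> (1 / c ^ DIM('a)) powr (1 / r)"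
    using fin by (intro powr_mono2 integral_nonneg_AE) auto
  then show ?thesis unfolding fin(5) inverse_power_powr[OF c, symmetric] using fin by (simp add: Lp_norm_def)
next
  case inf
  show ?thesis unfolding inf using Lp_space_infinityI(2)[of "\<lambda>x::'a. complex_of_real (gauss c x)" 1] c by simp
qed

definition test_symbol :: "('a::euclidean_space \<Rightarrow> 'a) \<Rightarrow> real \<Rightarrow> 'a \<times> 'a \<Rightarrow> complex" where
  "test_symbol N l z = cis (2 * pi * (snd z \<bullet> N (fst z))) * of_real (gauss 1 (fst z) * gauss l (snd z))"

lemma test_symbol_measurable:
  assumes [measurable]: "N \<in> borel_measurable borel"
  shows "test_symbol N l \<in> borel_measurable borel"
  unfolding test_symbol_def[abs_def] by measurable

lemma norm_test_symbol: "norm (test_symbol N l z) = gauss 1 (fst z) * gauss l (snd z)"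
  by (simp add: test_symbol_def norm_mult)

text \<open>The phase has modulus 1, so the norm splits into two Gaussian factors, of which only the
  one in frequency depends on \<open>l\<close>.\<close>

lemma test_symbol_Lp:
  fixes N :: "'a::euclidean_space \<Rightarrow> 'a"
  assumes N: "N \<in> borel_measurable borel" and l: "0 < l" and q: "1 \<le> q"
  shows "test_symbol N l \<in> Lp_space q" "Lp_norm q (test_symbol N l) \<le> l powr (- (real DIM('a) * enn2real (1 / q)))"
proof -
  have [measurable]: "test_symbol N l \<in> borel_measurable borel" by (rule test_symbol_measurable[OF N])
  have "test_symbol N l \<in> Lp_space q \<and> Lp_norm q (test_symbol N l) \<le> l powr (- (real DIM('a) * enn2real (1 / q)))"
    using q
  proof (cases q rule: exponent_cases)
    case (fin r)
    have eq: "norm (test_symbol N l z) powr r = gauss (1 * sqrt r) (fst z) * gauss (l * sqrt r) (snd z)" for z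
      using fin by (simp add: norm_test_symbol powr_mult gauss_powr)
    have i1: "integrable lborel (gauss (1 * sqrt r) :: 'a \<Rightarrow> real)" "integrable lborel (gauss (l * sqrt r) :: 'a \<Rightarrow> real)"
      using fin l by (auto intro!: gauss_integral)
    have i: "integrable lborel (\<lambda>z. norm (test_symbol N l z) powr r)"
      unfolding eq by (rule integrable_lborel_mult[OF i1])
    have "(\<integral>z. norm (test_symbol N l z) powr r \<partial>lborel)
       = (\<integral>x. gauss (1 * sqrt r) (x::'a) \<partial>lborel) * (\<integral>x. gauss (l * sqrt r) (x::'a) \<partial>lborel)"
      unfolding eq by (rule integral_lborel_mult[OF i1])
    also have "\<dots> \<le> (1 / 1 ^ DIM('a)) * (1 / l ^ DIM('a))"
      using l fin by (intro mult_mono gauss_scaled_integral_le integral_nonneg_AE) auto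
    finally have "(\<integral>z. norm (test_symbol N l z) powr r \<partial>lborel) powr (1 / r) \<le> (1 / l ^ DIM('a)) powr (1 / r)"
      using fin by (intro powr_mono2 integral_nonneg_AE) auto
    then show ?thesis unfolding fin(5) inverse_power_powr[OF l, symmetric] using i fin by (simp add: Lp_norm_def Lp_space_def)
  next
    case inf
    have "norm (test_symbol N l z) \<le> 1" for z unfolding norm_test_symbol by (intro mult_le_one) auto
    then show ?thesis unfolding inf using Lp_space_infinityI[of "test_symbol N l" 1] l by simp
  qed
  then show "test_symbol N l \<in> Lp_space q" "Lp_norm q (test_symbol N l) \<le> l powr (- (real DIM('a) * enn2real (1 / q)))"
    by auto
qed

text \<open>The phase of \<open>test_symbol\<close> undoes the translation by \<open>N x\<close>, after which integrating out the
  frequency variable produces an approximate identity in \<open>y\<close>; rescaling \<open>y\<close> by \<open>l\<close> makes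
  the lower bound independent of \<open>l\<close>.\<close>

lemma test_symbol_lower_bound:
  fixes M Q R N :: "'a::euclidean_space \<Rightarrow> 'a"
  assumes lin: "linear M" "linear Q" "linear R" "linear N" and Rs: "affine_scaling R d"
  obtains c0 where "0 < c0"
    "\<And>l. 0 < l \<Longrightarrow> l \<le> 1 \<Longrightarrow> c0 \<le> norm (\<integral>z. test_symbol N l z *
        (\<integral>y. cis (2 * pi * (snd z \<bullet> y)) * of_real (gauss 1 (M (fst z) + Q (y + N (fst z))) * gauss (1 / l) (R (y + N (fst z)))) \<partial>lborel) \<partial>lborel)"
proof -
  obtain K1 K2 K3 where Ks: "\<And>x. norm (M x) \<le> norm x * K1" "\<And>x. norm (Q x) \<le> norm x * K2" "\<And>x. norm (R x) \<le> norm x * K3"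
    using lin[THEN linear_conv_bounded_linear[THEN iffD1], THEN bounded_linear.bounded] by metis
  define K where "K = \<bar>K1\<bar> + \<bar>K2\<bar> + \<bar>K3\<bar>"
  have K: "norm (M x) \<le> K * norm x" "norm (Q x) \<le> K * norm x" "norm (R x) \<le> K * norm x" for x
  proof -
    have "norm x * K1 \<le> K * norm x" "norm x * K2 \<le> K * norm x" "norm x * K3 \<le> K * norm x"
      unfolding K_def mult.commute[of "norm x"] by (intro mult_right_mono; simp)+
    then show "norm (M x) \<le> K * norm x" "norm (Q x) \<le> K * norm x" "norm (R x) \<le> K * norm x"
      using Ks[of x] by linarith+
  qed
  have [measurable]: "M \<in> borel_measurable borel" "Q \<in> borel_measurable borel" "R \<in> borel_measurable borel" "N \<in> borel_measurable borel"
    using lin by (auto intro!: borel_measurable_continuous_onI linear_continuous_on simp: linear_conv_bounded_linear[symmetric])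
  \<comment> \<open>Counts the quadratic terms in y: 2 K^2 from M x + l Q y, K^2 from R y, and 1
    from the mollifier. The terms in x need less. The condition l \<le> 1 bounds l Q y by Q
    y.\<close>
  define k where "k = sqrt (3 * K\<^sup>2 + 1)"
  have k: "0 < k" "k\<^sup>2 = 3 * K\<^sup>2 + 1" by (auto simp: k_def add_nonneg_pos)
  have low: "gauss k x * gauss k y \<le> gauss 1 (M x + l *\<^sub>R Q y) * gauss 1 (R y) * gauss 1 y"
    if l: "0 < l" "l \<le> 1" for l x y
  proof -
    have "norm (M x + l *\<^sub>R Q y) \<le> norm (M x) + norm (l *\<^sub>R Q y)" by (rule norm_triangle_ineq)
    also have "norm (l *\<^sub>R Q y) \<le> norm (Q y)" using l by (simp add: mult_left_le_one_le)
    finally have "norm (M x + l *\<^sub>R Q y) \<le> K * norm x + K * norm y" using K(1)[of x] K(2)[of y] by linarith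
    then have "(norm (M x + l *\<^sub>R Q y))\<^sup>2 \<le> (K * norm x + K * norm y)\<^sup>2" by (intro power_mono) auto
    also have "\<dots> \<le> 2 * (K * norm x)\<^sup>2 + 2 * (K * norm y)\<^sup>2"
      using zero_le_power2[of "K * norm x - K * norm y"] by (simp add: power2_sum power2_diff)
    finally have 1: "(norm (M x + l *\<^sub>R Q y))\<^sup>2 \<le> 2 * K\<^sup>2 * (norm x)\<^sup>2 + 2 * K\<^sup>2 * (norm y)\<^sup>2"
      by (simp add: power_mult_distrib)
    have "(norm (R y))\<^sup>2 \<le> (K * norm y)\<^sup>2" using K(3)[of y] by (intro power_mono) auto
    then have 2: "(norm (R y))\<^sup>2 \<le> K\<^sup>2 * (norm y)\<^sup>2" by (simp add: power_mult_distrib)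
    have "(norm (M x + l *\<^sub>R Q y))\<^sup>2 + (norm (R y))\<^sup>2 + (norm y)\<^sup>2 \<le> k\<^sup>2 * (norm x)\<^sup>2 + k\<^sup>2 * (norm y)\<^sup>2"
    proof -
      have "0 \<le> K\<^sup>2 * (norm x)\<^sup>2" by simp
      moreover have "k\<^sup>2 * (norm x)\<^sup>2 + k\<^sup>2 * (norm y)\<^sup>2
          = 3 * (K\<^sup>2 * (norm x)\<^sup>2) + (norm x)\<^sup>2 + 3 * (K\<^sup>2 * (norm y)\<^sup>2) + (norm y)\<^sup>2"
        by (simp add: k algebra_simps)
      ultimately show ?thesis using 1 2 zero_le_power2[of "norm x"] by linarith
    qed
    then have "pi * ((norm (M x + l *\<^sub>R Q y))\<^sup>2 + (norm (R y))\<^sup>2 + (norm y)\<^sup>2) \<le> pi * (k\<^sup>2 * (norm x)\<^sup>2 + k\<^sup>2 * (norm y)\<^sup>2)"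
      by (intro mult_left_mono) auto
    then show ?thesis by (simp add: gauss_def exp_add[symmetric] algebra_simps)
  qed
  define k' where "k' = sqrt (1 + k\<^sup>2)"
  have k': "0 < k'" "k'\<^sup>2 = 1 + k\<^sup>2" by (auto simp: k'_def add_pos_nonneg)
  have kk: "gauss 1 x * gauss k x = gauss k' x" for x :: 'a
    by (simp add: gauss_def exp_add[symmetric] k' algebra_simps)
  define c0 where "c0 = 1 / k' ^ DIM('a) * (1 / k ^ DIM('a))"
  show ?thesis
  proof (rule that[of c0])
    show "0 < c0" using k k' by (simp add: c0_def)
    fix l :: real assume l: "0 < l" "l \<le> 1"
    have l': "0 < 1 / l" using l by simp
    define G where "G x y = complex_of_real (gauss 1 (M x + Q y) * gauss (1 / l) (R y))" for x y
    define E where "E z y = cis (2 * pi * (snd z \<bullet> y)) * of_real (gauss 1 (M (fst z) + Q (y + N (fst z))) * gauss (1 / l) (R (y + N (fst z))))" for z y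
    define H where "H x = (\<integral>y. gauss 1 (M x + Q y) * gauss (1 / l) (R y) * (gauss (1 / l) y / l ^ DIM('a)) \<partial>lborel)" for x
    have shift: "test_symbol N l z * (\<integral>y. E z y \<partial>lborel)
        = of_real (gauss 1 (fst z) * gauss l (snd z)) * (\<integral>y. cis (2 * pi * (snd z \<bullet> y)) * G (fst z) y \<partial>lborel)" for z
    proof -
      have "(\<integral>y. E z y \<partial>lborel) = (\<integral>y. E z (y - N (fst z)) \<partial>lborel)"
      proof -
        have "E z \<in> borel_measurable borel" unfolding E_def[abs_def] by measurable
        then show ?thesis using affine_scaling_integral(2)[OF affine_scaling_diff, of "E z" "N (fst z)"] by simp
      qed
      also have "\<dots> = (\<integral>y. cis (- (2 * pi * (snd z \<bullet> N (fst z)))) * (cis (2 * pi * (snd z \<bullet> y)) * G (fst z) y) \<partial>lborel)"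
        by (rule Bochner_Integration.integral_cong[OF refl])
          (simp add: E_def G_def inner_diff_right right_diff_distrib mult.assoc[symmetric] cis_mult)
      also have "\<dots> = cis (- (2 * pi * (snd z \<bullet> N (fst z)))) * (\<integral>y. cis (2 * pi * (snd z \<bullet> y)) * G (fst z) y \<partial>lborel)"
        by (rule integral_mult_right_zero)
      finally show ?thesis
        by (simp add: test_symbol_def mult.assoc mult.left_commute[of _ "cis (- _)"])
          (simp add: mult.assoc[symmetric] cis_mult)
    qed
    have [measurable]: "G x \<in> borel_measurable borel" for x unfolding G_def[abs_def] by measurable
    have iR: "integrable lborel (\<lambda>y. gauss (1 / l) (R y))"
      using affine_scaling_integral(1)[OF Rs, of "gauss (1 / l)"] gauss_integral(1)[OF l', where 'a='a] by simp
    have GR: "norm (G x y) \<le> gauss (1 / l) (R y)" for x y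
      by (simp add: G_def norm_mult mult_left_le_one_le)
    have iG: "integrable lborel (G x)" for x
      by (rule Bochner_Integration.integrable_bound[OF iR]) (use GR in auto)
    define B where "B = (\<integral>y. gauss (1 / l) (R y) \<partial>lborel)"
    have ftG: "norm (ft (G x) w) \<le> B" for x w
      unfolding B_def by (rule order_trans[OF ft_bound[OF iG]]) (intro integral_mono integrable_norm iG iR GR)
    define F where "F z = complex_of_real (gauss 1 (fst z) * gauss l (snd z)) * ft (G (fst z)) (snd z)" for z
    have "(\<lambda>v. cis (2 * pi * (snd (fst v) \<bullet> snd v)) * G (fst (fst v)) (snd v)) \<in> borel_measurable borel"
      unfolding G_def by measurable
    from borel_measurable_lborel_integral[OF this]
    have ftm: "(\<lambda>z. ft (G (fst z)) (snd z)) \<in> borel_measurable borel" by (simp add: ft_def)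
    have gl: "integrable lborel (gauss 1 :: 'a \<Rightarrow> real)" "integrable lborel (gauss l :: 'a \<Rightarrow> real)"
      using l by (auto intro!: gauss_integral)
    have iF: "integrable lborel F"
    proof (rule Bochner_Integration.integrable_bound)
      show "integrable lborel (\<lambda>z::'a \<times> 'a. gauss 1 (fst z) * gauss l (snd z) * B)"
        by (intro integrable_mult_left integrable_lborel_mult gl)
      show "F \<in> borel_measurable lborel"
        using ftm unfolding F_def[abs_def] by measurable
      have "norm (F z) \<le> gauss 1 (fst z) * gauss l (snd z) * B" for z
        unfolding F_def norm_mult norm_of_real by (simp add: mult_left_mono ftG)
      then show "AE z in lborel. norm (F z) \<le> norm (gauss 1 (fst z) * gauss l (snd z) * B)"
        unfolding real_norm_def by (intro AE_I2) (rule order_trans[OF _ abs_ge_self])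
    qed
    have inner: "(\<integral>w. F (x, w) \<partial>lborel) = of_real (gauss 1 x * H x)" for x
    proof -
      define Ke where "Ke z = cis (2 * pi * (fst z \<bullet> snd z))" for z :: "'a \<times> 'a"
      have [measurable]: "Ke \<in> borel_measurable borel" unfolding Ke_def[abs_def] by measurable
      have ig: "integrable lborel (\<lambda>w::'a. complex_of_real (gauss l w))" using gl by simp
      have "(\<integral>w. F (x, w) \<partial>lborel) = (\<integral>w. of_real (gauss 1 x) * (of_real (gauss l w) * (\<integral>y. Ke (w, y) * G x y \<partial>lborel)) \<partial>lborel)"
        by (simp add: F_def ft_def Ke_def mult.assoc)
      also have "\<dots> = of_real (gauss 1 x) * (\<integral>w. of_real (gauss l w) * (\<integral>y. Ke (w, y) * G x y \<partial>lborel) \<partial>lborel)"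
        by (rule integral_mult_right_zero)
      also have "(\<integral>w. of_real (gauss l w) * (\<integral>y. Ke (w, y) * G x y \<partial>lborel) \<partial>lborel)
         = (\<integral>y. G x y * (\<integral>w. Ke (w, y) * of_real (gauss l w) \<partial>lborel) \<partial>lborel)"
        by (rule fubini_bounded_kernel(1)[OF ig iG, of Ke 1]) (simp_all add: Ke_def)
      also have "\<dots> = (\<integral>y. of_real (gauss 1 (M x + Q y) * gauss (1 / l) (R y) * (gauss (1 / l) y / l ^ DIM('a))) \<partial>lborel)"
      proof (rule Bochner_Integration.integral_cong[OF refl])
        fix y :: 'a
        have "(\<integral>w. Ke (w, y) * of_real (gauss l w) \<partial>lborel) = of_real (gauss (1 / l) y / l ^ DIM('a))"
          using gauss_ft(2)[OF l(1), of y] by (simp add: Ke_def)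
        then show "G x y * (\<integral>w. Ke (w, y) * of_real (gauss l w) \<partial>lborel)
          = of_real (gauss 1 (M x + Q y) * gauss (1 / l) (R y) * (gauss (1 / l) y / l ^ DIM('a)))"
          by (simp only: G_def of_real_mult)
      qed
      also have "\<dots> = of_real (H x)" unfolding H_def by (rule integral_complex_of_real)
      finally show ?thesis by simp
    qed
    have "(\<integral>z. F z \<partial>lborel) = (\<integral>x. of_real (gauss 1 x * H x) \<partial>lborel)"
      unfolding integral_lborel_pair(1)[OF iF] inner ..
    then have FH: "(\<integral>z. F z \<partial>lborel) = of_real (\<integral>x. gauss 1 x * H x \<partial>lborel)"
      by (simp only: integral_complex_of_real)
    have iH: "integrable lborel (\<lambda>x. gauss 1 x * H x)"
      using integral_lborel_pair(3)[OF iF] unfolding inner by (simp only: complex_of_real_integrable_eq)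
    \<comment> \<open>Replacing y by l y, the Jacobian cancels the normalisation of the mollifier
      and both \<open>gauss (1 / l)\<close> factors become \<open>gauss 1\<close>, R being linear.
      The parameter survives only in \<open>l *\<^sub>R Q y\<close>, which the lower bound by
      \<open>k\<close> covers.\<close>
    have Hlow: "gauss k x / k ^ DIM('a) \<le> H x" for x
    proof -
      have sc: "affine_scaling (\<lambda>y. 0 + l *\<^sub>R y :: 'a) (l ^ DIM('a))"
        using affine_scaling_homothety[of l 0] l by simp
      have gl: "gauss (1 / l) (l *\<^sub>R v) = gauss 1 v" for v :: 'a
        using l by (simp add: gauss_def power_mult_distrib power_divide)
      have "H x = l ^ DIM('a) *\<^sub>R (\<integral>y. gauss 1 (M x + Q (0 + l *\<^sub>R y)) * gauss (1 / l) (R (0 + l *\<^sub>R y)) * (gauss (1 / l) (0 + l *\<^sub>R y) / l ^ DIM('a)) \<partial>lborel)"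
        unfolding H_def by (rule affine_scaling_integral(2)[OF sc]) measurable
      also have "\<dots> = (\<integral>y. l ^ DIM('a) * (gauss 1 (M x + Q (0 + l *\<^sub>R y)) * gauss (1 / l) (R (0 + l *\<^sub>R y)) * (gauss (1 / l) (0 + l *\<^sub>R y) / l ^ DIM('a))) \<partial>lborel)"
        unfolding real_scaleR_def by (rule integral_mult_right_zero[symmetric])
      also have "\<dots> = (\<integral>y. gauss 1 (M x + l *\<^sub>R Q y) * gauss 1 (R y) * gauss 1 y \<partial>lborel)"
        by (rule Bochner_Integration.integral_cong[OF refl])
          (use l lin in \<open>simp add: linear_scale gl\<close>)
      finally have Heq: "H x = \<dots>" .
      have "gauss k x / k ^ DIM('a) = (\<integral>y. gauss k x * gauss k (y::'a) \<partial>lborel)"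
        using gauss_integral(2)[OF k(1), where 'a='a] by simp
      also have "\<dots> \<le> H x"
        unfolding Heq
      proof (rule integral_mono)
        show "integrable lborel (\<lambda>y::'a. gauss k x * gauss k y)"
          by (intro integrable_mult_right gauss_integral k)
        show "integrable lborel (\<lambda>y. gauss 1 (M x + l *\<^sub>R Q y) * gauss 1 (R y) * gauss 1 y)"
        proof (rule Bochner_Integration.integrable_bound[OF \<open>integrable lborel (gauss 1 :: 'a \<Rightarrow> real)\<close>])
          show "AE y in lborel. norm (gauss 1 (M x + l *\<^sub>R Q y) * gauss 1 (R y) * gauss 1 y) \<le> norm (gauss 1 y)"
            by (intro AE_I2) (simp add: abs_mult mult_left_le_one_le mult_le_one)
        qed measurable
        show "gauss k x * gauss k y \<le> gauss 1 (M x + l *\<^sub>R Q y) * gauss 1 (R y) * gauss 1 y" for y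
          by (rule low[OF l])
      qed
      finally show ?thesis .
    qed
    have "c0 = (\<integral>x. gauss 1 x * (gauss k x / k ^ DIM('a)) \<partial>(lborel :: 'a measure))"
      using gauss_integral(2)[OF k'(1), where 'a='a] by (simp add: c0_def kk mult.assoc[symmetric])
    also have "\<dots> \<le> (\<integral>x. gauss 1 x * H x \<partial>lborel)"
    proof (rule integral_mono[OF _ iH])
      show "integrable lborel (\<lambda>x::'a. gauss 1 x * (gauss k x / k ^ DIM('a)))"
        using gauss_integral(1)[OF k'(1), where 'a='a] by (simp add: kk mult.assoc[symmetric])
      show "gauss 1 x * (gauss k x / k ^ DIM('a)) \<le> gauss 1 x * H x" for x
        by (intro mult_left_mono Hlow) simp
    qed
    also have "\<dots> \<le> norm (\<integral>z. F z \<partial>lborel)" unfolding FH by simp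
    also have "(\<integral>z. F z \<partial>lborel) = (\<integral>z. test_symbol N l z * (\<integral>y. E z y \<partial>lborel) \<partial>lborel)"
      unfolding shift F_def ft_def ..
    finally show "c0 \<le> norm (\<integral>z. test_symbol N l z * (\<integral>y. cis (2 * pi * (snd z \<bullet> y)) * of_real (gauss 1 (M (fst z) + Q (y + N (fst z))) * gauss (1 / l) (R (y + N (fst z)))) \<partial>lborel) \<partial>lborel)"
      unfolding E_def .
  qed
qed

text \<open>Turns a lower bound uniform in the scale into an inequality between exponents: for
  positive e the right side would fall below c0 as l tends to 0.\<close>

lemma powr_exponent_nonpos:
  fixes e C c0 :: real
  assumes c0: "0 < c0" and le: "\<And>l. 0 < l \<Longrightarrow> l \<le> 1 \<Longrightarrow> c0 \<le> C * l powr e"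
  shows "e \<le> 0"
proof (rule ccontr)
  assume "\<not> e \<le> 0"
  then have e: "0 < e" by simp
  define C' where "C' = max C c0"
  have C': "0 < C'" "C \<le> C'" "c0 \<le> C'" using c0 by (auto simp: C'_def)
  \<comment> \<open>Solves C' l^e = c0 / 2. Enlarging \<open>C\<close> to \<open>C' \<ge> c0\<close>
    guarantees l \<le> 1 and allows any sign of \<open>C\<close>.\<close>
  define l where "l = (c0 / (2 * C')) powr (1 / e)"
  have l0: "0 < l" using c0 C' by (simp add: l_def)
  have "l \<le> 1 powr (1 / e)" unfolding l_def using c0 C' e by (intro powr_mono2) (auto simp: field_simps)
  then have "c0 \<le> C * l powr e" using le l0 by simp
  also have "\<dots> \<le> C' * l powr e" using C' by (intro mult_right_mono) auto
  also have "l powr e = c0 / (2 * C')" using e c0 C' by (simp add: l_def powr_powr)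
  finally show False using c0 C' by simp
qed

section \<open>Quantization by a right-regular matrix\<close>

text \<open>The functional norm is an infimum over representing functions, so a representative is
  available only up to an arbitrarily small excess; Hoelder's inequality is applied to it and the
  excess is sent to 0.\<close>

lemma functional_Lp_norm_pairing:
  fixes g :: "'a::euclidean_space \<Rightarrow> complex"
  assumes le: "functional_Lp_norm \<gamma> p u \<le> ennreal c" and c: "0 \<le> c" and g: "g \<in> M1 \<gamma>" "nice g"
    and p: "1 \<le> p" "1 / p + 1 / p' = 1"
  shows "norm (u g) \<le> c * Lp_norm p' g"
proof (rule field_le_epsilon)
  fix e :: real assume e: "0 < e"
  \<comment> \<open>Keeps d times the norm of \<open>g\<close> below e; the summand 1 covers a
    vanishing norm.\<close>
  define d where "d = e / (Lp_norm p' g + 1)"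
  have n: "0 < Lp_norm p' g + 1" using Lp_norm_nonneg[of p' g] by linarith
  have d: "0 < d" using e n by (simp add: d_def)
  have "functional_Lp_norm \<gamma> p u < ennreal (c + d)"
    using le by (rule le_less_trans) (use c d in \<open>simp add: ennreal_less_iff\<close>)
  then obtain h where h: "h \<in> Lp_space p" "\<forall>g\<in>M1 \<gamma>. u g = L2_pairing h g" "ennreal (Lp_norm p h) < ennreal (c + d)"
    unfolding functional_Lp_norm_def Inf_less_iff by auto
  have hn: "Lp_norm p h \<le> c + d" using h(3) by (simp add: ennreal_less_iff)
  have gL: "(\<lambda>x. cnj (g x)) \<in> Lp_space p'"
    using nice_Lp[OF g(2) conjugate_exponents(1)[OF p]] by (simp add: Lp_cnj)
  have "norm (u g) \<le> (\<integral>x. norm (h x * cnj (g x)) \<partial>lborel)"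
    using h(2) g(1) by (simp only: L2_pairing_def integral_norm_bound)
  also have "\<dots> \<le> Lp_norm p h * Lp_norm p' g"
    using Lp_holder(2)[OF h(1) gL p] by (simp add: norm_mult Lp_cnj)
  also have "\<dots> \<le> (c + d) * Lp_norm p' g" by (intro mult_right_mono hn) simp
  also have "\<dots> = c * Lp_norm p' g + e * (Lp_norm p' g / (Lp_norm p' g + 1))"
    by (simp add: d_def distrib_right)
  also have "e * (Lp_norm p' g / (Lp_norm p' g + 1)) \<le> e * 1"
    using e n by (intro mult_left_mono) (auto simp: divide_le_eq)
  finally show "norm (u g) \<le> c * Lp_norm p' g + e" by simp
qed

lemma matrix_inv_cancel:
  fixes B :: "real^'n^'n"
  assumes "invertible B"
  shows "matrix_inv B *v (B *v x) = x" "B *v (matrix_inv B *v x) = x"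
proof -
  have "B ** matrix_inv B = mat 1 \<and> matrix_inv B ** B = mat 1"
    using assms unfolding matrix_inv_def invertible_def by (rule someI_ex)
  then show "matrix_inv B *v (B *v x) = x" "B *v (matrix_inv B *v x) = x"
    by (simp_all add: matrix_vector_mul_assoc)
qed

section \<open>The block geometry of a right-regular matrix\<close>

locale right_regular_matrix =
  fixes A :: "real^('d::finite + 'd)^('d + 'd)"
  assumes A_invertible: "invertible A" and A_regular: "right_regular A"
begin

abbreviation "A11 \<equiv> block11 A"
abbreviation "A12 \<equiv> block12 A"
abbreviation "A21 \<equiv> block21 A"
abbreviation "A22 \<equiv> block22 A"

definition "UA z = A11 *v fst z + A12 *v snd z"
definition "WA z = A21 *v fst z + A22 *v snd z"
text \<open>Solves \<open>UA (x, y) = u\<close> for y; invertibility of \<open>A12\<close> enters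
  here as the existence of an explicit kernel.\<close>

definition "YA z = matrix_inv A12 *v (snd z - A11 *v fst z)"

lemma A12_invertible: "invertible A12" and A22_invertible: "invertible A22"
  using A_regular by (simp_all add: right_regular_def)

lemma det_nonzero: "det A \<noteq> 0" "det A12 \<noteq> 0" "det A22 \<noteq> 0"
  using A_invertible A_regular by (auto simp: right_regular_def invertible_det_nz)

lemma matrix_vector_measurable [measurable]:
  fixes B :: "real^'n::finite^'m::finite"
  shows "(\<lambda>x. B *v x) \<in> borel_measurable borel"
  by (intro borel_measurable_continuous_onI matrix_vector_mult_linear_continuous_on)

text \<open>Gluing pairs into vectors, which preserves measure, conjugates this map to
  multiplication by \<open>A\<close>.\<close>

lemma UW_affine_scaling: "affine_scaling (\<lambda>z. (UA z, WA z)) \<bar>det A\<bar>"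
  unfolding affine_scaling_def
proof (intro conjI ballI)
  show "0 < \<bar>det A\<bar>" using det_nonzero by simp
  show m: "(\<lambda>z. (UA z, WA z)) \<in> borel_measurable borel"
    unfolding UA_def WA_def by measurable
  fix \<phi> :: "(real^'d) \<times> (real^'d) \<Rightarrow> ennreal" assume [measurable]: "\<phi> \<in> borel_measurable borel"
  define j where "j = (\<lambda>(x :: real^'d, y :: real^'d). (\<chi> i. case i of Inl a \<Rightarrow> x $ a | Inr b \<Rightarrow> y $ b) :: real^('d + 'd))"
  define sp where "sp v = ((\<chi> a. v $ Inl a) :: real^'d, (\<chi> b. v $ Inr b) :: real^'d)" for v :: "real^('d + 'd)"
  have [measurable]: "j \<in> borel_measurable borel"
    unfolding j_def
  proof (intro borel_measurable_continuous_onI, unfold case_prod_unfold, intro continuous_on_vec_lambda)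
    show "continuous_on UNIV (\<lambda>x. case i of Inl a \<Rightarrow> fst x $ a | Inr b \<Rightarrow> snd x $ b)"
      for i :: "'d + 'd"
      by (cases i) (auto intro!: continuous_intros)
  qed
  have [measurable]: "sp \<in> borel_measurable borel"
    unfolding sp_def by (intro borel_measurable_continuous_onI continuous_intros)
  have lb: "distr lborel borel j = lborel"
    unfolding j_def by (rule lborel_vec_sum)
  have tr: "(\<integral>\<^sup>+z. \<psi> (j z) \<partial>lborel) = (\<integral>\<^sup>+v. \<psi> v \<partial>lborel)" if [measurable]: "\<psi> \<in> borel_measurable borel" for \<psi>
    by (subst lb[symmetric]) (simp add: nn_integral_distr)
  have spj: "sp (j z) = z" for z by (cases z) (simp add: sp_def j_def)
  have Aj: "sp (A *v j z) = (UA z, WA z)" for z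
  proof -
    have U: "(UNIV :: ('d + 'd) set) = range Inl \<union> range Inr" by (auto simp: UNIV_sum)
    have sum: "(\<Sum>i\<in>(UNIV::('d + 'd) set). g i) = (\<Sum>a\<in>UNIV. g (Inl a)) + (\<Sum>b\<in>UNIV. g (Inr b))" for g :: "'d + 'd \<Rightarrow> real"
      unfolding U by (subst sum.union_disjoint) (auto simp: sum.reindex)
    show ?thesis
      by (cases z) (simp add: sp_def j_def UA_def WA_def matrix_vector_mult_def sum block11_def block12_def
          block21_def block22_def vec_eq_iff)
  qed
  have "(\<integral>\<^sup>+z. \<phi> z \<partial>lborel) = (\<integral>\<^sup>+z. \<phi> (sp (j z)) \<partial>lborel)" by (simp add: spj)
  also have "\<dots> = (\<integral>\<^sup>+v. \<phi> (sp v) \<partial>lborel)" by (rule tr) measurable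
  also have "\<dots> = ennreal \<bar>det A\<bar> * (\<integral>\<^sup>+v. \<phi> (sp (A *v v)) \<partial>lborel)"
    by (rule nn_integral_lborel_matrix) (use det_nonzero in auto)
  also have "(\<integral>\<^sup>+v. \<phi> (sp (A *v v)) \<partial>lborel) = (\<integral>\<^sup>+z. \<phi> (sp (A *v j z)) \<partial>lborel)"
    by (rule tr[symmetric]) measurable
  finally show "(\<integral>\<^sup>+z. \<phi> z \<partial>lborel) = ennreal \<bar>det A\<bar> * (\<integral>\<^sup>+z. \<phi> (UA z, WA z) \<partial>lborel)"
    unfolding Aj .
qed

sublocale wigner_geometry UA WA YA "\<bar>det A12\<bar>" "\<bar>det A22\<bar>" "\<bar>det A\<bar>"
proof
  show "UA \<in> borel_measurable borel" "WA \<in> borel_measurable borel" "YA \<in> borel_measurable borel"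
    unfolding UA_def[abs_def] WA_def[abs_def] YA_def[abs_def] by measurable
  show "affine_scaling (\<lambda>y. UA (x, y)) \<bar>det A12\<bar>" "affine_scaling (\<lambda>y. WA (x, y)) \<bar>det A22\<bar>" for x
    unfolding UA_def WA_def fst_conv snd_conv by (rule affine_scalingI, rule det_nonzero)+
  show "affine_scaling (\<lambda>z. (UA z, WA z)) \<bar>det A\<bar>" by (rule UW_affine_scaling)
  show "YA (x, UA (x, y)) = y" for x y by (simp add: YA_def UA_def matrix_inv_cancel A12_invertible)
qed

text \<open>Conjugation reverses the character and moves the conjugate from \<open>f\<close> to
  \<open>g\<close>. The pairing against \<sigma> is therefore bilinear in \<open>f\<close> and the
  conjugate of the test function.\<close>

lemma cnj_matrix_wigner: "cnj (matrix_wigner A g f z) = T f (\<lambda>x. cnj (g x)) z"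
  unfolding matrix_wigner_def T_def case_prod_unfold
  by (subst Bochner_Integration.integral_cnj[symmetric])
    (simp add: UA_def WA_def cis_cnj mult.assoc)

lemma psido_eq: "psido A (L2_pairing s) f g = (\<integral>z. s z * T f (\<lambda>x. cnj (g x)) z \<partial>lborel)"
  by (simp add: psido_def L2_pairing_def cnj_matrix_wigner)

text \<open>The operator bound concerns bounded integrable functions. Elements of M1 are exchanged
  for such representatives, which changes neither the norms nor the values of \<open>T\<close>, and
  the resulting \<open>h\<close> represents the functional on all of M1.\<close>

lemma psido_bounded:
  fixes \<gamma> :: "real^'d \<Rightarrow> complex"
  assumes \<gamma>: "\<gamma> \<in> schwartz" "\<gamma> x0 \<noteq> 0" and s: "s \<in> Lp_space q" and f: "f \<in> M1 \<gamma>"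
    and p: "1 \<le> p" "1 / p + 1 / p' = 1" and q: "1 \<le> q" "1 / q + 1 / q' = 1"
    and pq: "q \<le> 2" "q \<le> p" "p \<le> q'"
  shows "functional_Lp_norm \<gamma> p (psido A (L2_pairing s) f) \<le> ennreal (bound_const p p' q' * Lp_norm q s * Lp_norm p f)"
proof -
  have [measurable]: "f \<in> borel_measurable borel" using f by (simp add: M1_def)
  obtain f' where f': "nice f'" "AE x in lborel. f x = f' x" by (rule M1_AE_nice[OF \<gamma> f])
  have [measurable]: "f' \<in> borel_measurable borel" using f' by (simp add: niceD)
  have nf: "Lp_norm p f = Lp_norm p f'" by (rule Lp_space_cong_AE(2)) (use f' in auto)
  obtain h where h: "h \<in> Lp_space p" "Lp_norm p h \<le> bound_const p p' q' * (Lp_norm q s * Lp_norm p f')"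
    "\<And>g. nice g \<Longrightarrow> (\<integral>z. s z * T f' g z \<partial>lborel) = (\<integral>u. h u * g u \<partial>lborel)"
    by (rule operator_bounded[OF s f'(1) p q pq]) blast
  have [measurable]: "h \<in> borel_measurable borel" using h(1) by measurable
  have "psido A (L2_pairing s) f g = L2_pairing h g" if g: "g \<in> M1 \<gamma>" for g
  proof -
    have [measurable]: "g \<in> borel_measurable borel" using g by (simp add: M1_def)
    obtain g' where g': "nice g'" "AE x in lborel. g x = g' x" by (rule M1_AE_nice[OF \<gamma> g])
    have [measurable]: "g' \<in> borel_measurable borel" using g' by (simp add: niceD)
    have "T f (\<lambda>x. cnj (g x)) z = T f' (\<lambda>x. cnj (g' x)) z" for z
      by (rule T_cong_AE) (use f' g' in auto)
    then have "psido A (L2_pairing s) f g = (\<integral>u. h u * cnj (g' u) \<partial>lborel)"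
      unfolding psido_eq using h(3)[OF nice_cnj[OF g'(1)]] by simp
    also have "\<dots> = L2_pairing h g"
      unfolding L2_pairing_def by (rule integral_cong_AE) (use g' in auto)
    finally show ?thesis .
  qed
  then have "functional_Lp_norm \<gamma> p (psido A (L2_pairing s) f) \<le> ennreal (Lp_norm p h)"
    unfolding functional_Lp_norm_def using h(1) by (intro Inf_lower) blast
  also have "\<dots> \<le> ennreal (bound_const p p' q' * Lp_norm q s * Lp_norm p f)"
    using h(2) nf by (intro ennreal_leI) (simp add: mult.assoc)
  finally show ?thesis .
qed

text \<open>Upper half of the necessity argument: assumed continuity, tested on the shear-adapted
  symbol and two Gaussians of independent widths, with every norm replaced by the power of its width
  parameter.\<close>

lemma gauss_test:
  fixes \<gamma> :: "real^'d \<Rightarrow> complex" and N :: "real^'d \<Rightarrow> real^'d"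
  assumes \<gamma>: "\<gamma> \<in> schwartz" and C: "0 < C"
    and cont: "\<forall>s\<in>Lp_space q. \<forall>f\<in>M1 \<gamma>.
      functional_Lp_norm \<gamma> p (psido A (L2_pairing s) f) \<le> ennreal (C * Lp_norm q s * Lp_norm p f)"
    and p: "1 \<le> p" "1 / p + 1 / p' = 1" and q: "1 \<le> q" and N: "linear N"
    and abl: "0 < a" "0 < b" "0 < l"
  shows "norm (\<integral>z. test_symbol N l z * T (\<lambda>x. of_real (gauss a x)) (\<lambda>x. of_real (gauss b x)) z \<partial>lborel)
    \<le> C * l powr (- (real CARD('d) * enn2real (1 / q))) * a powr (- (real CARD('d) * enn2real (1 / p)))
       * b powr (- (real CARD('d) * enn2real (1 / p')))"
proof -
  let ?f = "\<lambda>x :: real^'d. complex_of_real (gauss a x)" and ?g = "\<lambda>x :: real^'d. complex_of_real (gauss b x)"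
  have Nm: "N \<in> borel_measurable borel"
    using N by (intro borel_measurable_continuous_onI linear_continuous_on) (simp add: linear_conv_bounded_linear)
  note s = test_symbol_Lp[OF Nm abl(3) q]
  have "norm (psido A (L2_pairing (test_symbol N l)) ?f ?g) \<le> (C * Lp_norm q (test_symbol N l) * Lp_norm p ?f) * Lp_norm p' ?g"
    by (rule functional_Lp_norm_pairing[OF cont[rule_format, OF s(1) gauss_M1[OF \<gamma> abl(1)]] _ gauss_M1[OF \<gamma> abl(2)] gauss_nice[OF abl(2)] p])
      (use C in auto)
  also have "\<dots> \<le> (C * l powr (- (real DIM(real^'d) * enn2real (1 / q))) * a powr (- (real DIM(real^'d) * enn2real (1 / p))))
       * b powr (- (real DIM(real^'d) * enn2real (1 / p')))"
    using C abl p q by (intro mult_mono s(2) gauss_Lp_norm_le conjugate_exponents(1)[OF p] mult_nonneg_nonneg) auto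
  finally show ?thesis by (simp add: psido_eq)
qed

text \<open>Concentrating \<open>f\<close> makes the upper bound scale as l to the power d (1/p -
  1/q), concentrating \<open>g\<close> as l to the power d (1/p' - 1/q), with d the dimension. The
  lower bound is independent of l, so neither exponent can be positive.\<close>

lemma quantization_continuous_imp:
  fixes \<gamma> :: "real^'d \<Rightarrow> complex"
  assumes \<gamma>: "\<gamma> \<in> schwartz" and qc: "quantization_continuous \<gamma> A q p"
    and p: "1 \<le> p" "1 / p + 1 / p' = 1" and q: "1 \<le> q"
  shows "enn2real (1 / p) \<le> enn2real (1 / q)" "enn2real (1 / p') \<le> enn2real (1 / q)"
proof -
  obtain C where C: "0 < C" "\<forall>s\<in>Lp_space q. \<forall>f\<in>M1 \<gamma>.
      functional_Lp_norm \<gamma> p (psido A (L2_pairing s) f) \<le> ennreal (C * Lp_norm q s * Lp_norm p f)"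
    using qc by (auto simp: quantization_continuous_def)
  note test = gauss_test[OF \<gamma> C p q]
  have lin: "linear (\<lambda>x. B *v x)" for B :: "real^'d^'d" by (rule matrix_vector_mul_linear)
  have inv: "(1 / l) powr (- x) = l powr x" if "0 < l" for l x :: real
    using that by (simp add: powr_divide powr_minus inverse_eq_divide)
  have d: "0 < real CARD('d)" by simp
  have scR: "affine_scaling (\<lambda>x. A12 *v x) \<bar>det A12\<bar>" "affine_scaling (\<lambda>x. A22 *v x) \<bar>det A22\<bar>"
    using affine_scalingI[of A12 0] affine_scalingI[of A22 0] det_nonzero by simp_all
  show "enn2real (1 / p) \<le> enn2real (1 / q)"
  proof -
    \<comment> \<open>Solves A22 N = A21, so that \<open>WA (x, y)\<close> is A22 (y + N x) and
      \<open>UA (x, y)\<close> is (A11 - A12 N) x + A12 (y + N x). The concentrated factor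
      \<open>f\<close> then depends on y + N x alone.\<close>
    define N where "N x = matrix_inv A22 *v (A21 *v x)" for x
    have linN: "linear N" unfolding N_def by (rule linear_compose[OF lin lin, unfolded o_def])
    have linM: "linear (\<lambda>x. A11 *v x - A12 *v (N x))"
      by (intro linear_compose_sub lin linear_compose[OF linN lin, unfolded o_def])
    obtain c0 where c0: "0 < c0" "\<And>l. 0 < l \<Longrightarrow> l \<le> 1 \<Longrightarrow> c0 \<le> norm (\<integral>z. test_symbol N l z *
        (\<integral>y. cis (2 * pi * (snd z \<bullet> y)) * of_real (gauss 1 (A11 *v fst z - A12 *v N (fst z) + A12 *v (y + N (fst z))) * gauss (1 / l) (A22 *v (y + N (fst z)))) \<partial>lborel) \<partial>lborel)"
      by (rule test_symbol_lower_bound[OF linM lin lin linN scR(2)]) blast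
    have eq: "(\<integral>y. cis (2 * pi * (snd z \<bullet> y)) * of_real (gauss 1 (A11 *v fst z - A12 *v N (fst z) + A12 *v (y + N (fst z))) * gauss (1 / l) (A22 *v (y + N (fst z)))) \<partial>lborel)
      = T (\<lambda>x. of_real (gauss (1 / l) x)) (\<lambda>x. of_real (gauss 1 x)) z" for z l
      unfolding T_def by (simp add: UA_def WA_def matrix_vector_right_distrib N_def matrix_inv_cancel A22_invertible add.commute)
    have "c0 \<le> C * l powr (real CARD('d) * (enn2real (1 / p) - enn2real (1 / q)))" if l: "0 < l" "l \<le> 1" for l
    proof -
      have "c0 \<le> C * l powr (- (real CARD('d) * enn2real (1 / q))) * (1 / l) powr (- (real CARD('d) * enn2real (1 / p)))
         * 1 powr (- (real CARD('d) * enn2real (1 / p')))"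
        using c0(2)[OF l] test[OF linN, of "1 / l" 1 l] l unfolding eq by simp
      also have "\<dots> = C * (l powr (- (real CARD('d) * enn2real (1 / q))) * l powr (real CARD('d) * enn2real (1 / p)))"
        unfolding inv[OF l(1)] by simp
      also have "\<dots> = C * l powr (real CARD('d) * (enn2real (1 / p) - enn2real (1 / q)))"
        unfolding powr_add[symmetric] by (simp add: algebra_simps)
      finally show ?thesis .
    qed
    from powr_exponent_nonpos[OF c0(1) this] d show ?thesis by (simp add: mult_le_0_iff)
  qed
  show "enn2real (1 / p') \<le> enn2real (1 / q)"
  proof -
    \<comment> \<open>The mirror image, with A12 N = A11: now the concentrated factor is
      \<open>g\<close>, composed with \<open>UA\<close>, and the two block rows exchange their
      roles.\<close>
    define N where "N x = matrix_inv A12 *v (A11 *v x)" for x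
    have linN: "linear N" unfolding N_def by (rule linear_compose[OF lin lin, unfolded o_def])
    have linM: "linear (\<lambda>x. A21 *v x - A22 *v (N x))"
      by (intro linear_compose_sub lin linear_compose[OF linN lin, unfolded o_def])
    obtain c0 where c0: "0 < c0" "\<And>l. 0 < l \<Longrightarrow> l \<le> 1 \<Longrightarrow> c0 \<le> norm (\<integral>z. test_symbol N l z *
        (\<integral>y. cis (2 * pi * (snd z \<bullet> y)) * of_real (gauss 1 (A21 *v fst z - A22 *v N (fst z) + A22 *v (y + N (fst z))) * gauss (1 / l) (A12 *v (y + N (fst z)))) \<partial>lborel) \<partial>lborel)"
      by (rule test_symbol_lower_bound[OF linM lin lin linN scR(1)]) blast
    have eq: "(\<integral>y. cis (2 * pi * (snd z \<bullet> y)) * of_real (gauss 1 (A21 *v fst z - A22 *v N (fst z) + A22 *v (y + N (fst z))) * gauss (1 / l) (A12 *v (y + N (fst z)))) \<partial>lborel)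
      = T (\<lambda>x. of_real (gauss 1 x)) (\<lambda>x. of_real (gauss (1 / l) x)) z" for z l
      unfolding T_def by (simp add: UA_def WA_def matrix_vector_right_distrib N_def matrix_inv_cancel A12_invertible add.commute mult.commute[of "complex_of_real (gauss 1 _)"])
    have "c0 \<le> C * l powr (real CARD('d) * (enn2real (1 / p') - enn2real (1 / q)))" if l: "0 < l" "l \<le> 1" for l
    proof -
      have "c0 \<le> C * l powr (- (real CARD('d) * enn2real (1 / q))) * 1 powr (- (real CARD('d) * enn2real (1 / p)))
         * (1 / l) powr (- (real CARD('d) * enn2real (1 / p')))"
        using c0(2)[OF l] test[OF linN, of 1 "1 / l" l] l unfolding eq by simp
      also have "\<dots> = C * (l powr (- (real CARD('d) * enn2real (1 / q))) * l powr (real CARD('d) * enn2real (1 / p')))"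
        unfolding inv[OF l(1)] by simp
      also have "\<dots> = C * l powr (real CARD('d) * (enn2real (1 / p') - enn2real (1 / q)))"
        unfolding powr_add[symmetric] by (simp add: algebra_simps)
      finally show ?thesis .
    qed
    from powr_exponent_nonpos[OF c0(1) this] d show ?thesis by (simp add: mult_le_0_iff)
  qed
qed

lemma bound_const_eq:
  "bound_const p p' q' = 1 / (\<bar>det A\<bar> powr enn2real (1 / q')
     * \<bar>det A12\<bar> powr (enn2real (1 / p') - enn2real (1 / q'))
     * \<bar>det A22\<bar> powr (enn2real (1 / p) - enn2real (1 / q')))"
  by (simp only: bound_const_def powr_minus inverse_mult_distrib inverse_eq_divide[symmetric])

end

theorem theorem15:
  fixes A :: "real^('d::finite + 'd)^('d + 'd)"
    and \<gamma> :: "real^'d \<Rightarrow> complex"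
    and p p' q q' :: ennreal
  assumes "\<gamma> \<in> schwartz" and "\<exists>x. \<gamma> x \<noteq> 0"
    and "invertible A" and "right_regular A"
    and "1 \<le> p" and "1 \<le> q"
    and "1 / p + 1 / p' = 1" and "1 / q + 1 / q' = 1"
  shows "(quantization_continuous \<gamma> A q p \<longleftrightarrow> q \<le> 2 \<and> q \<le> p \<and> p \<le> q') \<and>
    (q \<le> 2 \<and> q \<le> p \<and> p \<le> q' \<longrightarrow>
      (\<forall>s \<in> Lp_space q.
        operator_Lp_norm \<gamma> p (psido A (L2_pairing s)) \<le>
          ennreal (Lp_norm q s /
            (\<bar>det A\<bar> powr enn2real (1 / q')
             * \<bar>det (block12 A)\<bar> powr (enn2real (1 / p') - enn2real (1 / q'))
             * \<bar>det (block22 A)\<bar> powr (enn2real (1 / p) - enn2real (1 / q'))))))"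
proof -
  interpret right_regular_matrix A by standard (use assms in auto)
  obtain x0 where x0: "\<gamma> x0 \<noteq> 0" using assms by blast
  note p = \<open>1 \<le> p\<close> \<open>1 / p + 1 / p' = 1\<close> and q = \<open>1 \<le> q\<close> \<open>1 / q + 1 / q' = 1\<close>
  have bound: "functional_Lp_norm \<gamma> p (psido A (L2_pairing s) f) \<le> ennreal (bound_const p p' q' * Lp_norm q s * Lp_norm p f)"
    if "q \<le> 2 \<and> q \<le> p \<and> p \<le> q'" "s \<in> Lp_space q" "f \<in> M1 \<gamma>" for s f
    using that psido_bounded[OF assms(1) x0 _ _ p q] by blast
  have "q \<le> 2 \<and> q \<le> p \<and> p \<le> q'" if qc: "quantization_continuous \<gamma> A q p"
  proof -
    note * = quantization_continuous_imp[OF assms(1) qc p q(1)]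
    note c = conjugate_exponents[OF p] conjugate_exponents[OF q]
    have two: "enn2real (1 / 2) = 1 / 2"
    proof -
      have "(1::ennreal) \<le> 2" by simp
      then show ?thesis by (cases "2 :: ennreal" rule: exponent_cases) auto
    qed
    have "q \<le> p" using reciprocal_antimono[OF p(1) q(1)] * by blast
    \<comment> \<open>Adding 1/p \<le> 1/q and 1/p' \<le> 1/q gives 1 \<le> 2/q; taking complements
      in the second inequality gives 1/q' \<le> 1/p.\<close>
    moreover have "enn2real (1 / 2) \<le> enn2real (1 / q)" unfolding two using *(1,2) c(2) by linarith
    then have "q \<le> 2" using reciprocal_antimono[of 2 q] q(1) by simp
    moreover have "enn2real (1 / q') \<le> enn2real (1 / p)" using *(2) c(2,4) by linarith
    then have "p \<le> q'" using reciprocal_antimono[OF c(3) p(1)] by blast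
    ultimately show ?thesis by blast
  qed
  moreover have "quantization_continuous \<gamma> A q p" if "q \<le> 2 \<and> q \<le> p \<and> p \<le> q'"
    unfolding quantization_continuous_def using bound[OF that] bound_const_pos by blast
  moreover have "operator_Lp_norm \<gamma> p (psido A (L2_pairing s)) \<le> ennreal (bound_const p p' q' * Lp_norm q s)"
    if "q \<le> 2 \<and> q \<le> p \<and> p \<le> q'" "s \<in> Lp_space q" for s
    unfolding operator_Lp_norm_def
  proof (rule Inf_lower, intro CollectI exI conjI ballI)
    show "0 \<le> bound_const p p' q' * Lp_norm q s" using bound_const_pos[of p p' q'] by simp
    show "functional_Lp_norm \<gamma> p (psido A (L2_pairing s) f) \<le> ennreal (bound_const p p' q' * Lp_norm q s * Lp_norm p f)"
      if "f \<in> M1 \<gamma>" for f by (rule bound) fact+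
  qed simp
  moreover have "Lp_norm q s / (\<bar>det A\<bar> powr enn2real (1 / q')
     * \<bar>det A12\<bar> powr (enn2real (1 / p') - enn2real (1 / q'))
     * \<bar>det A22\<bar> powr (enn2real (1 / p) - enn2real (1 / q'))) = bound_const p p' q' * Lp_norm q s" for s :: "(real^'d) \<times> (real^'d) \<Rightarrow> complex"
    unfolding bound_const_eq by simp
  ultimately show ?thesis by metis
qed

end
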